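(* Let $2\le p<\infty$. Let $p_{m,k}^H\in V_m^H$ be the reduced solution, and let $\beta_p$, $L_p$ be the inf-sup stability factor and the Lipschitz constant at $p_{m,k}^H$ defined in the context. Set $$\tau_{m,p}^k:=\frac{2L_p}{\beta_p^2}\Big(\|F(p_{m,k}^H)-P_k^L[F(p_{m,k}^H)]\|_{W^{-1,p}(\Omega)}+\|P_k^L[F(p_{m,k}^H)]\|_{W^{-1,p}(\Omega)}\Big).$$ If $\tau_{m,p}^k<1$, then there exists a unique solution $p^{H\times h}\in B(p_{m,k}^H,\beta_p/L_p)$ of $$\langle F(p^{H\times h}),v^{H\times h}\rangle=0\quad\text{for all }v^{H\times h}\in V^{H\times h},$$ and the following a posteriori error estimate holds: $$|p^{H\times h}-p_{m,k}^H|_{W^{1,p}(\Omega)}\le\Delta_{m,p}^k:=\frac{\beta_p}{L_p}\Big(1-\sqrt{1-\tau_{m,p}^k}\Big).$$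
   Context: Domain and problem. $\Omega=\Omega_{1D}\times\omega\subset\mathbb R^2$, $\Omega_{1D}=(x_0,x_1)$, $\omega=(y_0,y_1)$. $A$ is a nonlinear elliptic operator, $f$ a given right-hand side, and the full problem is posed with homogeneous Dirichlet conditions: $\langle F(w),v\rangle:=\langle A(w),v\rangle-\langle f,v\rangle=0$ for all test functions $v$. $F$ is considered as a mapping from $W^{1,p}_0(\Omega)$ to $W^{-1,p}(\Omega)=(W_0^{1,q}(\Omega))'$, $1/p+1/q=1$, with Fréchet derivative $F'$. Discrete spaces. $V^{H\times h}$ is the tensor-product finite element space of continuous functions on $\Omega$, vanishing on $\partial\Omega$, that are on every rectangle of the product $\mathcal T_H\times\tau_h$ of a partition of $\Omega_{1D}$ and a partition of $\omega$ polynomials of degree at most $r$ in $x$ and at most $s$ in $y$. $X^H\subset H_0^1(\Omega_{1D})$ and $Y^h\subset H^1_0(\omega)$ are the corresponding one-dimensional conforming finite element spaces; $\phi_1,\dots,\phi_m\in Y^h$ are $L^2(\omega)$-orthonormal, and $V_m^H=\{\sum_{j=1}^m\bar v_j(x)\phi_j(y):\bar v_j\in X^H\}\subset V^{H\times h}$. Operator approximation and reduced solution. $\kappa_1,\dots,\kappa_k$ are $L^2(\omega)$-orthonormal (collateral basis) functions, $\mathfrak I$ a partition of $\omega$ into intervals, and for each $I\in\mathfrak I$, $\sigma_j^I$ ($1\le j\le k_I$) are linear interpolating functionals on functions on $I$ and $\vartheta_j^I\in\mathrm{span}\{\kappa_1|_I,\dots,\kappa_k|_I\}$ (extended by zero)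 satisfy $\sigma_i^I(\vartheta_j^I)=\delta_{ij}$. With $L=\sum_Ik_I$, the empirical projection of $A(w)$ is $$P_k^L[A(w)](x,y)=\sum_{n=1}^k\sum_{I\in\mathfrak I}\sum_{j=1}^{k_I}\sigma_j^I(A(w)(x,\cdot))\int_\omega\vartheta_j^I(z)\kappa_n(z)\,dz\;\kappa_n(y)$$ (applied component-wise to $u_1,u_2$, where necessary, when $\langle A(w),v\rangle=\int_\Omega u_1\partial_xv+u_2\partial_yv$), and $\langle P_k^L[F(w)],v\rangle=\langle P_k^L[A(w)],v\rangle-\langle f,v\rangle$. The reduced solution $p_{m,k}^H\in V_m^H$ satisfies $\langle P_k^L[F(p_{m,k}^H)],v\rangle=0$ for all $v\in V_m^H$. Norms and constants. $|\cdot|_{W^{1,p}(\Omega)}$ is the $W^{1,p}$-seminorm, $\|\cdot\|_{W^{-1,p}(\Omega)}$ the dual norm on $W^{-1,p}(\Omega)$, $\|\cdot\|_{W^{1,p}(\Omega),W^{-1,p}(\Omega)}$ the associated operator norm. For $R\in\mathbb R^+$, $B(p_{m,k}^H,R)=\{w\in V^{H\times h}:|w-p_{m,k}^H|_{W^{1,p}(\Omega)}\le R\}$. With $\langle\cdot,\cdot\rangle$ the dual pairing of $W^{-1,p}(\Omega)$ and $W^{1,q}(\Omega)$, $$\beta_p:=\inf_{\substack{w\in V^{H\times h}\\|w|_{W^{1,p}(\Omega)}\ne0}}\ \sup_{\substack{v\in V^{H\times h}\\|v|_{W^{1,q}(\Omega)}\ne0}}\frac{\langle F'(p_{m,k}^H)w,v\rangle}{|w|_{W^{1,p}(\Omega)}|v|_{W^{1,q}(\Omega)}},\qquad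 L_p:=\sup_{w\in B(p_{m,k}^H,R)}\frac{\|F'(w)-F'(p_{m,k}^H)\|_{W^{1,p}(\Omega),W^{-1,p}(\Omega)}}{|w-p_{m,k}^H|_{W^{1,p}(\Omega)}}.$$
   Formalization: The formal theorem additionally assumes β_p/L_p ≤ R, so that L_p controls F' on the whole ball B(p_{m,k}^H, β_p/L_p); without this uniqueness can fail. It also assumes that β_p and L_p are finite and positive, as the formulas require. *)

theory Defs
  imports "HOL-Analysis.Analysis"
begin

section \<open>Sobolev spaces\<close>

text \<open>Elements of function spaces over an open set are represented by functions on the whole
  space; only the values on that set matter, and functions equal almost everywhere there are not
  identified.\<close>

definition in_Lp :: "'a::euclidean_space set \<Rightarrow> real \<Rightarrow> ('a \<Rightarrow> real) \<Rightarrow> bool" where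
  "in_Lp \<Omega> p f \<longleftrightarrow>
     set_borel_measurable lborel \<Omega> f \<and> set_integrable lborel \<Omega> (\<lambda>z. \<bar>f z\<bar> powr p)"

definition locally_integrable :: "'a::euclidean_space set \<Rightarrow> ('a \<Rightarrow> real) \<Rightarrow> bool" where
  "locally_integrable \<Omega> f \<longleftrightarrow> (\<forall>K. compact K \<and> K \<subseteq> \<Omega> \<longrightarrow> set_integrable lborel K f)"

primrec Ck :: "nat \<Rightarrow> ('a::euclidean_space \<Rightarrow> real) \<Rightarrow> bool" where
  "Ck 0 f \<longleftrightarrow> continuous_on UNIV f"
| "Ck (Suc k) f \<longleftrightarrow> continuous_on UNIV f \<and>
     (\<forall>e\<in>Basis. \<exists>f'. Ck k f' \<and>
        (\<forall>z. ((\<lambda>t. f (z + t *\<^sub>R e)) has_real_derivative f' z) (at 0)))"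

definition test_functions :: "'a::euclidean_space set \<Rightarrow> ('a \<Rightarrow> real) set" where
  "test_functions \<Omega> =
     {\<phi>. (\<forall>k. Ck k \<phi>) \<and> (\<exists>K. compact K \<and> K \<subseteq> \<Omega> \<and> (\<forall>z. z \<notin> K \<longrightarrow> \<phi> z = 0))}"

definition has_weak_partial ::
    "'a::euclidean_space set \<Rightarrow> 'a \<Rightarrow> ('a \<Rightarrow> real) \<Rightarrow> ('a \<Rightarrow> real) \<Rightarrow> bool" where
  "has_weak_partial \<Omega> e w g \<longleftrightarrow> locally_integrable \<Omega> w \<and> locally_integrable \<Omega> g \<and>
     (\<forall>\<phi>\<in>test_functions \<Omega>.
        (LINT z:\<Omega>|lborel. w z * deriv (\<lambda>t. \<phi> (z + t *\<^sub>R e)) 0) = - (LINT z:\<Omega>|lborel. g z * \<phi> z))"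

text \<open>The weak derivative is only determined up to null sets; this is an arbitrary version.\<close>

definition weak_partial :: "'a::euclidean_space set \<Rightarrow> 'a \<Rightarrow> ('a \<Rightarrow> real) \<Rightarrow> 'a \<Rightarrow> real" where
  "weak_partial \<Omega> e w = (SOME g. has_weak_partial \<Omega> e w g)"

definition W1p :: "'a::euclidean_space set \<Rightarrow> real \<Rightarrow> ('a \<Rightarrow> real) set" where
  "W1p \<Omega> p = {w. in_Lp \<Omega> p w \<and> (\<forall>e\<in>Basis. \<exists>g. has_weak_partial \<Omega> e w g \<and> in_Lp \<Omega> p g)}"

definition W1p_seminorm :: "'a::euclidean_space set \<Rightarrow> real \<Rightarrow> ('a \<Rightarrow> real) \<Rightarrow> real" where
  "W1p_seminorm \<Omega> p w =
     (\<Sum>e\<in>Basis. LINT z:\<Omega>|lborel. \<bar>weak_partial \<Omega> e w z\<bar> powr p) powr (1 / p)"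

definition W1p_norm :: "'a::euclidean_space set \<Rightarrow> real \<Rightarrow> ('a \<Rightarrow> real) \<Rightarrow> real" where
  "W1p_norm \<Omega> p w =
     ((LINT z:\<Omega>|lborel. \<bar>w z\<bar> powr p)
       + (\<Sum>e\<in>Basis. LINT z:\<Omega>|lborel. \<bar>weak_partial \<Omega> e w z\<bar> powr p)) powr (1 / p)"

definition W1p0 :: "'a::euclidean_space set \<Rightarrow> real \<Rightarrow> ('a \<Rightarrow> real) set" where
  "W1p0 \<Omega> p = {w \<in> W1p \<Omega> p. \<exists>\<phi>. (\<forall>n. \<phi> n \<in> test_functions \<Omega>) \<and>
     (\<lambda>n::nat. W1p_norm \<Omega> p (\<lambda>z. \<phi> n z - w z)) \<longlonglongrightarrow> 0}"

text \<open>\<open>W_dual \<Omega> q\<close> is the dual of \<open>W1p0 \<Omega> q\<close>, i.e. the space of order -1 with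
  the exponent conjugate to \<open>q\<close>. On bounded domains the seminorm is a norm on \<open>W1p0 \<Omega> q\<close>
  equivalent to the full norm; all dual and operator norms below are taken with respect to it.\<close>

definition W_dual :: "'a::euclidean_space set \<Rightarrow> real \<Rightarrow> (('a \<Rightarrow> real) \<Rightarrow> real) set" where
  "W_dual \<Omega> q = {\<Phi>.
     (\<forall>v\<in>W1p0 \<Omega> q. \<forall>w\<in>W1p0 \<Omega> q. \<Phi> (\<lambda>z. v z + w z) = \<Phi> v + \<Phi> w) \<and>
     (\<forall>v\<in>W1p0 \<Omega> q. \<forall>c. \<Phi> (\<lambda>z. c * v z) = c * \<Phi> v) \<and>
     (\<exists>C. \<forall>v\<in>W1p0 \<Omega> q. \<bar>\<Phi> v\<bar> \<le> C * W1p_seminorm \<Omega> q v)}"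

definition dual_norm :: "'a::euclidean_space set \<Rightarrow> real \<Rightarrow> (('a \<Rightarrow> real) \<Rightarrow> real) \<Rightarrow> real" where
  "dual_norm \<Omega> q \<Phi> =
     (SUP v\<in>{v \<in> W1p0 \<Omega> q. W1p_seminorm \<Omega> q v \<noteq> 0}. \<bar>\<Phi> v\<bar> / W1p_seminorm \<Omega> q v)"

definition bounded_operator :: "'a::euclidean_space set \<Rightarrow> real \<Rightarrow> real \<Rightarrow>
    (('a \<Rightarrow> real) \<Rightarrow> ('a \<Rightarrow> real) \<Rightarrow> real) \<Rightarrow> bool" where
  "bounded_operator \<Omega> p q T \<longleftrightarrow>
     (\<forall>h\<in>W1p0 \<Omega> p. T h \<in> W_dual \<Omega> q) \<and>
     (\<forall>g\<in>W1p0 \<Omega> p. \<forall>h\<in>W1p0 \<Omega> p. \<forall>v\<in>W1p0 \<Omega> q. T (\<lambda>z. g z + h z) v = T g v + T h v) \<and>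
     (\<forall>h\<in>W1p0 \<Omega> p. \<forall>c. \<forall>v\<in>W1p0 \<Omega> q. T (\<lambda>z. c * h z) v = c * T h v) \<and>
     (\<exists>C. \<forall>h\<in>W1p0 \<Omega> p. dual_norm \<Omega> q (T h) \<le> C * W1p_seminorm \<Omega> p h)"

definition operator_norm :: "'a::euclidean_space set \<Rightarrow> real \<Rightarrow> real \<Rightarrow>
    (('a \<Rightarrow> real) \<Rightarrow> ('a \<Rightarrow> real) \<Rightarrow> real) \<Rightarrow> real" where
  "operator_norm \<Omega> p q T =
     (SUP h\<in>{h \<in> W1p0 \<Omega> p. W1p_seminorm \<Omega> p h \<noteq> 0}.
        dual_norm \<Omega> q (T h) / W1p_seminorm \<Omega> p h)"

definition has_frechet_derivative_at :: "'a::euclidean_space set \<Rightarrow> real \<Rightarrow> real \<Rightarrow>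
    (('a \<Rightarrow> real) \<Rightarrow> ('a \<Rightarrow> real) \<Rightarrow> real) \<Rightarrow> (('a \<Rightarrow> real) \<Rightarrow> ('a \<Rightarrow> real) \<Rightarrow> real) \<Rightarrow>
    ('a \<Rightarrow> real) \<Rightarrow> bool" where
  "has_frechet_derivative_at \<Omega> p q F T w \<longleftrightarrow> bounded_operator \<Omega> p q T \<and>
     (\<forall>\<epsilon>>0. \<exists>\<delta>>0. \<forall>h\<in>W1p0 \<Omega> p. W1p_seminorm \<Omega> p h < \<delta> \<longrightarrow>
        dual_norm \<Omega> q (\<lambda>v. F (\<lambda>z. w z + h z) v - F w v - T h v) \<le> \<epsilon> * W1p_seminorm \<Omega> p h)"


section \<open>Finite element spaces\<close>

definition mesh :: "real \<Rightarrow> real \<Rightarrow> real list \<Rightarrow> bool" where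
  "mesh a b ns \<longleftrightarrow> sorted_wrt (<) ns \<and> 2 \<le> length ns \<and> hd ns = a \<and> last ns = b"

text \<open>Finite element functions vanish on the boundary and are extended by zero. Thus they are
  determined as functions on the whole space, so that uniqueness statements can be literal.\<close>

definition fe_space_1d :: "real list \<Rightarrow> nat \<Rightarrow> (real \<Rightarrow> real) set" where
  "fe_space_1d xs r = {v. continuous_on UNIV v \<and>
     (\<forall>x. x \<notin> {hd xs<..<last xs} \<longrightarrow> v x = 0) \<and>
     (\<forall>i. Suc i < length xs \<longrightarrow>
        (\<exists>c. \<forall>x\<in>{xs ! i..xs ! Suc i}. v x = (\<Sum>a\<le>r. c a * x ^ a)))}"

definition fe_space_2d :: "real list \<Rightarrow> real list \<Rightarrow> nat \<Rightarrow> nat \<Rightarrow> (real \<times> real \<Rightarrow> real) set" where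
  "fe_space_2d xs ys r s = {w. continuous_on UNIV w \<and>
     (\<forall>z. z \<notin> {hd xs<..<last xs} \<times> {hd ys<..<last ys} \<longrightarrow> w z = 0) \<and>
     (\<forall>i j. Suc i < length xs \<and> Suc j < length ys \<longrightarrow>
        (\<exists>c. \<forall>x\<in>{xs ! i..xs ! Suc i}. \<forall>y\<in>{ys ! j..ys ! Suc j}.
           w (x, y) = (\<Sum>a\<le>r. \<Sum>b\<le>s. c a b * x ^ a * y ^ b)))}"

definition L2_orthonormal :: "real set \<Rightarrow> nat \<Rightarrow> (nat \<Rightarrow> real \<Rightarrow> real) \<Rightarrow> bool" where
  "L2_orthonormal \<omega> m \<phi> \<longleftrightarrow> (\<forall>i\<in>{1..m}. in_Lp \<omega> 2 (\<phi> i)) \<and>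
     (\<forall>i\<in>{1..m}. \<forall>j\<in>{1..m}. (LINT y:\<omega>|lborel. \<phi> i y * \<phi> j y) = of_bool (i = j))"

definition reduced_space ::
    "(real \<Rightarrow> real) set \<Rightarrow> nat \<Rightarrow> (nat \<Rightarrow> real \<Rightarrow> real) \<Rightarrow> (real \<times> real \<Rightarrow> real) set" where
  "reduced_space X m \<phi> =
     {w. \<exists>v. (\<forall>j\<in>{1..m}. v j \<in> X) \<and> w = (\<lambda>(x, y). \<Sum>j=1..m. v j x * \<phi> j y)}"


section \<open>Operators and the empirical projection\<close>

text \<open>A functional given in components: \<open>u0\<close> is the part given by a function and
  \<open>(u1, u2)\<close> is the part in divergence form. The two pure cases are \<open>u1 = u2 = 0\<close> and
  \<open>u0 = 0\<close>.\<close>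

definition component_functional :: "(real \<times> real) set \<Rightarrow> (real \<times> real \<Rightarrow> real) \<Rightarrow>
    (real \<times> real \<Rightarrow> real) \<Rightarrow> (real \<times> real \<Rightarrow> real) \<Rightarrow> (real \<times> real \<Rightarrow> real) \<Rightarrow> real" where
  "component_functional \<Omega> u0 u1 u2 v =
     (LINT z:\<Omega>|lborel. u0 z * v z + u1 z * weak_partial \<Omega> (1, 0) v z
                                    + u2 z * weak_partial \<Omega> (0, 1) v z)"

definition admissible_components :: "(real \<times> real) set \<Rightarrow> real \<Rightarrow> (real \<times> real \<Rightarrow> real) \<Rightarrow>
    (real \<times> real \<Rightarrow> real) \<Rightarrow> (real \<times> real \<Rightarrow> real) \<Rightarrow> bool" where
  "admissible_components \<Omega> q u0 u1 u2 \<longleftrightarrow>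
     (\<forall>v\<in>W1p0 \<Omega> q. set_integrable lborel \<Omega> (\<lambda>z. u0 z * v z) \<and>
        set_integrable lborel \<Omega> (\<lambda>z. u1 z * weak_partial \<Omega> (1, 0) v z) \<and>
        set_integrable lborel \<Omega> (\<lambda>z. u2 z * weak_partial \<Omega> (0, 1) v z)) \<and>
     component_functional \<Omega> u0 u1 u2 \<in> W_dual \<Omega> q"

text \<open>A linear functional on functions on \<open>I\<close>. Requiring linearity on all functions
  is no restriction for a functional (e.g. a mean value) given on a subspace only, since it extends
  linearly.\<close>

definition linear_functional_on :: "real set \<Rightarrow> ((real \<Rightarrow> real) \<Rightarrow> real) \<Rightarrow> bool" where
  "linear_functional_on I \<sigma> \<longleftrightarrow>
     (\<forall>g h. \<sigma> (\<lambda>y. g y + h y) = \<sigma> g + \<sigma> h) \<and> (\<forall>c g. \<sigma> (\<lambda>y. c * g y) = c * \<sigma> g) \<and>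
     (\<forall>g h. (\<forall>y\<in>I. g y = h y) \<longrightarrow> \<sigma> g = \<sigma> h)"

definition empirical_projection :: "real set \<Rightarrow> nat \<Rightarrow> (nat \<Rightarrow> real \<Rightarrow> real) \<Rightarrow> real set set \<Rightarrow>
    (real set \<Rightarrow> nat) \<Rightarrow> (real set \<Rightarrow> nat \<Rightarrow> (real \<Rightarrow> real) \<Rightarrow> real) \<Rightarrow>
    (real set \<Rightarrow> nat \<Rightarrow> real \<Rightarrow> real) \<Rightarrow> (real \<times> real \<Rightarrow> real) \<Rightarrow> real \<times> real \<Rightarrow> real" where
  "empirical_projection \<omega> k \<kappa> \<II> kI \<sigma> \<theta> u = (\<lambda>(x, y).
     \<Sum>n=1..k. \<Sum>I\<in>\<II>. \<Sum>j=1..kI I.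
       \<sigma> I j (\<lambda>y'. u (x, y')) * (LINT z:\<omega>|lborel. \<theta> I j z * \<kappa> n z) * \<kappa> n y)"


section \<open>Stability constants\<close>

definition fe_ball :: "(real \<times> real) set \<Rightarrow> real \<Rightarrow> (real \<times> real \<Rightarrow> real) set \<Rightarrow>
    (real \<times> real \<Rightarrow> real) \<Rightarrow> real \<Rightarrow> (real \<times> real \<Rightarrow> real) set" where
  "fe_ball \<Omega> p V w0 R = {w \<in> V. W1p_seminorm \<Omega> p (\<lambda>z. w z - w0 z) \<le> R}"

definition inf_sup_constant :: "(real \<times> real) set \<Rightarrow> real \<Rightarrow> real \<Rightarrow> (real \<times> real \<Rightarrow> real) set \<Rightarrow>
    ((real \<times> real \<Rightarrow> real) \<Rightarrow> (real \<times> real \<Rightarrow> real) \<Rightarrow> real) \<Rightarrow> ereal" where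
  "inf_sup_constant \<Omega> p q V T =
     (INF w\<in>{w \<in> V. W1p_seminorm \<Omega> p w \<noteq> 0}. SUP v\<in>{v \<in> V. W1p_seminorm \<Omega> q v \<noteq> 0}.
        ereal (T w v / (W1p_seminorm \<Omega> p w * W1p_seminorm \<Omega> q v)))"

text \<open>Lipschitz constant of \<open>dF\<close> at \<open>w0\<close>; the centre itself, where the quotient
  would be 0/0, does not contribute.\<close>

definition lipschitz_constant_at :: "(real \<times> real) set \<Rightarrow> real \<Rightarrow> real \<Rightarrow>
    (real \<times> real \<Rightarrow> real) set \<Rightarrow>
    ((real \<times> real \<Rightarrow> real) \<Rightarrow> (real \<times> real \<Rightarrow> real) \<Rightarrow> (real \<times> real \<Rightarrow> real) \<Rightarrow> real) \<Rightarrow>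
    (real \<times> real \<Rightarrow> real) \<Rightarrow> real \<Rightarrow> ereal" where
  "lipschitz_constant_at \<Omega> p q V dF w0 R =
     (SUP w\<in>{w \<in> fe_ball \<Omega> p V w0 R. W1p_seminorm \<Omega> p (\<lambda>z. w z - w0 z) \<noteq> 0}.
        ereal (operator_norm \<Omega> p q (\<lambda>h v. dF w h v - dF w0 h v)
               / W1p_seminorm \<Omega> p (\<lambda>z. w z - w0 z)))"

end

theory Submission
  imports Defs "HOL-Library.Function_Algebras"
begin

text \<open>On the finite-dimensional space \<open>V\<close> the statement is the Newton-Kantorovich (Brezzi-Rappaz-Raviart)
argument. A positive inf-sup constant makes \<open>B = F'(p)\<close> injective, hence bijective, from \<open>V\<close> to its
dual, with \<open>\<bar>B\<^sup>-\<^sup>1 l\<bar> \<le> \<parallel>l\<parallel> / \<beta>\<close>, so the discrete solutions are the fixed points of the simplified Newton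
map \<open>T w = w - B\<^sup>-\<^sup>1 F(w)\<close>. Comparing \<open>F'\<close> along the segment from \<open>w\<close> to \<open>u\<close> with \<open>B\<close> gives, on the ball
of radius \<open>\<beta> / L\<close>, the bound \<open>\<bar>T u - T w\<bar> \<le> L / (2 \<beta>) (\<bar>u - p\<bar> + \<bar>w - p\<bar>) \<bar>u - w\<bar>\<close>. With \<open>\<rho>\<close> the sum of the
two residual norms, a solution at distance \<open>d\<close> from \<open>p\<close> therefore satisfies
\<open>0 \<le> L / (2 \<beta>) d\<^sup>2 - d + \<rho> / \<beta>\<close>. The roots of this quadratic are \<open>\<beta> / L (1 \<plusminus> sqrt (1 - \<tau>))\<close>; the smaller one
is \<open>\<Delta>\<close>, and \<open>\<beta> / L\<close> lies strictly between them. Hence \<open>d \<le> \<Delta>\<close> for every solution in the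
closed ball of radius \<open>\<beta> / L\<close>, while \<open>T\<close> maps the ball of radius \<open>\<Delta>\<close> into itself with contraction
factor \<open>L \<Delta> / \<beta> < 1\<close>. This is the locale \<open>discrete_newton\<close>. Both the surjectivity of \<open>B\<close> and the
completeness of \<open>V\<close> come from dual bases: the functionals \<open>B(\<cdot>, b\<^sub>i)\<close> are coordinates of \<open>V\<close> that are
bounded by the norm.

What remains is to see finite element functions as elements of the Sobolev spaces, with the
seminorm a norm on them. The seminorm is built from arbitrarily chosen weak derivatives, so
nothing can be computed before weak derivatives are known to be unique
(\<open>has_weak_partial_unique\<close>, by testing against smooth bumps on boxes). Finite element functions are
Lipschitz, vanish outside the open rectangle, and are strictly differentiable along the axes off
the mesh lines (\<open>fe_regular\<close>). For such functions the limits of the difference quotients are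
the weak derivatives, because Lebesgue measure is translation invariant
(\<open>ae_partial_has_weak_partial\<close>); shrinking the function towards the centre of the rectangle and
mollifying it produces test functions that converge in the full norm (\<open>regular_on_box_W1p0\<close>); and
integrating the derivative of \<open>x w\<^sup>2\<close> shows that a function with vanishing derivative is zero
(\<open>ae_partial_0_imp_0\<close>).\<close>

section \<open>Finite-dimensional linear algebra with dual bases\<close>

text \<open>Linearity is required on the subspace only: the functionals in question are obtained from operators on
Sobolev spaces, and nothing is known about their values at other functions.\<close>

definition linear_functional :: "'v::real_vector set \<Rightarrow> ('v \<Rightarrow> real) \<Rightarrow> bool" where
  "linear_functional V l \<longleftrightarrow> (\<forall>u\<in>V. \<forall>v\<in>V. l (u + v) = l u + l v) \<and> (\<forall>c. \<forall>u\<in>V. l (c *\<^sub>R u) = c * l u)"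

lemma linear_functional_0:
  assumes "subspace V" "linear_functional V l"
  shows "l 0 = 0"
proof -
  have "l (0 *\<^sub>R 0) = 0 * l 0"
    using assms unfolding linear_functional_def by (metis subspace_0)
  then show ?thesis by simp
qed

lemma linear_functional_diff:
  assumes V: "subspace V" and l: "linear_functional V l" and u: "u \<in> V" and v: "v \<in> V"
  shows "l (u - v) = l u - l v"
proof -
  have "l (u + (-1) *\<^sub>R v) = l u + (-1) * l v"
    using assms by (metis linear_functional_def subspace_scale)
  then show ?thesis by simp
qed

lemma linear_functional_sum:
  assumes V: "subspace V" and l: "linear_functional V l" and b: "\<And>i. i \<in> D \<Longrightarrow> b i \<in> V"
  shows "l (\<Sum>i\<in>D. c i *\<^sub>R b i) = (\<Sum>i\<in>D. c i * l (b i))"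
  using b
proof (induction D rule: infinite_finite_induct)
  case (infinite A)
  then show ?case using linear_functional_0[OF V l] by simp
next
  case empty
  then show ?case using linear_functional_0[OF V l] by simp
next
  case (insert x F)
  have "(\<Sum>i\<in>F. c i *\<^sub>R b i) \<in> V"
    using insert V by (auto intro!: subspace_sum subspace_scale)
  moreover have "c x *\<^sub>R b x \<in> V" using insert V by (auto intro!: subspace_scale)
  ultimately show ?case using insert l unfolding linear_functional_def by simp
qed

text \<open>A basis \<open>b\<close> of \<open>V\<close> together with its coordinate functionals \<open>l\<close>. Finite dimension always enters through
such a pair.\<close>

definition dual_basis :: "'v::real_vector set \<Rightarrow> 'i set \<Rightarrow> ('i \<Rightarrow> 'v \<Rightarrow> real) \<Rightarrow> ('i \<Rightarrow> 'v) \<Rightarrow> bool" where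
  "dual_basis V D l b \<longleftrightarrow> finite D \<and> (\<forall>i\<in>D. linear_functional V (l i) \<and> b i \<in> V) \<and>
     (\<forall>i\<in>D. \<forall>j\<in>D. l i (b j) = of_bool (i = j)) \<and>
     (\<forall>u\<in>V. u = (\<Sum>i\<in>D. l i u *\<^sub>R b i))"

lemma dual_basisD:
  assumes "dual_basis V D l b"
  shows "finite D" "\<And>i. i \<in> D \<Longrightarrow> linear_functional V (l i)" "\<And>i. i \<in> D \<Longrightarrow> b i \<in> V"
    "\<And>i j. i \<in> D \<Longrightarrow> j \<in> D \<Longrightarrow> l i (b j) = of_bool (i = j)"
    "\<And>u. u \<in> V \<Longrightarrow> u = (\<Sum>i\<in>D. l i u *\<^sub>R b i)"
  using assms unfolding dual_basis_def by auto

text \<open>A minimal determining subfamily is a system of coordinates: by minimality, dropping the \<open>i\<close>-th functional leaves a nonzero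
vector annihilated by all the others, and the \<open>i\<close>-th functional cannot vanish there.\<close>

lemma dual_basis_of_determining_functionals:
  assumes V: "subspace V" and E: "finite E"
    and l: "\<And>i. i \<in> E \<Longrightarrow> linear_functional V (l i)"
    and det: "\<And>u. u \<in> V \<Longrightarrow> (\<forall>i\<in>E. l i u = 0) \<Longrightarrow> u = 0"
  obtains D b where "D \<subseteq> E" "dual_basis V D l b"
proof -
  define Q where "Q D \<longleftrightarrow> D \<subseteq> E \<and> (\<forall>u\<in>V. (\<forall>i\<in>D. l i u = 0) \<longrightarrow> u = 0)" for D
  have "Q E" using det by (auto simp: Q_def)
  \<comment> \<open>subfamilies that still determine \<open>V\<close>; a smallest one is independent\<close>
  define D where "D = arg_min card Q"
  have D: "Q D" and min: "\<And>D'. Q D' \<Longrightarrow> card D \<le> card D'"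
    using arg_min_nat_lemma[of Q E card] \<open>Q E\<close> unfolding D_def by auto
  have fin: "finite D" using D E finite_subset by (auto simp: Q_def)
  have "\<exists>b\<in>V. l i b = 1 \<and> (\<forall>j\<in>D. j \<noteq> i \<longrightarrow> l j b = 0)" if i: "i \<in> D" for i
  proof -
    have "\<not> Q (D - {i})"
      using min[of "D - {i}"] card_Diff1_less[OF fin i] by linarith
    then obtain u where u: "u \<in> V" "\<forall>j\<in>D - {i}. l j u = 0" "u \<noteq> 0"
      using D by (auto simp: Q_def)
    then have nz: "l i u \<noteq> 0" using D by (auto simp: Q_def)
    have "(1 / l i u) *\<^sub>R u \<in> V" using V u by (simp add: subspace_scale)
    moreover have "l j ((1 / l i u) *\<^sub>R u) = (1 / l i u) * l j u" if "j \<in> D" for j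
      using l[of j] D that u unfolding linear_functional_def Q_def by blast
    ultimately show ?thesis using u nz i by (intro bexI[of _ "(1 / l i u) *\<^sub>R u"]) auto
  qed
  then obtain b where b: "\<And>i. i \<in> D \<Longrightarrow> b i \<in> V \<and> l i (b i) = 1 \<and> (\<forall>j\<in>D. j \<noteq> i \<longrightarrow> l j (b i) = 0)"
    by metis
  have lD: "linear_functional V (l i)" if "i \<in> D" for i
    using that D l by (auto simp: Q_def)
  have "u = (\<Sum>i\<in>D. l i u *\<^sub>R b i)" if u: "u \<in> V" for u
  proof -
    let ?s = "\<Sum>i\<in>D. l i u *\<^sub>R b i"
    have s: "?s \<in> V" using V b by (auto intro!: subspace_sum subspace_scale)
    have "l j (u - ?s) = 0" if j: "j \<in> D" for j
    proof -
      have "l j ?s = (\<Sum>i\<in>D. l i u * l j (b i))"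
        using b by (intro linear_functional_sum[OF V lD[OF j]]) auto
      also have "\<dots> = (\<Sum>i\<in>D. if i = j then l j u else 0)"
        using b j by (intro sum.cong) auto
      also have "\<dots> = l j u" using fin j by simp
      finally show ?thesis using linear_functional_diff[OF V lD[OF j] u s] by simp
    qed
    moreover have "u - ?s \<in> V" using u s V by (rule_tac subspace_diff)
    ultimately have "u - ?s = 0" using D unfolding Q_def by blast
    then show ?thesis by simp
  qed
  moreover have "\<forall>i\<in>D. \<forall>j\<in>D. l i (b j) = of_bool (i = j)" using b by auto
  ultimately have "dual_basis V D l b"
    using fin lD b unfolding dual_basis_def by auto
  then show thesis using that D by (auto simp: Q_def)
qed

text \<open>The trace of the identity, expanded in either basis, is the number of basis vectors.\<close>

lemma card_dual_basis_eq:
  assumes V: "subspace V" and b: "dual_basis V D e b" and c: "dual_basis V D' l c"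
  shows "card D = card D'"
proof -
  have "real (card D) = (\<Sum>i\<in>D. e i (b i))"
    using b by (simp add: dual_basis_def)
  also have "\<dots> = (\<Sum>i\<in>D. \<Sum>j\<in>D'. l j (b i) * e i (c j))"
  proof (rule sum.cong[OF refl])
    fix i assume i: "i \<in> D"
    have "b i = (\<Sum>j\<in>D'. l j (b i) *\<^sub>R c j)" using dual_basisD(5)[OF c dual_basisD(3)[OF b i]] .
    then have "e i (b i) = e i (\<Sum>j\<in>D'. l j (b i) *\<^sub>R c j)" by simp
    also have "\<dots> = (\<Sum>j\<in>D'. l j (b i) * e i (c j))"
      by (rule linear_functional_sum[OF V dual_basisD(2)[OF b i] dual_basisD(3)[OF c]])
    finally show "e i (b i) = (\<Sum>j\<in>D'. l j (b i) * e i (c j))" .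
  qed
  also have "\<dots> = (\<Sum>j\<in>D'. \<Sum>i\<in>D. e i (c j) * l j (b i))"
    by (subst sum.swap) (simp add: mult.commute)
  also have "\<dots> = (\<Sum>j\<in>D'. l j (c j))"
  proof (rule sum.cong[OF refl])
    fix j assume j: "j \<in> D'"
    have "c j = (\<Sum>i\<in>D. e i (c j) *\<^sub>R b i)" using dual_basisD(5)[OF b dual_basisD(3)[OF c j]] .
    then have "l j (c j) = l j (\<Sum>i\<in>D. e i (c j) *\<^sub>R b i)" by simp
    also have "\<dots> = (\<Sum>i\<in>D. e i (c j) * l j (b i))"
      by (rule linear_functional_sum[OF V dual_basisD(2)[OF c j] dual_basisD(3)[OF b]])
    finally show "(\<Sum>i\<in>D. e i (c j) * l j (b i)) = l j (c j)" by simp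
  qed
  also have "\<dots> = real (card D')" using c by (simp add: dual_basis_def)
  finally show ?thesis by simp
qed

text \<open>If \<open>B w = 0\<close> only for \<open>w = 0\<close>, the functionals \<open>B(\<cdot>, b\<^sub>i)\<close> determine \<open>V\<close>. A minimal subfamily of them has as
many members as \<open>b\<close>, so it is the whole family. This is where injectivity of \<open>B\<close> becomes surjectivity.\<close>

lemma nondegenerate_form_dual_basis:
  assumes V: "subspace V" and b: "dual_basis V D e b"
    and B1: "\<And>v. v \<in> V \<Longrightarrow> linear_functional V (\<lambda>w. B w v)"
    and B2: "\<And>w. w \<in> V \<Longrightarrow> linear_functional V (B w)"
    and nondeg: "\<And>w. w \<in> V \<Longrightarrow> (\<forall>v\<in>V. B w v = 0) \<Longrightarrow> w = 0"
  obtains c where "dual_basis V D (\<lambda>i w. B w (b i)) c"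
proof -
  have fin: "finite D" and bV: "\<And>i. i \<in> D \<Longrightarrow> b i \<in> V" using dual_basisD[OF b] by auto
  have det: "w = 0" if w: "w \<in> V" and z: "\<forall>i\<in>D. B w (b i) = 0" for w
  proof (rule nondeg[OF w], rule ballI)
    fix v assume v: "v \<in> V"
    have "v = (\<Sum>i\<in>D. e i v *\<^sub>R b i)" by (rule dual_basisD(5)[OF b v])
    then have "B w v = B w (\<Sum>i\<in>D. e i v *\<^sub>R b i)" by simp
    also have "\<dots> = (\<Sum>i\<in>D. e i v * B w (b i))"
      by (rule linear_functional_sum[OF V B2[OF w] bV])
    finally show "B w v = 0" using z by simp
  qed
  obtain D' c where D': "D' \<subseteq> D" and c: "dual_basis V D' (\<lambda>i w. B w (b i)) c"
    by (rule dual_basis_of_determining_functionals[OF V fin, of "\<lambda>i w. B w (b i)"])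
       (use det B1 bV in auto)
  have "D' = D"
    using card_dual_basis_eq[OF V b c] D' fin by (simp add: card_subset_eq)
  then show thesis using c that by blast
qed

lemma nondegenerate_form_solvable:
  assumes V: "subspace V" and b: "dual_basis V D e b" and c: "dual_basis V D (\<lambda>i w. B w (b i)) c"
    and B1: "\<And>v. v \<in> V \<Longrightarrow> linear_functional V (\<lambda>w. B w v)"
    and B2: "\<And>w. w \<in> V \<Longrightarrow> linear_functional V (B w)"
    and l: "linear_functional V l"
  shows "\<exists>w\<in>V. \<forall>v\<in>V. B w v = l v"
proof -
  have fin: "finite D" and bV: "\<And>i. i \<in> D \<Longrightarrow> b i \<in> V" and cV: "\<And>i. i \<in> D \<Longrightarrow> c i \<in> V"
    using dual_basisD(1,3)[OF b] dual_basisD(3)[OF c] by auto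
  let ?w = "\<Sum>i\<in>D. l (b i) *\<^sub>R c i"
  have w: "?w \<in> V" using V cV by (auto intro!: subspace_sum subspace_scale)
  have wb: "B ?w (b j) = l (b j)" if j: "j \<in> D" for j
  proof -
    have "B ?w (b j) = (\<Sum>i\<in>D. l (b i) * B (c i) (b j))"
      by (rule linear_functional_sum[OF V B1[OF bV[OF j]] cV])
    also have "\<dots> = (\<Sum>i\<in>D. if i = j then l (b j) else 0)"
      using c j by (intro sum.cong) (auto simp: dual_basis_def)
    also have "\<dots> = l (b j)" using fin j by simp
    finally show ?thesis .
  qed
  have "B ?w v = l v" if v: "v \<in> V" for v
  proof -
    have ve: "v = (\<Sum>i\<in>D. e i v *\<^sub>R b i)" by (rule dual_basisD(5)[OF b v])
    have "B ?w (\<Sum>i\<in>D. e i v *\<^sub>R b i) = (\<Sum>i\<in>D. e i v * B ?w (b i))"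
      by (rule linear_functional_sum[OF V B2[OF w] bV])
    also have "\<dots> = (\<Sum>i\<in>D. e i v * l (b i))" using wb by simp
    also have "\<dots> = l (\<Sum>i\<in>D. e i v *\<^sub>R b i)"
      by (rule linear_functional_sum[OF V l bV, symmetric])
    finally show ?thesis using ve by metis
  qed
  then show ?thesis using w by blast
qed

section \<open>The simplified Newton iteration on a finite-dimensional space\<close>

text \<open>The solution space, its norm \<open>N\<close>, a measure \<open>M\<close> for the size of test vectors, the nonlinear functional \<open>G\<close> with
derivative \<open>dG\<close>, and a centre \<open>c0\<close> at which \<open>dG\<close> is stable with constant \<open>\<beta>\<close> and the residual is at most \<open>\<rho>\<close>.
Derivatives are taken along lines, and the suprema that define norms and constants are replaced by the
inequalities that they encode.\<close>

locale discrete_newton =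
  fixes V :: "'v::real_vector set" and N M :: "'v \<Rightarrow> real"
    and G :: "'v \<Rightarrow> 'v \<Rightarrow> real" and dG :: "'v \<Rightarrow> 'v \<Rightarrow> 'v \<Rightarrow> real"
    and c0 :: 'v and \<beta> L \<rho> :: real and D :: "'i set" and e :: "'i \<Rightarrow> 'v \<Rightarrow> real" and b :: "'i \<Rightarrow> 'v"
  assumes V: "subspace V" and basis: "dual_basis V D e b" and c0: "c0 \<in> V"
    and N_triangle: "\<And>u v. u \<in> V \<Longrightarrow> v \<in> V \<Longrightarrow> N (u + v) \<le> N u + N v"
    and N_scale: "\<And>c u. u \<in> V \<Longrightarrow> N (c *\<^sub>R u) = \<bar>c\<bar> * N u"
    and N_definite: "\<And>u. u \<in> V \<Longrightarrow> N u = 0 \<Longrightarrow> u = 0"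
    and M_nonneg: "\<And>v. v \<in> V \<Longrightarrow> 0 \<le> M v"
    and G_linear: "\<And>w. w \<in> V \<Longrightarrow> linear_functional V (G w)"
    and dG_linear: "\<And>w h. w \<in> V \<Longrightarrow> h \<in> V \<Longrightarrow> linear_functional V (dG w h)"
      "\<And>w v. w \<in> V \<Longrightarrow> v \<in> V \<Longrightarrow> linear_functional V (\<lambda>h. dG w h v)"
    and G_deriv: "\<And>w h v. w \<in> V \<Longrightarrow> h \<in> V \<Longrightarrow> v \<in> V \<Longrightarrow>
        ((\<lambda>t. G (w + t *\<^sub>R h) v) has_real_derivative dG w h v) (at 0)"
    and dG_bounded: "\<exists>C. \<forall>h\<in>V. \<forall>v\<in>V. \<bar>dG c0 h v\<bar> \<le> C * N h * M v"
    and inf_sup: "\<And>h K. h \<in> V \<Longrightarrow> (\<And>v. v \<in> V \<Longrightarrow> \<bar>dG c0 h v\<bar> \<le> K * M v) \<Longrightarrow> \<beta> * N h \<le> K"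
    and lipschitz: "\<And>w h v. w \<in> V \<Longrightarrow> h \<in> V \<Longrightarrow> v \<in> V \<Longrightarrow> N (w - c0) \<le> \<beta> / L \<Longrightarrow>
        \<bar>dG w h v - dG c0 h v\<bar> \<le> L * N (w - c0) * N h * M v"
    and residual: "\<And>v. v \<in> V \<Longrightarrow> \<bar>G c0 v\<bar> \<le> \<rho> * M v"
    and pos: "0 < \<beta>" "0 < L" "0 \<le> \<rho>"
    and small: "2 * L / \<beta>\<^sup>2 * \<rho> < 1"
begin

lemma N_0: "N 0 = 0"
  using N_scale[of 0 0] subspace_0[OF V] by simp

lemma N_nonneg: "u \<in> V \<Longrightarrow> 0 \<le> N u"
  using N_triangle[of u "(-1) *\<^sub>R u"] N_scale[of u "-1"] subspace_scale[OF V, of u "-1"] N_0 by simp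

lemma N_minus_commute:
  assumes "u \<in> V" "v \<in> V" shows "N (u - v) = N (v - u)"
  using N_scale[of "u - v" "-1"] subspace_diff[OF V] assms by simp

lemma nondegenerate:
  assumes "w \<in> V" "\<forall>v\<in>V. dG c0 w v = 0" shows "w = 0"
proof -
  have "\<beta> * N w \<le> 0" using inf_sup[of w 0] assms by simp
  then have "N w \<le> 0" using pos by (simp add: mult_le_0_iff)
  then show ?thesis using N_nonneg[OF assms(1)] N_definite[OF assms(1)] by simp
qed

sublocale dist: Metric_space V "\<lambda>u v. if u \<in> V \<and> v \<in> V then N (u - v) else 0"
proof
  fix x y z
  show "0 \<le> (if x \<in> V \<and> y \<in> V then N (x - y) else 0)"
    using N_nonneg subspace_diff[OF V] by auto
  show "(if x \<in> V \<and> y \<in> V then N (x - y) else 0) = (if y \<in> V \<and> x \<in> V then N (y - x) else 0)"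
    using N_minus_commute by auto
  assume x: "x \<in> V" and y: "y \<in> V"
  show "((if x \<in> V \<and> y \<in> V then N (x - y) else 0) = 0) = (x = y)"
    using N_definite[of "x - y"] subspace_diff[OF V] N_0 x y by auto
  assume z: "z \<in> V"
  show "(if x \<in> V \<and> z \<in> V then N (x - z) else 0) \<le>
    (if x \<in> V \<and> y \<in> V then N (x - y) else 0) + (if y \<in> V \<and> z \<in> V then N (y - z) else 0)"
    using N_triangle[of "x - y" "y - z"] subspace_diff[OF V] x y z by simp
qed

text \<open>A Cauchy sequence has convergent coordinates \<open>dG c0 (s n) (b\<^sub>i)\<close>, since these are bounded by the norm;
the vector with the limiting coordinates is the limit.\<close>

lemma complete: "dist.mcomplete"
  unfolding dist.mcomplete_def
proof (intro allI impI)
  fix s assume s: "dist.MCauchy s"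
  then have sV: "s n \<in> V" for n unfolding dist.MCauchy_def by auto
  obtain c where c: "dual_basis V D (\<lambda>i w. dG c0 w (b i)) c"
    by (rule nondegenerate_form_dual_basis[OF V basis, of "dG c0"])
       (use dG_linear c0 nondegenerate in auto)
  obtain C where C: "\<And>h v. h \<in> V \<Longrightarrow> v \<in> V \<Longrightarrow> \<bar>dG c0 h v\<bar> \<le> C * N h * M v"
    using dG_bounded by blast
  have fin: "finite D" and bV: "\<And>i. i \<in> D \<Longrightarrow> b i \<in> V" and cV: "\<And>i. i \<in> D \<Longrightarrow> c i \<in> V"
    and rep: "\<And>u. u \<in> V \<Longrightarrow> u = (\<Sum>i\<in>D. dG c0 u (b i) *\<^sub>R c i)"
    using dual_basisD(1,3)[OF basis] dual_basisD(3,5)[OF c] by auto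
  have "\<exists>a. (\<lambda>n. dG c0 (s n) (b i)) \<longlonglongrightarrow> a" if i: "i \<in> D" for i
  proof -
    have "Cauchy (\<lambda>n. dG c0 (s n) (b i))"
    proof (rule metric_CauchyI)
      fix \<epsilon> :: real assume "\<epsilon> > 0"
      define K where "K = \<bar>C\<bar> * M (b i) + 1"
      have K: "K > 0" using M_nonneg[OF bV[OF i]] unfolding K_def by (simp add: add_nonneg_pos)
      then have "\<epsilon> / K > 0" using \<open>\<epsilon> > 0\<close> by simp
      then obtain n0 where "\<forall>m n. n0 \<le> m \<longrightarrow> n0 \<le> n \<longrightarrow>
          (if s m \<in> V \<and> s n \<in> V then N (s m - s n) else 0) < \<epsilon> / K"
        using s unfolding dist.MCauchy_def by blast
      then have n0: "\<And>m n. n0 \<le> m \<Longrightarrow> n0 \<le> n \<Longrightarrow> N (s m - s n) < \<epsilon> / K"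
        using sV by simp
      have "dist (dG c0 (s m) (b i)) (dG c0 (s n) (b i)) < \<epsilon>" if mn: "n0 \<le> m" "n0 \<le> n" for m n
      proof -
        have mn': "s m - s n \<in> V" using sV V by (simp add: subspace_diff)
        have "dist (dG c0 (s m) (b i)) (dG c0 (s n) (b i)) = \<bar>dG c0 (s m - s n) (b i)\<bar>"
          using linear_functional_diff[OF V dG_linear(2)[OF c0 bV[OF i]]] sV
          by (simp add: dist_real_def)
        also have "\<dots> \<le> C * N (s m - s n) * M (b i)" using C mn' bV[OF i] by blast
        also have "\<dots> \<le> \<bar>C\<bar> * N (s m - s n) * M (b i)"
          using N_nonneg[OF mn'] M_nonneg[OF bV[OF i]] by (intro mult_right_mono) auto
        also have "\<dots> \<le> K * N (s m - s n)"
          using N_nonneg[OF mn'] unfolding K_def by (simp add: algebra_simps)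
        also have "\<dots> < K * (\<epsilon> / K)" using n0[OF mn] K by (intro mult_strict_left_mono) auto
        finally show ?thesis using K by simp
      qed
      then show "\<exists>n0. \<forall>m\<ge>n0. \<forall>n\<ge>n0. dist (dG c0 (s m) (b i)) (dG c0 (s n) (b i)) < \<epsilon>" by blast
    qed
    then show ?thesis using Cauchy_convergent by (auto simp: convergent_def)
  qed
  then obtain a where a: "\<And>i. i \<in> D \<Longrightarrow> (\<lambda>n. dG c0 (s n) (b i)) \<longlonglongrightarrow> a i" by metis
  define x where "x = (\<Sum>i\<in>D. a i *\<^sub>R c i)"
  have x: "x \<in> V" unfolding x_def using cV V by (auto intro!: subspace_sum subspace_scale)
  have Nsum: "N (\<Sum>i\<in>F. k i *\<^sub>R c i) \<le> (\<Sum>i\<in>F. \<bar>k i\<bar> * N (c i))" if "finite F" "F \<subseteq> D" for F k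
    using that
  proof (induction F rule: finite_induct)
    case empty then show ?case using N_0 by simp
  next
    case (insert i F)
    have "(\<Sum>i\<in>F. k i *\<^sub>R c i) \<in> V" using insert cV V by (auto intro!: subspace_sum subspace_scale)
    moreover have "k i *\<^sub>R c i \<in> V" using insert cV V by (auto intro!: subspace_scale)
    ultimately have "N (k i *\<^sub>R c i + (\<Sum>i\<in>F. k i *\<^sub>R c i)) \<le> N (k i *\<^sub>R c i) + N (\<Sum>i\<in>F. k i *\<^sub>R c i)"
      using N_triangle by blast
    then show ?case using insert N_scale[of "c i" "k i"] cV by simp
  qed
  have "(\<lambda>n. N (s n - x)) \<longlonglongrightarrow> 0"
  proof (rule tendsto_sandwich[OF _ _ tendsto_const])
    show "\<forall>\<^sub>F n in sequentially. 0 \<le> N (s n - x)"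
      using N_nonneg sV x V by (simp add: subspace_diff)
    have "N (s n - x) \<le> (\<Sum>i\<in>D. \<bar>dG c0 (s n) (b i) - a i\<bar> * N (c i))" for n
    proof -
      have "s n - x = (\<Sum>i\<in>D. (dG c0 (s n) (b i) - a i) *\<^sub>R c i)"
        using rep[OF sV[of n]] unfolding x_def by (simp add: scaleR_diff_left sum_subtractf)
      then show ?thesis using Nsum[OF fin, of "\<lambda>i. dG c0 (s n) (b i) - a i"] by simp
    qed
    then show "\<forall>\<^sub>F n in sequentially. N (s n - x) \<le> (\<Sum>i\<in>D. \<bar>dG c0 (s n) (b i) - a i\<bar> * N (c i))"
      by simp
    have "(\<lambda>n. \<Sum>i\<in>D. \<bar>dG c0 (s n) (b i) - a i\<bar> * N (c i)) \<longlonglongrightarrow> (\<Sum>i\<in>D. \<bar>a i - a i\<bar> * N (c i))"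
      using a by (intro tendsto_intros) auto
    then show "(\<lambda>n. \<Sum>i\<in>D. \<bar>dG c0 (s n) (b i) - a i\<bar> * N (c i)) \<longlonglongrightarrow> 0" by simp
  qed
  then have lim: "\<exists>n0. \<forall>n\<ge>n0. N (s n - x) < \<epsilon>" if "\<epsilon> > 0" for \<epsilon>
    using LIMSEQ_D[OF _ that, of "\<lambda>n. N (s n - x)" 0] by fastforce
  show "\<exists>x. limitin dist.mtopology s x sequentially"
    unfolding dist.limit_metric_sequentially using sV x lim by (intro exI[of _ x]) simp
qed

lemma line_deriv:
  assumes "w \<in> V" "h \<in> V" "v \<in> V"
  shows "((\<lambda>t. G (w + t *\<^sub>R h) v) has_real_derivative dG (w + t *\<^sub>R h) h v) (at t)"
proof -
  have "w + t *\<^sub>R h \<in> V" using assms V by (simp add: subspace_add subspace_scale)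
  then have "((\<lambda>s. G ((w + t *\<^sub>R h) + s *\<^sub>R h) v) has_real_derivative dG (w + t *\<^sub>R h) h v) (at 0)"
    using assms G_deriv by blast
  moreover have "(\<lambda>s. G ((w + t *\<^sub>R h) + s *\<^sub>R h) v) = (\<lambda>s. (\<lambda>t. G (w + t *\<^sub>R h) v) (s + t))"
    by (simp add: algebra_simps)
  ultimately show ?thesis
    using DERIV_shift[of "\<lambda>t. G (w + t *\<^sub>R h) v" "dG (w + t *\<^sub>R h) h v" 0 t] by simp
qed

text \<open>Along the segment from \<open>w\<close> to \<open>u\<close> the derivative deviates from \<open>dG c0\<close> by at most \<open>L\<close> times the distance to the
centre, which is at most linear in the parameter. Its integral is the mean of the distances at the two
ends; it is compared here through the monotonicity of \<open>k \<plusminus> g\<close>.\<close>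

lemma linearization_error:
  assumes u: "u \<in> V" "N (u - c0) \<le> \<beta> / L" and w: "w \<in> V" "N (w - c0) \<le> \<beta> / L" and v: "v \<in> V"
  shows "\<bar>G u v - G w v - dG c0 (u - w) v\<bar>
    \<le> L / 2 * (N (u - c0) + N (w - c0)) * N (u - w) * M v"
proof -
  define h where "h = u - w"
  have h: "h \<in> V" using u w V by (simp add: h_def subspace_diff)
  define B where "B = L * N h * M v"
  have B: "0 \<le> B" using pos N_nonneg[OF h] M_nonneg[OF v] by (simp add: B_def)
  define du where "du = N (u - c0)"
  define dw where "dw = N (w - c0)"
  define g where "g t = G (w + t *\<^sub>R h) v - t * dG c0 h v" for t :: real
  \<comment> \<open>the antiderivative of the bound \<open>B\<close> times the interpolated distance\<close>
  define k where "k t = B * (dw * t + (du - dw) * t\<^sup>2 / 2)" for t :: real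
  have g': "(g has_real_derivative dG (w + t *\<^sub>R h) h v - dG c0 h v) (at t)" for t
    unfolding g_def by (auto intro!: derivative_eq_intros line_deriv w h v)
  have k': "(k has_real_derivative B * (dw + (du - dw) * t)) (at t)" for t
    unfolding k_def by (auto intro!: derivative_eq_intros simp: field_simps)
  have bound: "\<bar>dG (w + t *\<^sub>R h) h v - dG c0 h v\<bar> \<le> B * (dw + (du - dw) * t)" if t: "0 \<le> t" "t \<le> 1" for t
  proof -
    have wt: "w + t *\<^sub>R h \<in> V" using w h V by (simp add: subspace_add subspace_scale)
    have uc: "u - c0 \<in> V" "w - c0 \<in> V" using u w c0 V by (auto simp: subspace_diff)
    have "N (w + t *\<^sub>R h - c0) = N (t *\<^sub>R (u - c0) + (1 - t) *\<^sub>R (w - c0))"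
      by (simp add: h_def algebra_simps)
    also have "\<dots> \<le> N (t *\<^sub>R (u - c0)) + N ((1 - t) *\<^sub>R (w - c0))"
      using uc V by (intro N_triangle) (auto simp: subspace_scale)
    also have "\<dots> = dw + (du - dw) * t" using t by (simp only: N_scale[OF uc(1)] N_scale[OF uc(2)] du_def dw_def) (simp add: algebra_simps)
    finally have le: "N (w + t *\<^sub>R h - c0) \<le> dw + (du - dw) * t" .
    also have "\<dots> = t * du + (1 - t) * dw" by (simp add: algebra_simps)
    also have "\<dots> \<le> t * (\<beta> / L) + (1 - t) * (\<beta> / L)"
      using u w t by (intro add_mono mult_left_mono) (auto simp: du_def dw_def)
    also have "\<dots> = \<beta> / L" by (simp only: distrib_right[symmetric]) simp
    finally have "\<bar>dG (w + t *\<^sub>R h) h v - dG c0 h v\<bar> \<le> L * N (w + t *\<^sub>R h - c0) * N h * M v"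
      using lipschitz[OF wt h v] by blast
    also have "\<dots> = B * N (w + t *\<^sub>R h - c0)" by (simp add: B_def)
    also have "\<dots> \<le> B * (dw + (du - dw) * t)" using le B by (rule mult_left_mono)
    finally show ?thesis .
  qed
  have "k 0 - g 0 \<le> k 1 - g 1"
  proof (rule DERIV_nonneg_imp_nondecreasing[of 0 1 "\<lambda>t. k t - g t"])
    fix t :: real assume "0 \<le> t" "t \<le> 1"
    then show "\<exists>y. ((\<lambda>t. k t - g t) has_real_derivative y) (at t) \<and> 0 \<le> y"
      using DERIV_diff[OF k' g', of t] bound[of t]
      by (intro exI[of _ "B * (dw + (du - dw) * t) - (dG (w + t *\<^sub>R h) h v - dG c0 h v)"]) auto
  qed simp
  moreover have "k 0 + g 0 \<le> k 1 + g 1"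
  proof (rule DERIV_nonneg_imp_nondecreasing[of 0 1 "\<lambda>t. k t + g t"])
    fix t :: real assume "0 \<le> t" "t \<le> 1"
    then show "\<exists>y. ((\<lambda>t. k t + g t) has_real_derivative y) (at t) \<and> 0 \<le> y"
      using DERIV_add[OF k' g', of t] bound[of t]
      by (intro exI[of _ "B * (dw + (du - dw) * t) + (dG (w + t *\<^sub>R h) h v - dG c0 h v)"]) auto
  qed simp
  ultimately have "\<bar>g 1 - g 0\<bar> \<le> k 1" by (simp add: k_def)
  moreover have "g 1 - g 0 = G u v - G w v - dG c0 h v" by (simp add: g_def h_def)
  moreover have "k 1 = L / 2 * (du + dw) * N h * M v" by (simp add: k_def B_def field_simps)
  ultimately show ?thesis by (simp add: h_def du_def dw_def)
qed

definition solve :: "('v \<Rightarrow> real) \<Rightarrow> 'v" where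
  "solve l = (SOME w. w \<in> V \<and> (\<forall>v\<in>V. dG c0 w v = l v))"

lemma solve_solves:
  assumes "linear_functional V l"
  shows "solve l \<in> V" "\<And>v. v \<in> V \<Longrightarrow> dG c0 (solve l) v = l v"
proof -
  obtain c where c: "dual_basis V D (\<lambda>i w. dG c0 w (b i)) c"
    by (rule nondegenerate_form_dual_basis[OF V basis, of "dG c0"])
       (use dG_linear c0 nondegenerate in auto)
  have "\<exists>w\<in>V. \<forall>v\<in>V. dG c0 w v = l v"
    using nondegenerate_form_solvable[OF V basis c] dG_linear c0 assms by blast
  then have "\<exists>w. w \<in> V \<and> (\<forall>v\<in>V. dG c0 w v = l v)" by blast
  then have "solve l \<in> V \<and> (\<forall>v\<in>V. dG c0 (solve l) v = l v)"
    unfolding solve_def by (rule someI_ex)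
  then show "solve l \<in> V" "\<And>v. v \<in> V \<Longrightarrow> dG c0 (solve l) v = l v" by auto
qed

definition newton_step :: "'v \<Rightarrow> 'v" where
  "newton_step w = w - solve (G w)"

lemma newton_step_in: "w \<in> V \<Longrightarrow> newton_step w \<in> V"
  unfolding newton_step_def using solve_solves(1)[OF G_linear] V by (simp add: subspace_diff)

lemma newton_step_fixed_iff:
  assumes "w \<in> V" shows "newton_step w = w \<longleftrightarrow> (\<forall>v\<in>V. G w v = 0)"
proof
  assume "newton_step w = w"
  then have z: "solve (G w) = 0" by (simp add: newton_step_def)
  have "dG c0 0 v = 0" if "v \<in> V" for v
    using linear_functional_0[OF V dG_linear(2)[OF c0 that]] .
  then show "\<forall>v\<in>V. G w v = 0" using solve_solves(2)[OF G_linear[OF assms]] z by simp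
next
  assume "\<forall>v\<in>V. G w v = 0"
  then have "solve (G w) = 0"
    using nondegenerate solve_solves[OF G_linear[OF assms]] by simp
  then show "newton_step w = w" by (simp add: newton_step_def)
qed

lemma newton_step_contraction:
  assumes u: "u \<in> V" "N (u - c0) \<le> \<beta> / L" and w: "w \<in> V" "N (w - c0) \<le> \<beta> / L"
  shows "N (newton_step u - newton_step w) \<le> L / (2 * \<beta>) * (N (u - c0) + N (w - c0)) * N (u - w)"
proof -
  have uV: "newton_step u - newton_step w \<in> V" "u - w \<in> V"
    using newton_step_in u w V by (auto simp: subspace_diff)
  have s: "solve (G u) \<in> V" "solve (G w) \<in> V" using solve_solves(1)[OF G_linear] u w by auto
  have sd: "solve (G u) - solve (G w) \<in> V" using s V by (simp add: subspace_diff)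
  have "\<beta> * N (newton_step u - newton_step w) \<le> L / 2 * (N (u - c0) + N (w - c0)) * N (u - w)"
  proof (rule inf_sup[OF uV(1)])
    fix v assume v: "v \<in> V"
    have "dG c0 (newton_step u - newton_step w) v = dG c0 ((u - w) - (solve (G u) - solve (G w))) v"
      by (simp add: newton_step_def algebra_simps)
    also have "\<dots> = dG c0 (u - w) v - (dG c0 (solve (G u)) v - dG c0 (solve (G w)) v)"
      using linear_functional_diff[OF V dG_linear(2)[OF c0 v]] uV sd s by simp
    also have "\<dots> = - (G u v - G w v - dG c0 (u - w) v)"
      using solve_solves(2)[OF G_linear v] u w by simp
    finally have eq: "dG c0 (newton_step u - newton_step w) v = - (G u v - G w v - dG c0 (u - w) v)" .
    show "\<bar>dG c0 (newton_step u - newton_step w) v\<bar> \<le> L / 2 * (N (u - c0) + N (w - c0)) * N (u - w) * M v"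
      unfolding eq abs_minus_cancel by (rule linearization_error[OF u w v])
  qed
  then show ?thesis using pos by (simp add: field_simps)
qed

lemma newton_step_centre: "N (newton_step c0 - c0) \<le> \<rho> / \<beta>"
proof -
  have s: "solve (G c0) \<in> V" using solve_solves(1)[OF G_linear[OF c0]] .
  have "\<beta> * N (solve (G c0)) \<le> \<rho>"
    using inf_sup[OF s, of \<rho>] solve_solves(2)[OF G_linear[OF c0]] residual by simp
  moreover have "N (newton_step c0 - c0) = N (solve (G c0))"
    using N_scale[OF s, of "-1"] by (simp add: newton_step_def)
  ultimately show ?thesis using pos by (simp add: field_simps)
qed

definition \<tau> where "\<tau> = 2 * L / \<beta>\<^sup>2 * \<rho>"
definition \<Delta> where "\<Delta> = \<beta> / L * (1 - sqrt (1 - \<tau>))"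

lemma \<tau>_bounds: "0 \<le> \<tau>" "\<tau> < 1"
  using pos small by (auto simp: \<tau>_def)

text \<open>\<open>\<Delta>\<close> is the smaller root of the quadratic that governs \<open>newton_step_quadratic\<close>.\<close>

lemma \<Delta>_properties: "0 \<le> \<Delta>" "\<Delta> < \<beta> / L" "L / \<beta> * \<Delta> < 1" "L / (2 * \<beta>) * \<Delta>\<^sup>2 + \<rho> / \<beta> = \<Delta>"
proof -
  have s: "0 < sqrt (1 - \<tau>)" "sqrt (1 - \<tau>) \<le> 1" using \<tau>_bounds by auto
  then show "0 \<le> \<Delta>" using pos by (simp add: \<Delta>_def)
  show "\<Delta> < \<beta> / L" using pos s by (simp add: \<Delta>_def field_simps)
  then show "L / \<beta> * \<Delta> < 1" using pos by (simp add: field_simps)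
  have sq: "(sqrt (1 - \<tau>))\<^sup>2 = 1 - \<tau>" using \<tau>_bounds by simp
  have "L / (2 * \<beta>) * \<Delta>\<^sup>2 = \<beta> / (2 * L) * (1 - sqrt (1 - \<tau>))\<^sup>2"
    using pos by (simp add: \<Delta>_def power2_eq_square field_simps)
  also have "(1 - sqrt (1 - \<tau>))\<^sup>2 = 2 * (1 - sqrt (1 - \<tau>)) - \<tau>"
    using sq by (simp add: power2_eq_square algebra_simps)
  also have "\<beta> / (2 * L) * (2 * (1 - sqrt (1 - \<tau>)) - \<tau>) = \<Delta> - \<beta> / (2 * L) * \<tau>"
    using pos by (simp add: \<Delta>_def field_simps)
  also have "\<beta> / (2 * L) * \<tau> = \<rho> / \<beta>" using pos by (simp add: \<tau>_def power2_eq_square)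
  finally show "L / (2 * \<beta>) * \<Delta>\<^sup>2 + \<rho> / \<beta> = \<Delta>" by simp
qed

lemma newton_step_quadratic:
  assumes w: "w \<in> V" "N (w - c0) \<le> \<beta> / L"
  shows "N (newton_step w - c0) \<le> L / (2 * \<beta>) * (N (w - c0))\<^sup>2 + \<rho> / \<beta>"
proof -
  have "N (newton_step w - c0) \<le> N (newton_step w - newton_step c0) + N (newton_step c0 - c0)"
    using N_triangle[of "newton_step w - newton_step c0" "newton_step c0 - c0"] newton_step_in w c0 V
    by (simp add: subspace_diff)
  also have "N (newton_step w - newton_step c0) \<le> L / (2 * \<beta>) * (N (w - c0))\<^sup>2"
    using newton_step_contraction[OF w c0] N_0 pos by (simp add: power2_eq_square)
  finally show ?thesis using newton_step_centre by simp
qed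

text \<open>The quadratic at \<open>d\<close> is the product of \<open>d - \<Delta>\<close> with a factor that is negative for \<open>d \<le> \<beta> / L\<close>.\<close>

lemma solution_bound:
  assumes w: "w \<in> V" "N (w - c0) \<le> \<beta> / L" and sol: "\<forall>v\<in>V. G w v = 0"
  shows "N (w - c0) \<le> \<Delta>"
proof -
  define d where "d = N (w - c0)"
  have "d \<le> L / (2 * \<beta>) * d\<^sup>2 + \<rho> / \<beta>"
    using newton_step_quadratic[OF w] newton_step_fixed_iff[OF w(1)] sol by (simp add: d_def)
  then have "0 \<le> (L / (2 * \<beta>) * d\<^sup>2 - d) - (L / (2 * \<beta>) * \<Delta>\<^sup>2 - \<Delta>)"
    using \<Delta>_properties(4) by linarith
  also have "\<dots> = (d - \<Delta>) * (L / (2 * \<beta>) * (d + \<Delta>) - 1)"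
  proof -
    have "(q * d\<^sup>2 - d) - (q * \<Delta>\<^sup>2 - \<Delta>) = (d - \<Delta>) * (q * (d + \<Delta>) - 1)" for q
      by (simp add: power2_eq_square algebra_simps)
    then show ?thesis .
  qed
  finally have prod: "0 \<le> (d - \<Delta>) * (L / (2 * \<beta>) * (d + \<Delta>) - 1)" .
  have "d + \<Delta> < 2 * (\<beta> / L)" using w \<Delta>_properties(2) by (simp add: d_def)
  then have "L / (2 * \<beta>) * (d + \<Delta>) - 1 < 0" using pos by (simp add: field_simps)
  then show ?thesis using prod by (simp add: zero_le_mult_iff d_def)
qed

text \<open>Two solutions both lie in the smaller ball of radius \<open>\<Delta>\<close>, where the iteration is a strict contraction. This
covers the boundary of the ball of radius \<open>\<beta> / L\<close>, where the contraction factor may reach 1.\<close>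

lemma solution_unique:
  assumes u: "u \<in> V" "N (u - c0) \<le> \<beta> / L" "\<forall>v\<in>V. G u v = 0"
    and w: "w \<in> V" "N (w - c0) \<le> \<beta> / L" "\<forall>v\<in>V. G w v = 0"
  shows "u = w"
proof -
  have uw: "u - w \<in> V" using u w V by (simp add: subspace_diff)
  have le: "N (u - c0) + N (w - c0) \<le> 2 * \<Delta>" using solution_bound u w by (smt (verit))
  have "N (u - w) \<le> L / (2 * \<beta>) * (N (u - c0) + N (w - c0)) * N (u - w)"
    using newton_step_contraction u w newton_step_fixed_iff by metis
  also have "\<dots> \<le> L / (2 * \<beta>) * (2 * \<Delta>) * N (u - w)"
    using le pos N_nonneg[OF uw] by (intro mult_right_mono mult_left_mono) auto
  finally have "(1 - L / \<beta> * \<Delta>) * N (u - w) \<le> 0" by (simp add: algebra_simps)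
  then have "N (u - w) \<le> 0" using \<Delta>_properties(3) by (simp add: mult_le_0_iff)
  then show ?thesis using N_nonneg[OF uw] N_definite[OF uw] by simp
qed

lemma solution_exists:
  obtains w where "w \<in> V" "N (w - c0) \<le> \<Delta>" "\<forall>v\<in>V. G w v = 0"
proof -
  define S where "S = {w \<in> V. N (w - c0) \<le> \<Delta>}"
  have ball: "S = dist.mcball c0 \<Delta>"
    using c0 N_minus_commute unfolding S_def dist.mcball_def by auto
  interpret S: Submetric V "\<lambda>u v. if u \<in> V \<and> v \<in> V then N (u - v) else 0" S
    by unfold_locales (auto simp: S_def)
  have compl: "S.sub.mcomplete"
    using complete S.closedin_eq_mcomplete unfolding ball by auto
  have maps: "newton_step \<in> S \<rightarrow> S"
  proof
    fix w assume "w \<in> S"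
    then have w: "w \<in> V" "N (w - c0) \<le> \<Delta>" by (auto simp: S_def)
    then have "(N (w - c0))\<^sup>2 \<le> \<Delta>\<^sup>2" using N_nonneg c0 V by (intro power_mono) (auto simp: subspace_diff)
    then have "L / (2 * \<beta>) * (N (w - c0))\<^sup>2 \<le> L / (2 * \<beta>) * \<Delta>\<^sup>2"
      using pos by (intro mult_left_mono) auto
    then have "N (newton_step w - c0) \<le> \<Delta>"
      using newton_step_quadratic[of w] w \<Delta>_properties by linarith
    then show "newton_step w \<in> S" using newton_step_in w by (simp add: S_def)
  qed
  have ne: "S \<noteq> {}" using c0 N_0 \<Delta>_properties(1) by (auto simp: S_def intro!: exI[of _ c0])
  have con: "(if newton_step u \<in> V \<and> newton_step w \<in> V then N (newton_step u - newton_step w) else 0)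
      \<le> L / \<beta> * \<Delta> * (if u \<in> V \<and> w \<in> V then N (u - w) else 0)" if "u \<in> S" "w \<in> S" for u w
  proof -
    have u: "u \<in> V" "N (u - c0) \<le> \<Delta>" and w: "w \<in> V" "N (w - c0) \<le> \<Delta>" using that by (auto simp: S_def)
    have "N (newton_step u - newton_step w) \<le> L / (2 * \<beta>) * (N (u - c0) + N (w - c0)) * N (u - w)"
      using newton_step_contraction u w \<Delta>_properties(2) by auto
    also have "\<dots> \<le> L / (2 * \<beta>) * (2 * \<Delta>) * N (u - w)"
      using u w pos N_nonneg[of "u - w"] V by (intro mult_right_mono mult_left_mono) (auto simp: subspace_diff)
    finally show ?thesis using u w newton_step_in by simp
  qed
  obtain w where "w \<in> S" "newton_step w = w"
    by (rule S.sub.Banach_fixedpoint_thm[OF compl ne maps \<Delta>_properties(3) con])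
  then show thesis using that newton_step_fixed_iff by (auto simp: S_def)
qed

end

section \<open>Smooth bump functions\<close>

text \<open>The powers of \<open>x\<close> in the denominator make the family closed under differentiation, so that one
induction gives smoothness of every member.\<close>

definition flat :: "nat \<Rightarrow> real \<Rightarrow> real" where
  "flat j x = (if 0 < x then exp (- 1 / x) / x ^ j else 0)"

lemma flat_tendsto_0: "(flat j \<longlongrightarrow> 0) (at 0)"
proof -
  have "((\<lambda>x::real. inverse x ^ j / exp (inverse x)) \<longlongrightarrow> 0) (at_right 0)"
    by (rule filterlim_compose[OF tendsto_power_div_exp_0 filterlim_inverse_at_top_right])
  moreover have "\<forall>\<^sub>F x in at_right 0. inverse x ^ j / exp (inverse x) = flat j x"
    using eventually_at_right_less[of "0::real"]
    by eventually_elim (simp add: flat_def exp_minus field_simps)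
  ultimately have right: "(flat j \<longlongrightarrow> 0) (at_right 0)"
    by (rule Lim_transform_eventually)
  have "\<forall>\<^sub>F x in at_left 0. 0 = flat j x"
    unfolding eventually_at_filter by (auto simp: flat_def)
  then have "(flat j \<longlongrightarrow> 0) (at_left 0)"
    by (rule Lim_transform_eventually[OF tendsto_const])
  then show ?thesis using right by (rule filterlim_split_at)
qed

text \<open>At the origin the difference quotient of the \<open>j\<close>-th function is the next function of the family.\<close>

lemma flat_deriv: "(flat j has_real_derivative (flat (j + 2) x - real j * flat (Suc j) x)) (at x)"
proof -
  consider "x < 0" | "x = 0" | "0 < x" by linarith
  then show ?thesis
  proof cases
    case 1
    have "((\<lambda>_. 0) has_real_derivative 0) (at x)" by simp
    then have "(flat j has_real_derivative 0) (at x)"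
      by (rule has_field_derivative_transform_within_open[of _ _ _ "{..<0}"]) (use 1 in \<open>auto simp: flat_def\<close>)
    then show ?thesis using 1 by (simp add: flat_def)
  next
    case 2
    have "((\<lambda>h. (flat j (0 + h) - flat j 0) / h) \<longlongrightarrow> 0) (at 0)"
    proof (rule Lim_transform_eventually[OF flat_tendsto_0[of "Suc j"]])
      show "\<forall>\<^sub>F h in at 0. flat (Suc j) h = (flat j (0 + h) - flat j 0) / h"
        unfolding eventually_at_filter by (auto simp: flat_def)
    qed
    then show ?thesis using 2 by (simp add: DERIV_def flat_def)
  next
    case 3
    have "((\<lambda>x. exp (- 1 / x) / x ^ j) has_real_derivative (flat (j + 2) x - real j * flat (Suc j) x)) (at x)"
    proof -
      have e: "((\<lambda>x. exp (- 1 / x)) has_real_derivative exp (- 1 / x) / (x * x)) (at x)"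
        using 3 by (auto intro!: derivative_eq_intros)
      have "exp (- 1 / x) / (x * x) * x ^ j - exp (- 1 / x) * (real j * x ^ (j - Suc 0))
          = (flat (j + 2) x - real j * flat (Suc j) x) * (x ^ j * x ^ j)"
        using 3 by (cases j) (simp_all add: flat_def field_simps)
      then show ?thesis using DERIV_divide[OF e DERIV_pow[of j x UNIV]] 3 by simp
    qed
    then show ?thesis
      by (rule has_field_derivative_transform_within_open[of _ _ _ "{0<..}"]) (use 3 in \<open>auto simp: flat_def\<close>)
  qed
qed

lemma line_derivative:
  fixes f :: "'a::real_vector \<Rightarrow> real"
  assumes "\<And>z. ((\<lambda>t. f (z + t *\<^sub>R e)) has_real_derivative f' z) (at 0)"
  shows "((\<lambda>t. f (z + t *\<^sub>R e)) has_real_derivative f' (z + t *\<^sub>R e)) (at t)"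
proof -
  have "((\<lambda>s. f ((z + t *\<^sub>R e) + s *\<^sub>R e)) has_real_derivative f' (z + t *\<^sub>R e)) (at 0)" by (rule assms)
  moreover have "(\<lambda>s. f ((z + t *\<^sub>R e) + s *\<^sub>R e)) = (\<lambda>s. (\<lambda>t. f (z + t *\<^sub>R e)) (s + t))"
    by (simp add: algebra_simps)
  ultimately show ?thesis using DERIV_shift[of "\<lambda>t. f (z + t *\<^sub>R e)" "f' (z + t *\<^sub>R e)" 0 t] by simp
qed

lemma Ck_continuous: "Ck k f \<Longrightarrow> continuous_on UNIV f"
  by (cases k) auto

lemma Ck_SucD: "Ck (Suc k) f \<Longrightarrow> Ck k f"
proof (induction k arbitrary: f)
  case 0
  then show ?case by simp
next
  case (Suc k)
  have "\<exists>f'. Ck k f' \<and> (\<forall>z. ((\<lambda>t. f (z + t *\<^sub>R e)) has_real_derivative f' z) (at 0))" if "e \<in> Basis" for e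
    using Suc that by (metis Ck.simps(2))
  then show ?case using Suc.prems by simp
qed

lemma Ck_const: "Ck k (\<lambda>z. c)"
  by (induction k arbitrary: c) (auto intro!: exI[of _ "\<lambda>z. 0"])

lemma Ck_add: "Ck k f \<Longrightarrow> Ck k g \<Longrightarrow> Ck k (\<lambda>z. f z + g z)"
proof (induction k arbitrary: f g)
  case (Suc k)
  show ?case unfolding Ck.simps
  proof (intro conjI ballI)
    fix e :: 'a assume e: "e \<in> Basis"
    obtain f' where f': "Ck k f'" "\<forall>z. ((\<lambda>t. f (z + t *\<^sub>R e)) has_real_derivative f' z) (at 0)"
      using Suc.prems e by auto
    obtain g' where g': "Ck k g'" "\<forall>z. ((\<lambda>t. g (z + t *\<^sub>R e)) has_real_derivative g' z) (at 0)"
      using Suc.prems e by auto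
    show "\<exists>h. Ck k h \<and> (\<forall>z. ((\<lambda>t. f (z + t *\<^sub>R e) + g (z + t *\<^sub>R e)) has_real_derivative h z) (at 0))"
      using f' g' Suc.IH by (intro exI[of _ "\<lambda>z. f' z + g' z"]) (auto intro!: DERIV_add)
  qed (use Suc.prems in \<open>auto intro!: continuous_intros\<close>)
qed (auto intro!: continuous_intros)

lemma Ck_mult: "Ck k f \<Longrightarrow> Ck k g \<Longrightarrow> Ck k (\<lambda>z. f z * g z)"
proof (induction k arbitrary: f g)
  case (Suc k)
  show ?case unfolding Ck.simps
  proof (intro conjI ballI)
    fix e :: 'a assume e: "e \<in> Basis"
    obtain f' where f': "Ck k f'" "\<forall>z. ((\<lambda>t. f (z + t *\<^sub>R e)) has_real_derivative f' z) (at 0)"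
      using Suc.prems e by auto
    obtain g' where g': "Ck k g'" "\<forall>z. ((\<lambda>t. g (z + t *\<^sub>R e)) has_real_derivative g' z) (at 0)"
      using Suc.prems e by auto
    have "((\<lambda>t. f (z + t *\<^sub>R e) * g (z + t *\<^sub>R e)) has_real_derivative f' z * g z + f z * g' z) (at 0)" for z
      using DERIV_mult[OF f'(2)[rule_format, of z] g'(2)[rule_format, of z]] by (simp add: mult.commute)
    moreover have "Ck k (\<lambda>z. f' z * g z + f z * g' z)"
      using Suc.IH f' g' Suc.prems by (auto intro!: Ck_add dest!: Ck_SucD simp del: Ck.simps)
    ultimately show "\<exists>h. Ck k h \<and> (\<forall>z. ((\<lambda>t. f (z + t *\<^sub>R e) * g (z + t *\<^sub>R e)) has_real_derivative h z) (at 0))"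
      by blast
  qed (use Suc.prems in \<open>auto intro!: continuous_intros\<close>)
qed (auto intro!: continuous_intros)

lemma Ck_sum:
  assumes "finite A" "\<And>i. i \<in> A \<Longrightarrow> Ck k (f i)"
  shows "Ck k (\<lambda>z. \<Sum>i\<in>A. f i z)"
  using assms by (induction A rule: finite_induct) (auto intro: Ck_const Ck_add)

lemma Ck_prod:
  assumes "finite A" "\<And>i. i \<in> A \<Longrightarrow> Ck k (f i)"
  shows "Ck k (\<lambda>z. \<Prod>i\<in>A. f i z)"
  using assms by (induction A rule: finite_induct) (auto intro: Ck_const Ck_mult)

lemma Ck_flat: "Ck k (\<lambda>z::'a::euclidean_space. flat j (a * (z \<bullet> i) + b))"
proof (induction k arbitrary: j)
  case 0
  have c: "continuous_on UNIV (flat j)" for j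
    by (meson DERIV_isCont continuous_at_imp_continuous_on flat_deriv)
  have "continuous_on UNIV (\<lambda>z::'a. a * (z \<bullet> i) + b)" by (intro continuous_intros)
  from continuous_on_compose2[OF c this] show ?case by simp
next
  case (Suc k)
  show ?case unfolding Ck.simps
  proof (intro conjI ballI)
    show "continuous_on UNIV (\<lambda>z::'a. flat j (a * (z \<bullet> i) + b))" using Ck_continuous[OF Suc.IH] .
    fix e :: 'a assume e: "e \<in> Basis"
    let ?f' = "\<lambda>z::'a. (a * (e \<bullet> i)) * (flat (j + 2) (a * (z \<bullet> i) + b) + (- real j) * flat (Suc j) (a * (z \<bullet> i) + b))"
    have "((\<lambda>t. flat j (a * ((z + t *\<^sub>R e) \<bullet> i) + b)) has_real_derivative ?f' z) (at 0)" for z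
    proof -
      have "((\<lambda>t. a * ((z + t *\<^sub>R e) \<bullet> i) + b) has_real_derivative a * (e \<bullet> i)) (at 0)"
        by (auto intro!: derivative_eq_intros simp: inner_add_left inner_scaleR_left)
      from DERIV_chain2[OF flat_deriv this] show ?thesis by (simp add: algebra_simps)
    qed
    moreover have "Ck k ?f'" by (intro Ck_mult Ck_add Ck_const Suc.IH)
    ultimately show "\<exists>h. Ck k h \<and> (\<forall>z. ((\<lambda>t. flat j (a * ((z + t *\<^sub>R e) \<bullet> i) + b)) has_real_derivative h z) (at 0))"
      by blast
  qed
qed

text \<open>The parameter \<open>n\<close> stretches the arguments: for positive \<open>n\<close> the bumps are positive exactly on the box, bounded by 1, and
increase to its indicator as \<open>n\<close> grows.\<close>

definition box_bump :: "real \<Rightarrow> 'a::euclidean_space \<Rightarrow> 'a \<Rightarrow> 'a \<Rightarrow> real" where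
  "box_bump n a b z = (\<Prod>i\<in>Basis. flat 0 (n * (z \<bullet> i) + (- n * (a \<bullet> i))) * flat 0 ((- n) * (z \<bullet> i) + n * (b \<bullet> i)))"

lemma Ck_box_bump: "Ck k (box_bump n a b)"
  unfolding box_bump_def by (intro Ck_prod finite_Basis Ck_mult Ck_flat)

lemma flat_0_bounds: "0 \<le> flat 0 x" "flat 0 x \<le> 1" "0 < flat 0 x \<longleftrightarrow> 0 < x"
  by (auto simp: flat_def)

lemma flat_shift: assumes "0 < n" shows "0 < n * x + (- n * a) \<longleftrightarrow> a < x" "0 < (- n) * x + n * b \<longleftrightarrow> x < (b::real)"
  using assms by (auto simp: algebra_simps)

lemma box_bump_bounds: "0 \<le> box_bump n a b z" "box_bump n a b z \<le> 1"
  unfolding box_bump_def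
  by (auto intro!: prod_nonneg prod_le_1 mult_nonneg_nonneg mult_le_one flat_0_bounds)

lemma box_bump_eq_0: assumes "0 < n" "z \<notin> box a b" shows "box_bump n a b z = 0"
proof -
  obtain i where i: "i \<in> Basis" "\<not> (a \<bullet> i < z \<bullet> i) \<or> \<not> (z \<bullet> i < b \<bullet> i)"
    using assms by (auto simp: mem_box)
  then have "flat 0 (n * (z \<bullet> i) + (- n * (a \<bullet> i))) * flat 0 ((- n) * (z \<bullet> i) + n * (b \<bullet> i)) = 0"
    using flat_0_bounds(1,3) flat_shift[OF assms(1)] by (metis less_eq_real_def mult_eq_0_iff)
  then show ?thesis unfolding box_bump_def using i(1) by (auto intro!: prod_zero)
qed

lemma box_bump_pos: assumes "0 < n" "z \<in> box a b" shows "0 < box_bump n a b z"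
  using assms flat_shift[OF assms(1)] unfolding box_bump_def mem_box
  by (intro prod_pos mult_pos_pos) (auto simp: flat_0_bounds(3) simp del: mult_minus_left)

lemma box_bump_tendsto: "(\<lambda>n. box_bump (real (Suc n)) a b z) \<longlonglongrightarrow> indicator (box a b) z"
proof (cases "z \<in> box a b")
  case True
  have lim: "(\<lambda>n. flat 0 (real (Suc n) * c)) \<longlonglongrightarrow> 1" if "c > 0" for c
  proof -
    have "(\<lambda>n. exp (- (1 / c) * (1 / real (Suc n)))) \<longlonglongrightarrow> exp (- (1 / c) * 0)"
      by (intro tendsto_intros LIMSEQ_Suc[OF lim_1_over_n])
    moreover have "flat 0 (real (Suc n) * c) = exp (- (1 / c) * (1 / real (Suc n)))" for n
      using that by (simp add: flat_def zero_less_mult_iff del: of_nat_Suc)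
    ultimately show ?thesis by simp
  qed
  have "(\<lambda>n. box_bump (real (Suc n)) a b z) \<longlonglongrightarrow> (\<Prod>i\<in>(Basis::'a set). 1 * 1)"
    unfolding box_bump_def
  proof (intro tendsto_prod tendsto_mult)
    fix i :: 'a assume i: "i \<in> Basis"
    have "z \<bullet> i - a \<bullet> i > 0" "b \<bullet> i - z \<bullet> i > 0" using True i by (auto simp: mem_box)
    from lim[OF this(1)] lim[OF this(2)]
    show "(\<lambda>n. flat 0 (real (Suc n) * (z \<bullet> i) + - real (Suc n) * (a \<bullet> i))) \<longlonglongrightarrow> 1"
      "(\<lambda>n. flat 0 (- real (Suc n) * (z \<bullet> i) + real (Suc n) * (b \<bullet> i))) \<longlonglongrightarrow> 1"
      by (simp_all add: algebra_simps del: of_nat_Suc)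
  qed
  then show ?thesis using True by simp
next
  case False
  then show ?thesis using box_bump_eq_0[of "real (Suc n)" z a b for n] by simp
qed

lemma box_bump_test:
  assumes "0 < n" "cbox a b \<subseteq> \<Omega>" shows "box_bump n a b \<in> test_functions \<Omega>"
proof -
  have "z \<notin> cbox a b \<Longrightarrow> box_bump n a b z = 0" for z
    using box_bump_eq_0[OF assms(1)] box_subset_cbox[of a b] by blast
  then show ?thesis unfolding test_functions_def
    using Ck_box_bump assms(2) by (auto intro!: exI[of _ "cbox a b"])
qed

section \<open>Weak derivatives are unique\<close>

text \<open>Local integrability only speaks about compact sets, so measurability has to be collected from a
countable cover by compact boxes.\<close>

lemma locally_integrable_measurable:
  assumes "open \<Omega>" "locally_integrable \<Omega> g"
  shows "set_borel_measurable lborel \<Omega> g"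
proof -
  obtain D where D: "countable D" "D \<subseteq> Pow \<Omega>" "\<And>X. X \<in> D \<Longrightarrow> \<exists>a b. X = cbox a b" "\<Union>D = \<Omega>"
    by (rule open_countable_Union_open_cbox[OF assms(1)]) auto
  have "(\<lambda>z. indicator \<Omega> z *\<^sub>R g z) \<in> borel_measurable lborel"
  proof (rule measurable_piecewise_restrict[of "insert (- \<Omega>) D"])
    show "countable (insert (- \<Omega>) D)" using D by simp
    show "space lborel \<subseteq> \<Union> (insert (- \<Omega>) D)" using D by auto
    fix X assume X: "X \<in> insert (- \<Omega>) D"
    have Xb: "X \<in> sets borel" using X D(3)[of X] assms(1) by auto
    then show "X \<inter> space lborel \<in> sets lborel" by simp
    have "(\<lambda>z. indicator X z *\<^sub>R (indicator \<Omega> z *\<^sub>R g z)) \<in> borel_measurable lborel"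
    proof (cases "X = - \<Omega>")
      case True
      then have "(\<lambda>z. indicator X z *\<^sub>R (indicator \<Omega> z *\<^sub>R g z)) = (\<lambda>z. 0)"
        by (auto simp: indicator_def)
      then show ?thesis by simp
    next
      case False
      then have XD: "X \<in> D" using X by simp
      then have "compact X" "X \<subseteq> \<Omega>" using D(2) D(3)[OF XD] by auto
      then have "(\<lambda>z. indicator X z *\<^sub>R g z) \<in> borel_measurable lborel"
        using assms(2) unfolding locally_integrable_def set_integrable_def by auto
      moreover have "(\<lambda>z. indicator X z *\<^sub>R (indicator \<Omega> z *\<^sub>R g z)) = (\<lambda>z. indicator X z *\<^sub>R g z)"
        using \<open>X \<subseteq> \<Omega>\<close> by (auto simp: indicator_def fun_eq_iff)
      ultimately show ?thesis by simp
    qed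
    then show "(\<lambda>z. indicator \<Omega> z *\<^sub>R g z) \<in> borel_measurable (restrict_space lborel X)"
      using Xb by (subst borel_measurable_restrict_space_iff) auto
  qed
  then show ?thesis unfolding set_borel_measurable_def .
qed

text \<open>Boxes form an intersection-stable generator of the Borel sets, so all set integrals vanish.\<close>

lemma AE_0_if_box_integrals_0:
  fixes f :: "'a::euclidean_space \<Rightarrow> real"
  assumes f: "integrable lborel f" and tot: "integral\<^sup>L lborel f = 0"
    and box: "\<And>u v. (LINT z:box u v|lborel. f z) = 0"
  shows "AE z in lborel. f z = 0"
proof -
  have int: "set_integrable lborel A f" if "A \<in> sets borel" for A
    using integrable_mult_indicator[of A lborel f] f that by (simp add: set_integrable_def)
  have "(LINT z:A|lborel. f z) = 0" if A: "A \<in> sets borel" for A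
  proof -
    have bsets: "sigma_sets UNIV (range (\<lambda>(a, b). box a b :: 'a set)) = sets borel"
      by (subst borel_eq_box) (simp add: sets_measure_of)
    have sig: "A \<in> sigma_sets UNIV (range (\<lambda>(a, b). box a b :: 'a set))" using A bsets by simp
    have "Int_stable (range (\<lambda>(a, b). box a b :: 'a set))"
      by (auto simp: Int_stable_def box_Int_box)
    moreover have "range (\<lambda>(a, b). box a b :: 'a set) \<subseteq> Pow UNIV" by simp
    ultimately show ?thesis using sig
    proof (induction rule: sigma_sets_induct_disjoint)
      case (basic A)
      then show ?case using box by auto
    next
      case empty
      then show ?case by (simp add: set_lebesgue_integral_def)
    next
      case (compl A)
      then have A: "A \<in> sets borel" using bsets by simp
      then have "(LINT z:A|lborel. f z) + (LINT z:-A|lborel. f z) = (LINT z:A \<union> -A|lborel. f z)"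
        using int by (subst set_integral_Un) auto
      then show ?case using compl tot by (simp add: Compl_eq_Diff_UNIV set_lebesgue_integral_def)
    next
      case (union A)
      then have A: "A i \<in> sets borel" for i using bsets by auto
      have "(LINT z:(\<Union>i. A i)|lborel. f z) = (\<Sum>i. (LINT z:A i|lborel. f z))"
        using A union(1) int by (intro lebesgue_integral_countable_add) (auto simp: disjoint_family_on_def)
      then show ?case using union by simp
    qed
  qed
  then show ?thesis
    using density_unique_real[of lborel f "\<lambda>_. 0"] f by (simp add: set_lebesgue_integral_def)
qed

lemma AE_boundary_cbox: "AE z in lborel. z \<in> cbox a b \<longrightarrow> z \<in> box a (b::'a::euclidean_space)"
proof -
  have "cbox a b - box a b \<in> null_sets lebesgue"
    using negligible_frontier_interval negligible_iff_null_sets by blast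
  then have "cbox a b - box a b \<in> null_sets lborel"
    by (subst (asm) null_sets_completion_iff) auto
  then show ?thesis by (rule AE_I') auto
qed

text \<open>The fundamental lemma of the calculus of variations: bump functions converge boundedly to indicators
of boxes, hence the integrals over boxes vanish.\<close>

lemma AE_0_if_orthogonal_to_test_functions:
  fixes g :: "'a::euclidean_space \<Rightarrow> real"
  assumes \<Omega>: "open \<Omega>" and g: "locally_integrable \<Omega> g"
    and orth: "\<And>\<phi>. \<phi> \<in> test_functions \<Omega> \<Longrightarrow> (LINT z:\<Omega>|lborel. g z * \<phi> z) = 0"
  shows "AE z in lborel. z \<in> \<Omega> \<longrightarrow> g z = 0"
proof -
  have int: "set_integrable lborel (cbox c d) g" if "cbox c d \<subseteq> \<Omega>" for c d
    using g that by (auto simp: locally_integrable_def)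
  have box0: "(LINT z:box c d|lborel. g z) = 0" if cd: "cbox c d \<subseteq> \<Omega>" for c d
  proof -
    have eq: "indicator \<Omega> z *\<^sub>R (g z * box_bump (real (Suc n)) c d z)
        = (indicator (cbox c d) z *\<^sub>R g z) * box_bump (real (Suc n)) c d z" for n z
      using box_bump_eq_0[of "real (Suc n)" z c d] cd box_subset_cbox[of c d] by (auto simp: indicator_def)
    have "(\<lambda>n. LINT z|lborel. (indicator (cbox c d) z *\<^sub>R g z) * box_bump (real (Suc n)) c d z)
      \<longlonglongrightarrow> (LINT z|lborel. (indicator (cbox c d) z *\<^sub>R g z) * indicator (box c d) z)"
    proof (rule integral_dominated_convergence)
      show "integrable lborel (\<lambda>z. \<bar>indicator (cbox c d) z *\<^sub>R g z\<bar>)"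
        using int[OF cd] unfolding set_integrable_def by (rule integrable_abs)
      have m: "(\<lambda>z. indicator (cbox c d) z *\<^sub>R g z) \<in> borel_measurable lborel"
        using int[OF cd] by (auto simp: set_integrable_def)
      then show "(\<lambda>z. (indicator (cbox c d) z *\<^sub>R g z) * indicator (box c d) z) \<in> borel_measurable lborel"
        by measurable
      have "box_bump (real (Suc n)) c d \<in> borel_measurable borel" for n
        using Ck_continuous[OF Ck_box_bump[of 0]] by (rule borel_measurable_continuous_onI)
      then show "(\<lambda>z. (indicator (cbox c d) z *\<^sub>R g z) * box_bump (real (Suc n)) c d z) \<in> borel_measurable lborel" for n
        using m by (intro borel_measurable_times) auto
      show "AE z in lborel. (\<lambda>n. (indicator (cbox c d) z *\<^sub>R g z) * box_bump (real (Suc n)) c d z)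
          \<longlonglongrightarrow> (indicator (cbox c d) z *\<^sub>R g z) * indicator (box c d) z"
        by (intro AE_I2 tendsto_mult tendsto_const box_bump_tendsto)
      show "AE z in lborel. norm ((indicator (cbox c d) z *\<^sub>R g z) * box_bump (real (Suc n)) c d z)
          \<le> \<bar>indicator (cbox c d) z *\<^sub>R g z\<bar>" for n
        using box_bump_bounds[of "real (Suc n)" c d] by (intro AE_I2) (simp add: abs_mult mult_left_le)
    qed
    moreover have "(LINT z|lborel. (indicator (cbox c d) z *\<^sub>R g z) * box_bump (real (Suc n)) c d z) = 0" for n
      using orth[OF box_bump_test[OF _ cd], of "real (Suc n)"]
      unfolding set_lebesgue_integral_def eq by (simp del: of_nat_Suc)
    ultimately have "(LINT z|lborel. (indicator (cbox c d) z *\<^sub>R g z) * indicator (box c d) z) = 0"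
      using LIMSEQ_unique[OF _ tendsto_const] by (simp only:)
    moreover have "(indicator (cbox c d) z *\<^sub>R g z) * indicator (box c d) z = indicator (box c d) z *\<^sub>R g z" for z
      using box_subset_cbox[of c d] by (auto simp: indicator_def)
    ultimately show ?thesis unfolding set_lebesgue_integral_def by (simp only:)
  qed
  have cbox0: "AE z in lborel. z \<in> cbox c d \<longrightarrow> g z = 0" if cd: "cbox c d \<subseteq> \<Omega>" for c d
  proof -
    have "AE z in lborel. indicator (box c d) z *\<^sub>R g z = 0"
    proof (rule AE_0_if_box_integrals_0)
      have "set_integrable lborel (box c d) g"
        using set_integrable_subset[OF int[OF cd], of "box c d"] box_subset_cbox[of c d] by auto
      then show "integrable lborel (\<lambda>z. indicator (box c d) z *\<^sub>R g z)" by (simp add: set_integrable_def)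
      show "(LINT z|lborel. indicator (box c d) z *\<^sub>R g z) = 0"
        using box0[OF cd] by (simp add: set_lebesgue_integral_def)
      fix u v :: 'a
      have "\<exists>s t. box u v \<inter> box c d = box s t" unfolding box_Int_box by blast
      then obtain s t where st: "box u v \<inter> box c d = box s t" by blast
      have "(LINT z:box s t|lborel. g z) = 0"
      proof (cases "box s t = {}")
        case False
        then have "cbox s t = closure (box u v \<inter> box c d)" using st by (simp add: closure_box)
        also have "\<dots> \<subseteq> cbox c d" by (intro closure_minimal) (use box_subset_cbox in auto)
        finally show ?thesis using cd by (intro box0) auto
      qed (simp add: set_lebesgue_integral_def)
      moreover have "indicator (box u v) z *\<^sub>R (indicator (box c d) z *\<^sub>R g z) = indicator (box s t) z *\<^sub>R g z" for z
        unfolding st[symmetric] by (simp add: indicator_inter_arith)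
      ultimately show "(LINT z:box u v|lborel. indicator (box c d) z *\<^sub>R g z) = 0"
        unfolding set_lebesgue_integral_def by (simp only:)
    qed
    with AE_boundary_cbox[of c d] show ?thesis by eventually_elim (auto simp: indicator_def)
  qed
  obtain D where D: "countable D" "D \<subseteq> Pow \<Omega>" "\<And>X. X \<in> D \<Longrightarrow> \<exists>a b. X = cbox a b" "\<Union>D = \<Omega>"
    by (rule open_countable_Union_open_cbox[OF \<Omega>]) auto
  have "AE z in lborel. \<forall>X\<in>D. z \<in> X \<longrightarrow> g z = 0"
    by (subst AE_ball_countable[OF D(1)]) (use D(2,3) cbox0 in blast)
  then show ?thesis by eventually_elim (use D(4) in blast)
qed

section \<open>Almost everywhere partial derivatives of Lipschitz functions\<close>

text \<open>The steps \<open>1 / (n + 1)\<close> suffice: passing to a sequence keeps all limits measurable and within reach of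
dominated convergence.\<close>

definition dquot :: "'a::euclidean_space \<Rightarrow> ('a \<Rightarrow> real) \<Rightarrow> nat \<Rightarrow> 'a \<Rightarrow> real" where
  "dquot e w n z = real (Suc n) * (w (z + (1 / real (Suc n)) *\<^sub>R e) - w z)"

text \<open>Bounded support makes all the functions involved integrable over the whole space, so that integrals can be
translated freely; the Lipschitz bound dominates the difference quotients.\<close>

definition ae_partial :: "'a::euclidean_space \<Rightarrow> ('a \<Rightarrow> real) \<Rightarrow> ('a \<Rightarrow> real) \<Rightarrow> bool" where
  "ae_partial e w g \<longleftrightarrow> continuous_on UNIV w \<and> (\<exists>r. \<forall>z. w z \<noteq> 0 \<longrightarrow> norm z \<le> r) \<and>
     (\<exists>L. \<forall>z t. \<bar>w (z + t *\<^sub>R e) - w z\<bar> \<le> L * \<bar>t\<bar>) \<and> g \<in> borel_measurable borel \<and>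
     (AE z in lborel. (\<lambda>n. dquot e w n z) \<longlonglongrightarrow> g z)"

lemma integral_translate:
  fixes f :: "'a::euclidean_space \<Rightarrow> real"
  assumes "f \<in> borel_measurable borel"
  shows "(LINT z|lborel. f (z + c)) = (LINT z|lborel. f z)"
proof -
  have "(LINT z|lborel. f z) = (LINT z|distr lborel borel ((+) c). f z)"
    by (simp add: lborel_distr_plus)
  also have "\<dots> = (LINT z|lborel. f (c + z))"
    using assms by (intro integral_distr) auto
  finally show ?thesis by (simp add: add.commute)
qed

lemma integrable_translate:
  fixes f :: "'a::euclidean_space \<Rightarrow> real"
  assumes "integrable lborel f"
  shows "integrable lborel (\<lambda>z. f (z + c))"
proof -
  have "integrable (distr lborel borel ((+) c)) f" using assms by (simp add: lborel_distr_plus)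
  then have "integrable lborel (\<lambda>z. f (c + z))"
    using assms by (subst (asm) integrable_distr_eq) auto
  then show ?thesis by (simp add: add.commute)
qed

lemma integrable_bounded_support:
  fixes f :: "'a::euclidean_space \<Rightarrow> real"
  assumes "f \<in> borel_measurable borel" "AE z in lborel. \<bar>f z\<bar> \<le> C" "\<And>z. f z \<noteq> 0 \<Longrightarrow> norm z \<le> r"
  shows "integrable lborel f"
proof (rule Bochner_Integration.integrable_bound)
  show "integrable lborel (\<lambda>z. indicator (cball 0 r) z * \<bar>C\<bar>)"
    by (intro integrable_mult_left integrable_real_indicator[OF _ emeasure_lborel_cball_finite]) auto
  show "f \<in> borel_measurable lborel" using assms(1) by simp
  show "AE z in lborel. norm (f z) \<le> norm (indicator (cball 0 r) z * \<bar>C\<bar>)"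
    using assms(2)
  proof eventually_elim
    case (elim z)
    then show ?case using assms(3)[of z] by (cases "f z = 0") auto
  qed
qed

lemma continuous_bounded_support_bound:
  fixes w :: "'a::euclidean_space \<Rightarrow> real"
  assumes "continuous_on UNIV w" "\<And>z. w z \<noteq> 0 \<Longrightarrow> norm z \<le> r"
  obtains M where "0 \<le> M" "\<And>z. \<bar>w z\<bar> \<le> M"
proof -
  have "compact (w ` cball 0 r)"
    by (rule compact_continuous_image) (use assms(1) in \<open>auto intro: continuous_on_subset\<close>)
  then obtain M where M: "\<And>z. z \<in> cball 0 r \<Longrightarrow> \<bar>w z\<bar> \<le> M"
    by (metis bounded_iff compact_imp_bounded imageI real_norm_def)
  have "\<bar>w z\<bar> \<le> \<bar>M\<bar>" for z
    using M[of z] assms(2)[of z] by (cases "w z = 0") auto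
  then show thesis using that[of "\<bar>M\<bar>"] by auto
qed

lemma ae_partialE:
  assumes "ae_partial e w g"
  obtains r L M where "continuous_on UNIV w" "0 \<le> r" "\<And>z. w z \<noteq> 0 \<Longrightarrow> norm z \<le> r" "0 \<le> L"
    "\<And>z t. \<bar>w (z + t *\<^sub>R e) - w z\<bar> \<le> L * \<bar>t\<bar>" "0 \<le> M" "\<And>z. \<bar>w z\<bar> \<le> M"
    "g \<in> borel_measurable borel" "AE z in lborel. (\<lambda>n. dquot e w n z) \<longlonglongrightarrow> g z"
proof -
  obtain r L where r: "\<And>z. w z \<noteq> 0 \<Longrightarrow> norm z \<le> r"
    and L: "\<And>z t. \<bar>w (z + t *\<^sub>R e) - w z\<bar> \<le> L * \<bar>t\<bar>" and w: "continuous_on UNIV w"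
    and g: "g \<in> borel_measurable borel" "AE z in lborel. (\<lambda>n. dquot e w n z) \<longlonglongrightarrow> g z"
    using assms unfolding ae_partial_def by auto
  obtain M where M: "0 \<le> M" "\<And>z. \<bar>w z\<bar> \<le> M"
    using continuous_bounded_support_bound[OF w r] by blast
  have "0 \<le> L" using L[of 0 1] by (smt (verit) abs_ge_zero abs_one mult_cancel_left2)
  moreover have "norm z \<le> \<bar>r\<bar>" if "w z \<noteq> 0" for z using r[OF that] by simp
  ultimately show thesis using that[of "\<bar>r\<bar>" L M] L w M g by auto
qed

lemma dquot_bound:
  assumes "\<And>z t. \<bar>w (z + t *\<^sub>R e) - w z\<bar> \<le> L * \<bar>t\<bar>"
  shows "\<bar>dquot e w n z\<bar> \<le> L"
proof -
  have "\<bar>dquot e w n z\<bar> = real (Suc n) * \<bar>w (z + (1 / real (Suc n)) *\<^sub>R e) - w z\<bar>"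
    by (simp add: dquot_def abs_mult)
  also have "\<dots> \<le> real (Suc n) * (L * \<bar>1 / real (Suc n)\<bar>)"
    using assms[of z "1 / real (Suc n)"] by (intro mult_left_mono) auto
  finally show ?thesis by simp
qed

lemma ae_partial_bound:
  assumes "ae_partial e w g" and "\<And>z t. \<bar>w (z + t *\<^sub>R e) - w z\<bar> \<le> L * \<bar>t\<bar>"
  shows "AE z in lborel. \<bar>g z\<bar> \<le> L"
proof -
  have "AE z in lborel. (\<lambda>n. dquot e w n z) \<longlonglongrightarrow> g z" using assms(1) by (auto simp: ae_partial_def)
  then show ?thesis
  proof eventually_elim
    case (elim z)
    then have "(\<lambda>n. \<bar>dquot e w n z\<bar>) \<longlonglongrightarrow> \<bar>g z\<bar>" by (intro tendsto_intros)
    then show ?case by (rule LIMSEQ_le_const2) (use dquot_bound[of w e L, OF assms(2)] in auto)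
  qed
qed

lemma dquot_measurable:
  assumes "continuous_on UNIV w" shows "dquot e w n \<in> borel_measurable borel"
proof -
  have "continuous_on UNIV (\<lambda>z. w (z + (1 / real (Suc n)) *\<^sub>R e))"
    by (rule continuous_on_compose2[OF assms]) (intro continuous_intros, simp)
  then have "continuous_on UNIV (dquot e w n)"
    unfolding dquot_def by (intro continuous_on_mult continuous_on_diff continuous_on_const assms)
  then show ?thesis by (rule borel_measurable_continuous_onI)
qed

text \<open>The difference quotients have integral zero by translation invariance, and they converge dominatedly.
Every integration by parts below is this fact applied to a product.\<close>

lemma integral_ae_partial_eq_0:
  assumes "ae_partial e w g"
  shows "integrable lborel g" "(LINT z|lborel. g z) = 0"
proof -
  obtain r L M where w: "continuous_on UNIV w" and r: "0 \<le> r" "\<And>z. w z \<noteq> 0 \<Longrightarrow> norm z \<le> r"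
    and L: "0 \<le> L" "\<And>z t. \<bar>w (z + t *\<^sub>R e) - w z\<bar> \<le> L * \<bar>t\<bar>" and M: "\<And>z. \<bar>w z\<bar> \<le> M"
    and g: "g \<in> borel_measurable borel" "AE z in lborel. (\<lambda>n. dquot e w n z) \<longlonglongrightarrow> g z"
    using ae_partialE[OF assms] by metis
  define B where "B z = L * indicator (cball 0 (r + norm e)) z" for z :: 'a
  have wm: "w \<in> borel_measurable borel" using w by (rule borel_measurable_continuous_onI)
  have wi: "integrable lborel w"
    by (rule integrable_bounded_support[OF wm _ r(2)]) (use M in auto)
  have bound: "AE z in lborel. norm (dquot e w n z) \<le> B z" for n
  proof (rule AE_I2)
    fix z
    show "norm (dquot e w n z) \<le> B z"
    proof (cases "z \<in> cball 0 (r + norm e)")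
      case True
      then show ?thesis using dquot_bound[of w e L, OF L(2)] by (simp add: B_def)
    next
      case False
      define h where "h = (1 / real (Suc n)) *\<^sub>R e"
      have h: "norm h \<le> norm e" unfolding h_def by (simp add: divide_le_eq mult_le_cancel_left1)
      have "norm z > r + norm e" using False by simp
      moreover have "norm z \<le> norm (z + h) + norm h" using norm_triangle_ineq4[of "z + h" h] by simp
      ultimately have "w z = 0" "w (z + h) = 0" using r h by (smt (verit) norm_ge_zero)+
      then show ?thesis using False by (simp add: dquot_def h_def B_def)
    qed
  qed
  have Bi: "integrable lborel B" unfolding B_def
    by (intro integrable_mult_right integrable_real_indicator[OF _ emeasure_lborel_cball_finite]) auto
  have dm: "dquot e w n \<in> borel_measurable lborel" for n using dquot_measurable[OF w] by simp
  have gm: "g \<in> borel_measurable lborel" using g by simp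
  show "integrable lborel g" by (rule integrable_dominated_convergence[OF gm dm Bi g(2) bound])
  have lim: "(\<lambda>n. LINT z|lborel. dquot e w n z) \<longlonglongrightarrow> (LINT z|lborel. g z)"
    by (rule integral_dominated_convergence[OF gm dm Bi g(2) bound])
  have "(LINT z|lborel. dquot e w n z) = 0" for n
    unfolding dquot_def using wi integrable_translate[OF wi] integral_translate[OF wm] by simp
  then show "(LINT z|lborel. g z) = 0" using lim LIMSEQ_unique[OF _ tendsto_const] by simp
qed

lemma ae_partial_add:
  assumes "ae_partial e u u'" "ae_partial e v v'"
  shows "ae_partial e (\<lambda>z. u z + v z) (\<lambda>z. u' z + v' z)"
proof -
  obtain r L where u: "continuous_on UNIV u" and r: "\<And>z. u z \<noteq> 0 \<Longrightarrow> norm z \<le> r"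
    and L: "\<And>z t. \<bar>u (z + t *\<^sub>R e) - u z\<bar> \<le> L * \<bar>t\<bar>"
    and u': "u' \<in> borel_measurable borel" "AE z in lborel. (\<lambda>n. dquot e u n z) \<longlonglongrightarrow> u' z"
    using ae_partialE[OF assms(1)] by metis
  obtain s K where v: "continuous_on UNIV v" and s: "\<And>z. v z \<noteq> 0 \<Longrightarrow> norm z \<le> s"
    and K: "\<And>z t. \<bar>v (z + t *\<^sub>R e) - v z\<bar> \<le> K * \<bar>t\<bar>"
    and v': "v' \<in> borel_measurable borel" "AE z in lborel. (\<lambda>n. dquot e v n z) \<longlonglongrightarrow> v' z"
    using ae_partialE[OF assms(2)] by metis
  show ?thesis unfolding ae_partial_def
  proof (intro conjI exI allI impI)
    show "continuous_on UNIV (\<lambda>z. u z + v z)" using u v by (intro continuous_on_add)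
    show "norm z \<le> max r s" if "u z + v z \<noteq> 0" for z
      using r[of z] s[of z] that by (cases "u z = 0") (auto simp: max_def)
    show "\<bar>u (z + t *\<^sub>R e) + v (z + t *\<^sub>R e) - (u z + v z)\<bar> \<le> (L + K) * \<bar>t\<bar>" for z t
      using L[of z t] K[of z t] unfolding distrib_right by linarith
    show "(\<lambda>z. u' z + v' z) \<in> borel_measurable borel" using u' v' by (intro borel_measurable_add)
    show "AE z in lborel. (\<lambda>n. dquot e (\<lambda>z. u z + v z) n z) \<longlonglongrightarrow> u' z + v' z"
      using u'(2) v'(2)
    proof eventually_elim
      case (elim z)
      from tendsto_add[OF this] show ?case by (simp add: dquot_def algebra_simps)
    qed
  qed
qed

lemma ae_partial_cmult:
  assumes "ae_partial e u u'"
  shows "ae_partial e (\<lambda>z. c * u z) (\<lambda>z. c * u' z)"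
proof -
  obtain r L where u: "continuous_on UNIV u" and r: "\<And>z. u z \<noteq> 0 \<Longrightarrow> norm z \<le> r"
    and L: "\<And>z t. \<bar>u (z + t *\<^sub>R e) - u z\<bar> \<le> L * \<bar>t\<bar>"
    and u': "u' \<in> borel_measurable borel" "AE z in lborel. (\<lambda>n. dquot e u n z) \<longlonglongrightarrow> u' z"
    using ae_partialE[OF assms(1)] by metis
  show ?thesis unfolding ae_partial_def
  proof (intro conjI exI allI impI)
    show "continuous_on UNIV (\<lambda>z. c * u z)" using u by (intro continuous_on_mult continuous_on_const)
    show "norm z \<le> r" if "c * u z \<noteq> 0" for z using r[of z] that by auto
    show "\<bar>c * u (z + t *\<^sub>R e) - c * u z\<bar> \<le> (\<bar>c\<bar> * L) * \<bar>t\<bar>" for z t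
      using mult_left_mono[OF L[of z t], of "\<bar>c\<bar>"] by (simp add: abs_mult[symmetric] algebra_simps)
    show "(\<lambda>z. c * u' z) \<in> borel_measurable borel" using u' by (intro borel_measurable_times) auto
    show "AE z in lborel. (\<lambda>n. dquot e (\<lambda>z. c * u z) n z) \<longlonglongrightarrow> c * u' z"
      using u'(2)
    proof eventually_elim
      case (elim z)
      from tendsto_mult[OF tendsto_const[of c] this] show ?case by (simp add: dquot_def algebra_simps)
    qed
  qed
qed

lemma ae_partial_diff:
  assumes "ae_partial e u u'" "ae_partial e v v'"
  shows "ae_partial e (\<lambda>z. u z - v z) (\<lambda>z. u' z - v' z)"
  using ae_partial_add[OF assms(1) ae_partial_cmult[OF assms(2), of "-1"]] by simp

lemma shift_tendsto:
  fixes v :: "'a::euclidean_space \<Rightarrow> real"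
  assumes "continuous_on UNIV v"
  shows "(\<lambda>n. v (z + (1 / real (Suc n)) *\<^sub>R e)) \<longlonglongrightarrow> v z"
proof -
  have "(\<lambda>n. z + (1 / real (Suc n)) *\<^sub>R e) \<longlonglongrightarrow> z + 0 *\<^sub>R e"
    by (intro tendsto_intros LIMSEQ_Suc[OF lim_1_over_n])
  then have lim: "(\<lambda>n. z + (1 / real (Suc n)) *\<^sub>R e) \<longlonglongrightarrow> z" by simp
  show ?thesis
    by (rule isCont_tendsto_compose[OF _ lim])
       (use assms in \<open>simp add: continuous_on_eq_continuous_at\<close>)
qed

lemma ae_partial_mult:
  assumes "ae_partial e u u'" "ae_partial e v v'"
  shows "ae_partial e (\<lambda>z. u z * v z) (\<lambda>z. u' z * v z + u z * v' z)"
proof -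
  obtain r L M where u: "continuous_on UNIV u" and r: "\<And>z. u z \<noteq> 0 \<Longrightarrow> norm z \<le> r"
    and L: "0 \<le> L" "\<And>z t. \<bar>u (z + t *\<^sub>R e) - u z\<bar> \<le> L * \<bar>t\<bar>" and M: "\<And>z. \<bar>u z\<bar> \<le> M" "0 \<le> M"
    and u': "u' \<in> borel_measurable borel" "AE z in lborel. (\<lambda>n. dquot e u n z) \<longlonglongrightarrow> u' z"
    using ae_partialE[OF assms(1)] by metis
  obtain s K Q where v: "continuous_on UNIV v" and s: "\<And>z. v z \<noteq> 0 \<Longrightarrow> norm z \<le> s"
    and K: "0 \<le> K" "\<And>z t. \<bar>v (z + t *\<^sub>R e) - v z\<bar> \<le> K * \<bar>t\<bar>" and Q: "\<And>z. \<bar>v z\<bar> \<le> Q" "0 \<le> Q"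
    and v': "v' \<in> borel_measurable borel" "AE z in lborel. (\<lambda>n. dquot e v n z) \<longlonglongrightarrow> v' z"
    using ae_partialE[OF assms(2)] by metis
  show ?thesis unfolding ae_partial_def
  proof (intro conjI exI allI impI)
    show "continuous_on UNIV (\<lambda>z. u z * v z)" using u v by (intro continuous_on_mult)
    show "norm z \<le> r" if "u z * v z \<noteq> 0" for z using r[of z] that by auto
    show "\<bar>u (z + t *\<^sub>R e) * v (z + t *\<^sub>R e) - u z * v z\<bar> \<le> (L * Q + M * K) * \<bar>t\<bar>" for z t
    proof -
      have "u (z + t *\<^sub>R e) * v (z + t *\<^sub>R e) - u z * v z =
        (u (z + t *\<^sub>R e) - u z) * v (z + t *\<^sub>R e) + u z * (v (z + t *\<^sub>R e) - v z)"
        by (simp add: algebra_simps)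
      also have "\<bar>\<dots>\<bar> \<le> \<bar>u (z + t *\<^sub>R e) - u z\<bar> * \<bar>v (z + t *\<^sub>R e)\<bar> + \<bar>u z\<bar> * \<bar>v (z + t *\<^sub>R e) - v z\<bar>"
        by (metis abs_mult abs_triangle_ineq)
      also have "\<dots> \<le> (L * \<bar>t\<bar>) * Q + M * (K * \<bar>t\<bar>)"
        using L K M Q by (intro add_mono mult_mono) auto
      finally show ?thesis by (simp add: algebra_simps)
    qed
    have "u \<in> borel_measurable borel" "v \<in> borel_measurable borel"
      using u v by (auto intro: borel_measurable_continuous_onI)
    then show "(\<lambda>z. u' z * v z + u z * v' z) \<in> borel_measurable borel"
      using u' v' by (intro borel_measurable_add borel_measurable_times)
    show "AE z in lborel. (\<lambda>n. dquot e (\<lambda>z. u z * v z) n z) \<longlonglongrightarrow> u' z * v z + u z * v' z"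
      using u'(2) v'(2)
    proof eventually_elim
      case (elim z)
      have "(\<lambda>n. dquot e u n z * v (z + (1 / real (Suc n)) *\<^sub>R e) + u z * dquot e v n z) \<longlonglongrightarrow> u' z * v z + u z * v' z"
        by (intro tendsto_intros elim shift_tendsto[OF v])
      moreover have "dquot e u n z * v (z + (1 / real (Suc n)) *\<^sub>R e) + u z * dquot e v n z
          = dquot e (\<lambda>z. u z * v z) n z" for n
        by (simp add: dquot_def algebra_simps)
      ultimately show ?case by simp
    qed
  qed
qed

lemma ae_partial_coordinate_mult:
  assumes "ae_partial e w g" and e: "e \<in> Basis"
  shows "ae_partial e (\<lambda>z. (z \<bullet> e) * w z) (\<lambda>z. w z + (z \<bullet> e) * g z)"
proof -
  obtain r L M where w: "continuous_on UNIV w" and r: "0 \<le> r" "\<And>z. w z \<noteq> 0 \<Longrightarrow> norm z \<le> r"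
    and L: "0 \<le> L" "\<And>z t. \<bar>w (z + t *\<^sub>R e) - w z\<bar> \<le> L * \<bar>t\<bar>" and M: "\<And>z. \<bar>w z\<bar> \<le> M" "0 \<le> M"
    and g: "g \<in> borel_measurable borel" "AE z in lborel. (\<lambda>n. dquot e w n z) \<longlonglongrightarrow> g z"
    using ae_partialE[OF assms(1)] by metis
  have ee: "e \<bullet> e = 1" using e by simp
  have ze: "\<bar>z \<bullet> e\<bar> \<le> norm z" for z using Basis_le_norm[OF e] by simp
  show ?thesis unfolding ae_partial_def
  proof (intro conjI exI allI impI)
    show "continuous_on UNIV (\<lambda>z. (z \<bullet> e) * w z)" using w by (intro continuous_intros)
    show "norm z \<le> r" if "(z \<bullet> e) * w z \<noteq> 0" for z using r(2)[of z] that by auto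
    show "\<bar>((z + t *\<^sub>R e) \<bullet> e) * w (z + t *\<^sub>R e) - (z \<bullet> e) * w z\<bar> \<le> (r * L + M) * \<bar>t\<bar>" for z t
    proof -
      define d where "d = w (z + t *\<^sub>R e) - w z"
      have d: "\<bar>d\<bar> \<le> L * \<bar>t\<bar>" using L(2) by (simp add: d_def)
      consider "w z = 0" "w (z + t *\<^sub>R e) = 0" | "w z \<noteq> 0" | "w (z + t *\<^sub>R e) \<noteq> 0" by blast
      then show ?thesis
      proof cases
        case 1
        then show ?thesis using r L M by simp
      next
        case 2
        have "((z + t *\<^sub>R e) \<bullet> e) * w (z + t *\<^sub>R e) - (z \<bullet> e) * w z = (z \<bullet> e) * d + t * w (z + t *\<^sub>R e)"
          using ee by (simp add: inner_add_left d_def algebra_simps)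
        also have "\<bar>\<dots>\<bar> \<le> \<bar>z \<bullet> e\<bar> * \<bar>d\<bar> + \<bar>t\<bar> * \<bar>w (z + t *\<^sub>R e)\<bar>" by (metis abs_mult abs_triangle_ineq)
        also have "\<dots> \<le> r * (L * \<bar>t\<bar>) + \<bar>t\<bar> * M"
          using r(2)[OF 2] ze[of z] d r(1) M by (intro add_mono mult_mono) auto
        finally show ?thesis by (simp add: algebra_simps)
      next
        case 3
        have "((z + t *\<^sub>R e) \<bullet> e) * w (z + t *\<^sub>R e) - (z \<bullet> e) * w z = ((z + t *\<^sub>R e) \<bullet> e) * d + t * w z"
          using ee by (simp add: inner_add_left d_def algebra_simps)
        also have "\<bar>\<dots>\<bar> \<le> \<bar>(z + t *\<^sub>R e) \<bullet> e\<bar> * \<bar>d\<bar> + \<bar>t\<bar> * \<bar>w z\<bar>" by (metis abs_mult abs_triangle_ineq)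
        also have "\<dots> \<le> r * (L * \<bar>t\<bar>) + \<bar>t\<bar> * M"
          using r(2)[OF 3] ze[of "z + t *\<^sub>R e"] d r(1) M by (intro add_mono mult_mono) auto
        finally show ?thesis by (simp add: algebra_simps)
      qed
    qed
    have "w \<in> borel_measurable borel" using w by (auto intro: borel_measurable_continuous_onI)
    then show "(\<lambda>z. w z + (z \<bullet> e) * g z) \<in> borel_measurable borel" using g by measurable
    show "AE z in lborel. (\<lambda>n. dquot e (\<lambda>z. (z \<bullet> e) * w z) n z) \<longlonglongrightarrow> w z + (z \<bullet> e) * g z"
      using g(2)
    proof eventually_elim
      case (elim z)
      have "(\<lambda>n. w (z + (1 / real (Suc n)) *\<^sub>R e) + (z \<bullet> e) * dquot e w n z) \<longlonglongrightarrow> w z + (z \<bullet> e) * g z"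
        by (intro tendsto_intros elim shift_tendsto[OF w])
      moreover have "w (z + (1 / real (Suc n)) *\<^sub>R e) + (z \<bullet> e) * dquot e w n z
          = dquot e (\<lambda>z. (z \<bullet> e) * w z) n z" for n
      proof -
        define N where "N = real (Suc n)"
        have N: "N * (1 / N) = 1" by (simp add: N_def)
        define y where "y = w (z + (1 / N) *\<^sub>R e)"
        have "N * ((z \<bullet> e + 1 / N) * y - (z \<bullet> e) * w z) = N * (1 / N) * y + (z \<bullet> e) * (N * (y - w z))"
          by (simp add: algebra_simps)
        then show ?thesis using ee N unfolding dquot_def N_def[symmetric] y_def[symmetric]
          by (simp add: inner_add_left)
      qed
      ultimately show ?case by simp
    qed
  qed
qed

lemma continuous_AE_0_imp_0:
  fixes w :: "'a::euclidean_space \<Rightarrow> real"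
  assumes "continuous_on UNIV w" "AE z in lborel. w z = 0"
  shows "w z = 0"
proof (rule ccontr)
  assume "w z \<noteq> 0"
  let ?S = "{z. w z \<noteq> 0}"
  have op: "open ?S" by (rule open_Collect_neq[OF assms(1) continuous_on_const])
  have "?S \<in> null_sets lborel"
    using assms(2) op by (subst (asm) AE_iff_null) auto
  then have "negligible ?S"
    by (simp add: negligible_iff_null_sets null_sets_completionI)
  then show False using open_not_negligible[OF op] \<open>w z \<noteq> 0\<close> by auto
qed

text \<open>The function \<open>(z \<bullet> e) w\<^sup>2\<close> has partial derivative \<open>w\<^sup>2 + 2 (z \<bullet> e) w g\<close>, whose integral is zero. If
\<open>g\<close> vanishes, so does the integral of \<open>w\<^sup>2\<close>.\<close>

lemma ae_partial_0_imp_0: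
  assumes w: "ae_partial e w g" and e: "e \<in> Basis" and g: "AE z in lborel. g z = 0"
  shows "w z = 0"
proof -
  have cont: "continuous_on UNIV w" using w by (simp add: ae_partial_def)
  obtain r M where r: "\<And>z. w z \<noteq> 0 \<Longrightarrow> norm z \<le> r" and M: "\<And>z. \<bar>w z\<bar> \<le> M" "0 \<le> M"
    using ae_partialE[OF w] by metis
  have wm: "w \<in> borel_measurable borel" using cont by (rule borel_measurable_continuous_onI)
  have sq: "integrable lborel (\<lambda>z. w z * w z)"
  proof (rule integrable_bounded_support[of _ "M * M" r])
    show "AE z in lborel. \<bar>w z * w z\<bar> \<le> M * M"
      using M by (intro AE_I2) (auto simp only: abs_mult intro!: mult_mono)
  qed (use wm r in auto)
  let ?h = "\<lambda>z. g z * ((z \<bullet> e) * w z) + w z * (w z + (z \<bullet> e) * g z)"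
  have h: "ae_partial e (\<lambda>z. w z * ((z \<bullet> e) * w z)) ?h"
    by (rule ae_partial_mult[OF w ae_partial_coordinate_mult[OF w e]])
  have "(LINT z|lborel. w z * w z) = (LINT z|lborel. ?h z)"
  proof (rule integral_cong_AE)
    show "(\<lambda>z. w z * w z) \<in> borel_measurable lborel" using wm by simp
    show "?h \<in> borel_measurable lborel" using h by (simp add: ae_partial_def)
    show "AE z in lborel. w z * w z = ?h z" using g by eventually_elim simp
  qed
  also have "\<dots> = 0" by (rule integral_ae_partial_eq_0[OF h])
  finally have "AE z in lborel. w z * w z = 0"
    using integral_nonneg_eq_0_iff_AE[OF sq] by simp
  then have "AE z in lborel. w z = 0" by eventually_elim simp
  then show ?thesis by (rule continuous_AE_0_imp_0[OF cont])
qed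

section \<open>Weak derivatives of Lipschitz functions\<close>

lemma test_function_partial:
  assumes \<phi>: "\<phi> \<in> test_functions \<Omega>" and e: "e \<in> Basis"
  obtains f' where "continuous_on UNIV f'" "\<And>z. ((\<lambda>t. \<phi> (z + t *\<^sub>R e)) has_real_derivative f' z) (at 0)"
    "f' = (\<lambda>z. deriv (\<lambda>t. \<phi> (z + t *\<^sub>R e)) 0)" "\<And>z. z \<notin> \<Omega> \<Longrightarrow> f' z = 0" "ae_partial e \<phi> f'"
proof -
  obtain K where K: "compact K" "K \<subseteq> \<Omega>" "\<And>z. z \<notin> K \<Longrightarrow> \<phi> z = 0" and C: "\<And>k. Ck k \<phi>"
    using \<phi> by (auto simp: test_functions_def)
  have "Ck (Suc 0) \<phi>" using C .
  then obtain f' where f': "Ck 0 f'" "\<And>z. ((\<lambda>t. \<phi> (z + t *\<^sub>R e)) has_real_derivative f' z) (at 0)"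
    using e by auto
  have cf: "continuous_on UNIV f'" using f'(1) by simp
  have c\<phi>: "continuous_on UNIV \<phi>" using C Ck_continuous by blast
  obtain r where r: "\<And>z. z \<in> K \<Longrightarrow> norm z \<le> r" using K(1) compact_imp_bounded bounded_iff by metis
  have z0: "f' z = 0" if z: "z \<notin> K" for z
  proof -
    have "open (- K)" using K(1) by (simp add: compact_imp_closed open_Compl)
    then obtain d where d: "d > 0" "ball z d \<subseteq> - K" using z open_contains_ball by (metis ComplI)
    have "((\<lambda>t. \<phi> (z + t *\<^sub>R e)) has_real_derivative 0) (at 0)"
    proof (rule has_field_derivative_transform_within_open[of "\<lambda>_. 0" _ _ "{-d<..<d}"])
      fix t assume "t \<in> {-d<..<d}"
      then have "z + t *\<^sub>R e \<in> ball z d" using e by (auto simp: dist_norm)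
      then show "0 = \<phi> (z + t *\<^sub>R e)" using d K(3) by auto
    qed (use d in auto)
    then show ?thesis using f'(2) DERIV_unique by blast
  qed
  obtain L where L: "0 \<le> L" "\<And>z. \<bar>f' z\<bar> \<le> L"
    using continuous_bounded_support_bound[OF cf, of r] z0 r by metis
  have line: "((\<lambda>t. \<phi> (z + t *\<^sub>R e)) has_real_derivative f' (z + t *\<^sub>R e)) (at t)" for z t
    by (rule line_derivative[OF f'(2)])
  have ae: "ae_partial e \<phi> f'" unfolding ae_partial_def
  proof (intro conjI exI allI impI)
    show "continuous_on UNIV \<phi>" by (rule c\<phi>)
    show "norm z \<le> r" if "\<phi> z \<noteq> 0" for z using K(3) r that by blast
    show "f' \<in> borel_measurable borel" using cf by (rule borel_measurable_continuous_onI)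
    show "\<bar>\<phi> (z + t *\<^sub>R e) - \<phi> z\<bar> \<le> L * \<bar>t\<bar>" for z t
    proof -
      have "norm (\<phi> (z + t *\<^sub>R e) - \<phi> (z + 0 *\<^sub>R e)) \<le> L * norm (t - 0)"
        by (rule field_differentiable_bound[of UNIV "\<lambda>t. \<phi> (z + t *\<^sub>R e)" "\<lambda>t. f' (z + t *\<^sub>R e)"])
           (use line L in auto)
      then show ?thesis by simp
    qed
    show "AE z in lborel. (\<lambda>n. dquot e \<phi> n z) \<longlonglongrightarrow> f' z"
    proof (rule AE_I2)
      fix z
      have "((\<lambda>h. (\<phi> (z + (0 + h) *\<^sub>R e) - \<phi> (z + 0 *\<^sub>R e)) / h) \<longlongrightarrow> f' z) (at 0)"
        using f'(2)[of z] unfolding DERIV_def .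
      moreover have "filterlim (\<lambda>n. 1 / real (Suc n)) (at 0) sequentially"
        unfolding filterlim_at by (intro conjI LIMSEQ_Suc[OF lim_1_over_n]) auto
      ultimately have "(\<lambda>n. (\<phi> (z + (0 + 1 / real (Suc n)) *\<^sub>R e) - \<phi> (z + 0 *\<^sub>R e)) / (1 / real (Suc n))) \<longlonglongrightarrow> f' z"
        by (rule filterlim_compose)
      then show "(\<lambda>n. dquot e \<phi> n z) \<longlonglongrightarrow> f' z" by (simp add: dquot_def mult.commute)
    qed
  qed
  show thesis
    by (rule that[OF cf f'(2) _ _ ae]) (use z0 K(2) f'(2) in \<open>auto intro!: ext DERIV_imp_deriv[symmetric]\<close>)
qed

text \<open>The derivative \<open>g \<phi> + w \<phi>'\<close> of \<open>w \<phi>\<close> has integral zero.\<close>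

lemma ae_partial_has_weak_partial:
  assumes w: "ae_partial e w g" and e: "e \<in> Basis" and \<Omega>: "open \<Omega>"
  shows "has_weak_partial \<Omega> e w g"
  unfolding has_weak_partial_def
proof (intro conjI ballI)
  obtain r M where cont: "continuous_on UNIV w" and r: "\<And>z. w z \<noteq> 0 \<Longrightarrow> norm z \<le> r" and M: "\<And>z. \<bar>w z\<bar> \<le> M"
    using ae_partialE[OF w] by metis
  have wi: "integrable lborel w"
    by (rule integrable_bounded_support[OF _ _ r]) (use cont M in \<open>auto intro: borel_measurable_continuous_onI\<close>)
  have loc: "locally_integrable \<Omega> f" if "integrable lborel f" for f :: "'a \<Rightarrow> real"
    unfolding locally_integrable_def set_integrable_def
    using that by (intro allI impI integrable_mult_indicator) (auto simp: compact_imp_closed)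
  show "locally_integrable \<Omega> w" using loc wi .
  show "locally_integrable \<Omega> g" using loc integral_ae_partial_eq_0[OF w] by blast
  fix \<phi> assume \<phi>: "\<phi> \<in> test_functions \<Omega>"
  obtain f' where f': "f' = (\<lambda>z. deriv (\<lambda>t. \<phi> (z + t *\<^sub>R e)) 0)" "\<And>z. z \<notin> \<Omega> \<Longrightarrow> f' z = 0" "ae_partial e \<phi> f'"
    "continuous_on UNIV f'"
    using test_function_partial[OF \<phi> e] by metis
  have \<phi>0: "\<phi> z = 0" if "z \<notin> \<Omega>" for z using \<phi> that by (auto simp: test_functions_def)
  have p: "ae_partial e (\<lambda>z. w z * \<phi> z) (\<lambda>z. g z * \<phi> z + w z * f' z)" by (rule ae_partial_mult[OF w f'(3)])
  obtain s Q where c\<phi>: "continuous_on UNIV \<phi>" and Q: "\<And>z. \<bar>\<phi> z\<bar> \<le> Q"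
    using ae_partialE[OF f'(3)] by metis
  have gi: "integrable lborel (\<lambda>z. g z * \<phi> z)"
  proof (rule Bochner_Integration.integrable_bound)
    show "integrable lborel (\<lambda>z. Q * g z)" using integral_ae_partial_eq_0[OF w] by simp
    show "(\<lambda>z. g z * \<phi> z) \<in> borel_measurable lborel"
    proof (intro borel_measurable_times)
      show "g \<in> borel_measurable lborel" using w by (simp add: ae_partial_def)
      show "\<phi> \<in> borel_measurable lborel" using borel_measurable_continuous_onI[OF c\<phi>] by simp
    qed
    show "AE z in lborel. norm (g z * \<phi> z) \<le> norm (Q * g z)"
      using Q by (intro AE_I2) (auto simp: abs_mult mult.commute intro!: mult_right_mono order_trans[OF Q abs_ge_self])
  qed
  have "integrable lborel (\<lambda>z. (g z * \<phi> z + w z * f' z) - g z * \<phi> z)"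
    by (intro Bochner_Integration.integrable_diff gi integral_ae_partial_eq_0[OF p])
  then have wfi: "integrable lborel (\<lambda>z. w z * f' z)" by simp
  have "0 = (LINT z|lborel. g z * \<phi> z) + (LINT z|lborel. w z * f' z)"
    using integral_ae_partial_eq_0(2)[OF p] gi wfi by simp
  moreover have "(LINT z:\<Omega>|lborel. g z * \<phi> z) = (LINT z|lborel. g z * \<phi> z)"
    unfolding set_lebesgue_integral_def using \<phi>0 by (intro Bochner_Integration.integral_cong) (auto simp: indicator_def)
  moreover have "(LINT z:\<Omega>|lborel. w z * f' z) = (LINT z|lborel. w z * f' z)"
    unfolding set_lebesgue_integral_def using f'(2) by (intro Bochner_Integration.integral_cong) (auto simp: indicator_def)
  ultimately show "(LINT z:\<Omega>|lborel. w z * deriv (\<lambda>t. \<phi> (z + t *\<^sub>R e)) 0) = - (LINT z:\<Omega>|lborel. g z * \<phi> z)"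
    unfolding f'(1) by linarith
qed

lemma has_weak_partial_unique:
  assumes \<Omega>: "open \<Omega>" and g: "has_weak_partial \<Omega> e w g" and h: "has_weak_partial \<Omega> e w h"
  shows "AE z in lborel. z \<in> \<Omega> \<longrightarrow> g z = h z"
proof -
  have loc: "locally_integrable \<Omega> g" "locally_integrable \<Omega> h" using g h by (auto simp: has_weak_partial_def)
  have locd: "locally_integrable \<Omega> (\<lambda>z. g z - h z)"
    using loc by (auto simp: locally_integrable_def intro!: set_integral_diff(1))
  have "AE z in lborel. z \<in> \<Omega> \<longrightarrow> g z - h z = 0"
  proof (rule AE_0_if_orthogonal_to_test_functions[OF \<Omega> locd])
    fix \<phi> assume \<phi>: "\<phi> \<in> test_functions \<Omega>"
    obtain K where K: "compact K" "K \<subseteq> \<Omega>" "\<And>z. z \<notin> K \<Longrightarrow> \<phi> z = 0" and C: "\<And>k. Ck k \<phi>"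
      using \<phi> by (auto simp: test_functions_def)
    have c\<phi>: "continuous_on UNIV \<phi>" using C Ck_continuous by blast
    obtain r where r: "\<And>z. z \<in> K \<Longrightarrow> norm z \<le> r" using K(1) compact_imp_bounded bounded_iff by metis
    obtain Q where Q: "\<And>z. \<bar>\<phi> z\<bar> \<le> Q" using continuous_bounded_support_bound[OF c\<phi>, of r] K(3) r by metis
    have int: "set_integrable lborel \<Omega> (\<lambda>z. f z * \<phi> z)" if f: "locally_integrable \<Omega> f" for f
    proof -
      have fK: "integrable lborel (\<lambda>z. indicator K z *\<^sub>R f z)"
        using f K unfolding locally_integrable_def set_integrable_def by blast
      have "integrable lborel (\<lambda>z. (indicator K z *\<^sub>R f z) * \<phi> z)"
      proof (rule Bochner_Integration.integrable_bound)
        show "integrable lborel (\<lambda>z. Q * (indicator K z *\<^sub>R f z))" using fK by (intro integrable_mult_right)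
        show "(\<lambda>z. (indicator K z *\<^sub>R f z) * \<phi> z) \<in> borel_measurable lborel"
          by (intro borel_measurable_times borel_measurable_integrable[OF fK])
             (use c\<phi> in \<open>auto intro!: borel_measurable_continuous_onI\<close>)
        show "AE z in lborel. norm ((indicator K z *\<^sub>R f z) * \<phi> z) \<le> norm (Q * (indicator K z *\<^sub>R f z))"
        proof (rule AE_I2)
          fix z
          have "\<bar>\<phi> z\<bar> \<le> \<bar>Q\<bar>" using Q[of z] by linarith
          then show "norm ((indicator K z *\<^sub>R f z) * \<phi> z) \<le> norm (Q * (indicator K z *\<^sub>R f z))"
            by (simp only: real_norm_def abs_mult) (metis abs_ge_zero mult.commute mult_left_mono abs_mult)
        qed
      qed
      moreover have "(indicator K z *\<^sub>R f z) * \<phi> z = indicator \<Omega> z *\<^sub>R (f z * \<phi> z)" for z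
        using K by (auto simp: indicator_def)
      ultimately show ?thesis unfolding set_integrable_def by (simp only:)
    qed
    have "(LINT z:\<Omega>|lborel. (g z - h z) * \<phi> z) = (LINT z:\<Omega>|lborel. g z * \<phi> z) - (LINT z:\<Omega>|lborel. h z * \<phi> z)"
      using set_integral_diff(2)[OF int[OF loc(1)] int[OF loc(2)]] by (simp add: left_diff_distrib)
    moreover have "(LINT z:\<Omega>|lborel. g z * \<phi> z) = (LINT z:\<Omega>|lborel. h z * \<phi> z)"
      using g h \<phi> unfolding has_weak_partial_def by fastforce
    ultimately show "(LINT z:\<Omega>|lborel. (g z - h z) * \<phi> z) = 0" by simp
  qed
  then show ?thesis by eventually_elim simp
qed

text \<open>The chosen version of the weak derivative is only known through its defining property; uniqueness
identifies its integrals with those of \<open>g\<close>.\<close>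

lemma integral_weak_partial:
  assumes w: "ae_partial e w g" and e: "e \<in> Basis" and \<Omega>: "open \<Omega>"
  shows "(LINT z:\<Omega>|lborel. \<bar>weak_partial \<Omega> e w z\<bar> powr p) = (LINT z:\<Omega>|lborel. \<bar>g z\<bar> powr p)"
proof -
  have g: "has_weak_partial \<Omega> e w g" by (rule ae_partial_has_weak_partial[OF assms])
  then have h: "has_weak_partial \<Omega> e w (weak_partial \<Omega> e w)"
    unfolding weak_partial_def by (rule someI[of "has_weak_partial \<Omega> e w"])
  let ?h = "weak_partial \<Omega> e w"
  have hm: "(\<lambda>z. indicator \<Omega> z *\<^sub>R ?h z) \<in> borel_measurable lborel"
    using locally_integrable_measurable[OF \<Omega>, of ?h] h by (simp add: has_weak_partial_def set_borel_measurable_def)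
  define k where "k z = indicator \<Omega> z *\<^sub>R ?h z" for z
  have [measurable]: "k \<in> borel_measurable borel" "\<Omega> \<in> sets borel" using hm \<Omega> by (auto simp: k_def[abs_def])
  have "(\<lambda>z. indicator \<Omega> z *\<^sub>R \<bar>k z\<bar> powr p) \<in> borel_measurable lborel" by measurable
  moreover have "indicator \<Omega> z *\<^sub>R \<bar>k z\<bar> powr p = indicator \<Omega> z *\<^sub>R \<bar>?h z\<bar> powr p" for z
    by (simp add: indicator_def k_def)
  ultimately have m: "(\<lambda>z. indicator \<Omega> z *\<^sub>R \<bar>?h z\<bar> powr p) \<in> borel_measurable lborel" by (simp only:)
  show ?thesis unfolding set_lebesgue_integral_def
  proof (rule integral_cong_AE[OF m])
    show "(\<lambda>z. indicator \<Omega> z *\<^sub>R \<bar>g z\<bar> powr p) \<in> borel_measurable lborel"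
      using w \<Omega> by (auto simp: ae_partial_def)
    show "AE z in lborel. indicator \<Omega> z *\<^sub>R \<bar>?h z\<bar> powr p = indicator \<Omega> z *\<^sub>R \<bar>g z\<bar> powr p"
      using has_weak_partial_unique[OF \<Omega> h g] by eventually_elim (auto simp: indicator_def)
  qed
qed

section \<open>Mollification\<close>

lemma Ck_convolution:
  fixes w :: "'a::euclidean_space \<Rightarrow> real"
  assumes w: "continuous_on UNIV w"
  shows "Ck k \<eta> \<Longrightarrow> Ck k (\<lambda>z. integral (cbox a b) (\<lambda>t. w t * \<eta> (z - t)))"
proof (induction k arbitrary: \<eta>)
  case 0
  then have c: "continuous_on UNIV \<eta>" by simp
  have "continuous_on (UNIV \<times> cbox a b) (\<lambda>(z, t). w t * \<eta> (z - t))"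
    unfolding split_def
    by (intro continuous_on_mult continuous_on_compose2[OF w] continuous_on_compose2[OF c]
        continuous_on_diff continuous_on_fst continuous_on_snd continuous_on_id) auto
  then show ?case by (simp add: integral_continuous_on_param)
next
  case (Suc k)
  show ?case unfolding Ck.simps
  proof (intro conjI ballI)
    have c: "continuous_on UNIV \<eta>" using Suc.prems Ck_continuous by blast
    show "continuous_on UNIV (\<lambda>z. integral (cbox a b) (\<lambda>t. w t * \<eta> (z - t)))"
      using Ck_continuous[OF Suc.IH[OF Ck_SucD[OF Suc.prems]]] .
    fix e :: 'a assume e: "e \<in> Basis"
    obtain f' where f': "Ck k f'" "\<And>z. ((\<lambda>t. \<eta> (z + t *\<^sub>R e)) has_real_derivative f' z) (at 0)"
      using Suc.prems e by auto
    have cf: "continuous_on UNIV f'" using f'(1) Ck_continuous by blast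
    have line: "((\<lambda>\<tau>. \<eta> (x + \<tau> *\<^sub>R e)) has_real_derivative f' (x + \<tau> *\<^sub>R e)) (at \<tau>)" for x \<tau>
      by (rule line_derivative[OF f'(2)])
    have "((\<lambda>\<tau>. integral (cbox a b) (\<lambda>t. w t * \<eta> (z + \<tau> *\<^sub>R e - t))) has_real_derivative
        integral (cbox a b) (\<lambda>t. w t * f' (z + 0 *\<^sub>R e - t))) (at 0 within UNIV)" for z
    proof (rule leibniz_rule_field_derivative[where U=UNIV])
      fix \<tau> :: real and t :: 'a
      have "((\<lambda>\<tau>. \<eta> (z - t + \<tau> *\<^sub>R e)) has_real_derivative f' (z - t + \<tau> *\<^sub>R e)) (at \<tau>)" by (rule line)
      from DERIV_cmult[OF this, of "w t"]
      show "((\<lambda>\<tau>. w t * \<eta> (z + \<tau> *\<^sub>R e - t)) has_real_derivative w t * f' (z + \<tau> *\<^sub>R e - t)) (at \<tau> within UNIV)"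
        by (simp add: algebra_simps)
      have "continuous_on (cbox a b) (\<lambda>t. w t * \<eta> (z + \<tau> *\<^sub>R e - t))"
        by (intro continuous_on_mult continuous_on_compose2[OF w] continuous_on_compose2[OF c]
            continuous_on_diff continuous_on_const continuous_on_id) auto
      then show "(\<lambda>t. w t * \<eta> (z + \<tau> *\<^sub>R e - t)) integrable_on cbox a b" by (rule integrable_continuous)
    next
      show "continuous_on (UNIV \<times> cbox a b) (\<lambda>(\<tau>, t). w t * f' (z + \<tau> *\<^sub>R e - t))"
        unfolding split_def
        by (intro continuous_on_mult continuous_on_compose2[OF w] continuous_on_compose2[OF cf] continuous_on_add
          continuous_on_scaleR continuous_on_diff continuous_on_const continuous_on_fst continuous_on_snd continuous_on_id) auto
    qed auto
    then show "\<exists>h. Ck k h \<and> (\<forall>z. ((\<lambda>\<tau>. integral (cbox a b) (\<lambda>t. w t * \<eta> (z + \<tau> *\<^sub>R e - t))) has_real_derivative h z) (at 0))"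
      using Suc.IH[OF f'(1)] by (intro exI[of _ "\<lambda>z. integral (cbox a b) (\<lambda>t. w t * f' (z - t))"]) auto
  qed
qed

lemma weighted_average_bound:
  fixes F k :: "'a::euclidean_space \<Rightarrow> real"
  assumes F: "continuous_on UNIV F" and k: "continuous_on UNIV k" "\<And>t. 0 \<le> k t" "\<And>t. k t \<noteq> 0 \<Longrightarrow> norm t \<le> r"
    and I: "(LINT t|lborel. k t) = I" "0 < I" and bound: "\<And>t. k t \<noteq> 0 \<Longrightarrow> \<bar>F t - D\<bar> \<le> B"
  shows "\<bar>(LINT t|lborel. F t * k t) / I - D\<bar> \<le> B"
proof -
  have int: "integrable lborel f" if f: "continuous_on UNIV f" "\<And>t. f t \<noteq> 0 \<Longrightarrow> norm t \<le> r" for f :: "'a \<Rightarrow> real"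
  proof -
    obtain M where "\<And>z. \<bar>f z\<bar> \<le> M" using continuous_bounded_support_bound[OF f] by blast
    then show ?thesis using f by (intro integrable_bounded_support[of f M r]) (auto intro: borel_measurable_continuous_onI)
  qed
  have ki: "integrable lborel k" by (rule int[OF k(1,3)])
  have Fk: "integrable lborel (\<lambda>t. F t * k t)" using F k(1,3) by (intro int) (auto intro!: continuous_on_mult)
  have "(LINT t|lborel. F t * k t) - D * I = (LINT t|lborel. F t * k t - D * k t)"
    using ki Fk I(1) by simp
  also have "\<dots> = (LINT t|lborel. (F t - D) * k t)" by (simp add: left_diff_distrib)
  finally have eq: "(LINT t|lborel. F t * k t) - D * I = (LINT t|lborel. (F t - D) * k t)" .
  have "\<bar>LINT t|lborel. (F t - D) * k t\<bar> \<le> (LINT t|lborel. \<bar>(F t - D) * k t\<bar>)"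
    by (rule integral_abs_bound)
  also have "\<dots> \<le> (LINT t|lborel. B * k t)"
  proof (rule integral_mono)
    have "integrable lborel (\<lambda>t. F t * k t - D * k t)" using ki Fk by simp
    then show "integrable lborel (\<lambda>t. \<bar>(F t - D) * k t\<bar>)" by (simp add: left_diff_distrib)
    show "integrable lborel (\<lambda>t. B * k t)" using ki by simp
    show "\<bar>(F t - D) * k t\<bar> \<le> B * k t" for t
      using bound[of t] k(2)[of t] by (cases "k t = 0") (auto simp: abs_mult intro!: mult_right_mono)
  qed
  also have "\<dots> = B * I" using I(1) by simp
  finally have "\<bar>(LINT t|lborel. F t * k t) - D * I\<bar> \<le> B * I" using eq by simp
  moreover have "(LINT t|lborel. F t * k t) / I - D = ((LINT t|lborel. F t * k t) - D * I) / I"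
    using I(2) by (simp add: field_simps)
  ultimately show ?thesis using I(2) by (simp add: divide_le_eq)
qed

lemma integral_reflect:
  fixes f :: "'a::euclidean_space \<Rightarrow> real"
  assumes "f \<in> borel_measurable borel"
  shows "(LINT t|lborel. f (z - t)) = (LINT t|lborel. f t)"
proof -
  have "distr lborel borel (\<lambda>t::'a. z - t) = lborel"
    using lborel_affine[of "-1" z] by (simp add: density_1)
  then have "(LINT t|lborel. f t) = (LINT t|distr lborel borel (\<lambda>t. z - t). f t)" by simp
  also have "\<dots> = (LINT t|lborel. f (z - t))"
    using assms by (intro integral_distr) auto
  finally show ?thesis by simp
qed

text \<open>The function is first shrunk by the factor \<open>s\<close> towards the centre \<open>c\<close> of the box, which moves its support away
from the boundary, and then averaged over a box of relative size \<open>(1 - s) / 2\<close>, which still leaves room. Each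
value of the result, and each of its increments, is an average of values and increments of \<open>w\<close> at points
near \<open>z\<close>; the last two conclusions express this by saying that every bound for all points near \<open>z\<close> is
inherited.\<close>

lemma mollified_dilation:
  fixes a b :: "'a::euclidean_space" and w :: "'a \<Rightarrow> real"
  defines "c \<equiv> (1 / 2) *\<^sub>R (a + b)" and "h \<equiv> (1 / 2) *\<^sub>R (b - a)"
  defines "H \<equiv> (\<Sum>i\<in>Basis. h \<bullet> i)"
  assumes ab: "\<And>i. i \<in> Basis \<Longrightarrow> a \<bullet> i < b \<bullet> i"
    and w: "continuous_on UNIV w" "\<And>z. z \<notin> box a b \<Longrightarrow> w z = 0"
    and s: "0 < s" "s < 1"
  obtains \<phi> where "\<phi> \<in> test_functions (box a b)"
    "\<And>z d B. (\<And>y. norm (y - z) \<le> (1 - s) * (H + norm (z - c)) / s \<Longrightarrow> \<bar>w y - d\<bar> \<le> B) \<Longrightarrow> \<bar>\<phi> z - d\<bar> \<le> B"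
    "\<And>z e \<tau> d B. (\<And>y. norm (y - z) \<le> (1 - s) * (H + norm (z - c)) / s \<Longrightarrow> \<bar>w (y + (\<tau> / s) *\<^sub>R e) - w y - d\<bar> \<le> B)
       \<Longrightarrow> \<bar>\<phi> (z + \<tau> *\<^sub>R e) - \<phi> z - d\<bar> \<le> B"
proof -
  define \<rho> where "\<rho> = (1 - s) / 2"
  have \<rho>: "0 < \<rho>" "s + \<rho> < 1" using s by (auto simp: \<rho>_def field_simps)
  have h: "h \<bullet> i > 0" if "i \<in> Basis" for i using ab[OF that] by (simp add: h_def inner_diff_left)
  define y where "y t = c + (1 / s) *\<^sub>R (t - c)" for t
  define ws where "ws t = w (y t)" for t
  define \<eta> where "\<eta> = box_bump 1 (- \<rho> *\<^sub>R h) (\<rho> *\<^sub>R h)"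
  have \<eta>C: "Ck k \<eta>" for k unfolding \<eta>_def by (rule Ck_box_bump)
  have \<eta>c: "continuous_on UNIV \<eta>" using \<eta>C Ck_continuous by blast
  have \<eta>0: "0 \<le> \<eta> z" for z unfolding \<eta>_def by (rule box_bump_bounds)
  have \<eta>s: "\<bar>z \<bullet> i\<bar> < \<rho> * (h \<bullet> i)" if "\<eta> z \<noteq> 0" "i \<in> Basis" for z i
    using box_bump_eq_0[of 1 z "- \<rho> *\<^sub>R h" "\<rho> *\<^sub>R h"] that unfolding \<eta>_def by (fastforce simp: mem_box)
  have \<eta>n: "norm z \<le> \<rho> * H" if "\<eta> z \<noteq> 0" for z
  proof -
    have "norm z \<le> (\<Sum>i\<in>Basis. \<bar>z \<bullet> i\<bar>)" by (rule norm_le_l1)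
    also have "\<dots> \<le> (\<Sum>i\<in>Basis. \<rho> * (h \<bullet> i))" using \<eta>s[OF that] by (intro sum_mono) force
    finally show ?thesis by (simp add: H_def sum_distrib_left)
  qed
  have \<eta>m: "\<eta> \<in> borel_measurable borel" using \<eta>c by (rule borel_measurable_continuous_onI)
  define I where "I = (LINT t|lborel. \<eta> t)"
  have I: "I > 0"
  proof -
    obtain M where M: "\<And>z. \<bar>\<eta> z\<bar> \<le> M" using continuous_bounded_support_bound[OF \<eta>c \<eta>n] by blast
    have int: "integrable lborel \<eta>" by (rule integrable_bounded_support[OF \<eta>m _ \<eta>n]) (use M in auto)
    have "I \<noteq> 0"
    proof
      assume "I = 0"
      then have "AE z in lborel. \<eta> z = 0"
        using integral_nonneg_eq_0_iff_AE[OF int] \<eta>0 by (simp add: I_def)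
      then have "\<eta> 0 = 0" by (rule continuous_AE_0_imp_0[OF \<eta>c])
      moreover have "0 < \<eta> 0" unfolding \<eta>_def using h \<rho> by (intro box_bump_pos) (auto simp: mem_box)
      ultimately show False by simp
    qed
    moreover have "I \<ge> 0" using \<eta>0 by (simp add: I_def)
    ultimately show ?thesis by simp
  qed
  have Iz: "(LINT t|lborel. \<eta> (z - t)) = I" for z unfolding I_def by (rule integral_reflect[OF \<eta>m])
  have wsc: "continuous_on UNIV ws" unfolding ws_def y_def
    by (intro continuous_on_compose2[OF w(1)] continuous_intros) auto
  have box: "z \<in> box a b \<longleftrightarrow> (\<forall>i\<in>Basis. \<bar>(z - c) \<bullet> i\<bar> < h \<bullet> i)" for z
    unfolding mem_box c_def h_def by (intro ball_cong refl) (auto simp: inner_diff_left inner_add_left abs_less_iff field_simps)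
  have ws0: "\<bar>(t - c) \<bullet> i\<bar> < s * (h \<bullet> i)" if "ws t \<noteq> 0" "i \<in> Basis" for t i
  proof -
    have "y t \<in> box a b" using that w(2) by (auto simp: ws_def)
    then have "\<bar>(y t - c) \<bullet> i\<bar> < h \<bullet> i" using box that by blast
    moreover have "(y t - c) \<bullet> i = ((t - c) \<bullet> i) / s" by (simp add: y_def)
    ultimately show ?thesis using s by (simp add: field_simps)
  qed
  define \<phi> where "\<phi> z = (LINT t|lborel. ws t * \<eta> (z - t)) / I" for z
  have cz: "continuous_on UNIV (\<lambda>t. \<eta> (z - t))" for z
    by (intro continuous_on_compose2[OF \<eta>c] continuous_intros) auto
  have \<phi>HK: "\<phi> z = 1 / I * integral (cbox a b) (\<lambda>t. ws t * \<eta> (z - t))" for z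
  proof -
    have "set_integrable lborel (cbox a b) (\<lambda>t. ws t * \<eta> (z - t))"
      unfolding set_integrable_def
      by (rule borel_integrable_compact) (auto intro!: continuous_on_mult continuous_on_subset[OF wsc] continuous_on_subset[OF cz])
    then have "integral (cbox a b) (\<lambda>t. ws t * \<eta> (z - t)) = (LINT t:cbox a b|lborel. ws t * \<eta> (z - t))"
      by (simp add: set_borel_integral_eq_integral)
    also have "\<dots> = (LINT t|lborel. ws t * \<eta> (z - t))"
      unfolding set_lebesgue_integral_def
    proof (rule Bochner_Integration.integral_cong[OF refl])
      fix t
      have "t \<in> box a b" if "ws t \<noteq> 0"
        unfolding box
      proof
        fix i :: 'a assume i: "i \<in> Basis"
        have "s * (h \<bullet> i) \<le> h \<bullet> i" using s h[OF i] by simp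
        then show "\<bar>(t - c) \<bullet> i\<bar> < h \<bullet> i" using ws0[OF that i] by linarith
      qed
      then show "indicator (cbox a b) t *\<^sub>R (ws t * \<eta> (z - t)) = ws t * \<eta> (z - t)"
        using box_subset_cbox[of a b] by (auto simp: indicator_def)
    qed
    finally show ?thesis by (simp add: \<phi>_def)
  qed
  have "Ck k \<phi>" for k
  proof -
    have "Ck k (\<lambda>z. 1 / I * integral (cbox a b) (\<lambda>t. ws t * \<eta> (z - t)))"
      by (intro Ck_mult Ck_const Ck_convolution wsc \<eta>C)
    then show ?thesis using \<phi>HK by presburger
  qed
  moreover have "\<phi> z = 0" if "z \<notin> cbox (c - (s + \<rho>) *\<^sub>R h) (c + (s + \<rho>) *\<^sub>R h)" for z
  proof -
    have "ws t * \<eta> (z - t) = 0" for t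
    proof (rule ccontr)
      assume nz: "ws t * \<eta> (z - t) \<noteq> 0"
      have "\<bar>(z - c) \<bullet> i\<bar> \<le> (s + \<rho>) * (h \<bullet> i)" if i: "i \<in> Basis" for i
      proof -
        have "(z - c) \<bullet> i = (t - c) \<bullet> i + (z - t) \<bullet> i" by (simp add: inner_diff_left)
        then show ?thesis using ws0[OF _ i, of t] \<eta>s[OF _ i, of "z - t"] nz by (auto simp: distrib_right abs_if split: if_splits)
      qed
      then have "z \<in> cbox (c - (s + \<rho>) *\<^sub>R h) (c + (s + \<rho>) *\<^sub>R h)"
        by (fastforce simp: mem_box inner_diff_left inner_add_left abs_le_iff)
      then show False using that by simp
    qed
    then have "(\<lambda>t. ws t * \<eta> (z - t)) = (\<lambda>t. 0)" by blast
    then show ?thesis by (simp add: \<phi>_def)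
  qed
  moreover have "cbox (c - (s + \<rho>) *\<^sub>R h) (c + (s + \<rho>) *\<^sub>R h) \<subseteq> box a b"
  proof
    fix z assume z: "z \<in> cbox (c - (s + \<rho>) *\<^sub>R h) (c + (s + \<rho>) *\<^sub>R h)"
    show "z \<in> box a b" unfolding box
    proof
      fix i :: 'a assume i: "i \<in> Basis"
      have "\<bar>(z - c) \<bullet> i\<bar> \<le> (s + \<rho>) * (h \<bullet> i)"
        using z i by (fastforce simp: mem_box inner_diff_left inner_add_left abs_le_iff)
      also have "\<dots> < 1 * (h \<bullet> i)" using \<rho> h[OF i] by (intro mult_strict_right_mono)
      finally show "\<bar>(z - c) \<bullet> i\<bar> < h \<bullet> i" by simp
    qed
  qed
  ultimately have test: "\<phi> \<in> test_functions (box a b)"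
    unfolding test_functions_def by (auto intro!: exI[of _ "cbox (c - (s + \<rho>) *\<^sub>R h) (c + (s + \<rho>) *\<^sub>R h)"])
  have near: "norm (y t - z) \<le> (1 - s) * (H + norm (z - c)) / s" if "\<eta> (z - t) \<noteq> 0" for z t
  proof -
    have H: "0 \<le> H" unfolding H_def using h by (intro sum_nonneg) force
    have "s *\<^sub>R (y t - z) = (t - z) + (1 - s) *\<^sub>R (z - c)"
      using s by (simp add: y_def algebra_simps)
    then have "s * norm (y t - z) = norm ((t - z) + (1 - s) *\<^sub>R (z - c))"
      using s by (metis abs_of_pos norm_scaleR)
    also have "\<dots> \<le> norm (t - z) + (1 - s) * norm (z - c)"
      using s by (intro order_trans[OF norm_triangle_ineq]) simp
    also have "norm (t - z) \<le> \<rho> * H" using \<eta>n[OF that] by (simp add: norm_minus_commute)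
    also have "\<rho> * H \<le> (1 - s) * H" using s H by (intro mult_right_mono) (auto simp: \<rho>_def)
    finally show ?thesis using s by (simp add: field_simps)
  qed
  have kn: "norm t \<le> \<rho> * H + norm z" if "\<eta> (z - t) \<noteq> 0" for t z
    using \<eta>n[OF that] norm_triangle_ineq4[of z "z - t"] by simp
  show thesis
  proof (rule that[OF test])
    fix z d B
    assume near_bound: "\<And>y. norm (y - z) \<le> (1 - s) * (H + norm (z - c)) / s \<Longrightarrow> \<bar>w y - d\<bar> \<le> B"
    show "\<bar>\<phi> z - d\<bar> \<le> B" unfolding \<phi>_def
      by (rule weighted_average_bound[OF wsc cz \<eta>0 kn Iz I]) (use near_bound near in \<open>auto simp: ws_def\<close>)
  next
    fix z e \<tau> d B
    assume near_bound: "\<And>y. norm (y - z) \<le> (1 - s) * (H + norm (z - c)) / s \<Longrightarrow> \<bar>w (y + (\<tau> / s) *\<^sub>R e) - w y - d\<bar> \<le> B"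
    have cs: "continuous_on UNIV (\<lambda>t. ws (t + \<tau> *\<^sub>R e))"
      by (intro continuous_on_compose2[OF wsc] continuous_intros) auto
    have int: "integrable lborel (\<lambda>t. f t * \<eta> (z - t))" if "continuous_on UNIV f" for f
    proof -
      have c: "continuous_on UNIV (\<lambda>t. f t * \<eta> (z - t))" using that cz by (rule continuous_on_mult)
      have n: "norm t \<le> \<rho> * H + norm z" if "f t * \<eta> (z - t) \<noteq> 0" for t using that kn by auto
      obtain M where "\<And>t. \<bar>f t * \<eta> (z - t)\<bar> \<le> M" using continuous_bounded_support_bound[OF c n] by blast
      then show ?thesis by (intro integrable_bounded_support[OF borel_measurable_continuous_onI[OF c] _ n]) auto
    qed
    have "(\<lambda>t. ws t * \<eta> (z + \<tau> *\<^sub>R e - t)) \<in> borel_measurable borel"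
      by (intro borel_measurable_continuous_onI continuous_on_mult wsc cz)
    from integral_translate[OF this, of "\<tau> *\<^sub>R e"]
    have "\<phi> (z + \<tau> *\<^sub>R e) = (LINT t|lborel. ws (t + \<tau> *\<^sub>R e) * \<eta> (z - t)) / I" by (simp add: \<phi>_def)
    then have "\<phi> (z + \<tau> *\<^sub>R e) - \<phi> z
        = ((LINT t|lborel. ws (t + \<tau> *\<^sub>R e) * \<eta> (z - t)) - (LINT t|lborel. ws t * \<eta> (z - t))) / I"
      by (simp add: \<phi>_def diff_divide_distrib)
    also have "\<dots> = (LINT t|lborel. (ws (t + \<tau> *\<^sub>R e) - ws t) * \<eta> (z - t)) / I"
      using int[OF cs] int[OF wsc] by (simp add: left_diff_distrib)
    finally have eq: "\<phi> (z + \<tau> *\<^sub>R e) - \<phi> z = (LINT t|lborel. (ws (t + \<tau> *\<^sub>R e) - ws t) * \<eta> (z - t)) / I" .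
    have ye: "y (t + \<tau> *\<^sub>R e) = y t + (\<tau> / s) *\<^sub>R e" for t by (simp add: y_def algebra_simps)
    show "\<bar>\<phi> (z + \<tau> *\<^sub>R e) - \<phi> z - d\<bar> \<le> B" unfolding eq
      by (rule weighted_average_bound[OF continuous_on_diff[OF cs wsc] cz \<eta>0 kn Iz I])
         (use near_bound near in \<open>auto simp: ws_def ye\<close>)
  qed
qed

section \<open>Lipschitz functions with zero boundary values are Sobolev functions\<close>

text \<open>The base point \<open>y\<close> varies together with the increment, so the estimate survives averaging over points near
\<open>z\<close>. Pointwise differentiability would not.\<close>

definition strict_partial :: "'a::euclidean_space \<Rightarrow> ('a \<Rightarrow> real) \<Rightarrow> 'a \<Rightarrow> real \<Rightarrow> bool" where
  "strict_partial e w z d \<longleftrightarrow> (\<forall>\<epsilon>>0. \<exists>\<delta>>0. \<forall>y\<in>ball z \<delta>. \<forall>t. \<bar>t\<bar> < \<delta> \<longrightarrow>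
     \<bar>w (y + t *\<^sub>R e) - w y - t * d\<bar> \<le> \<epsilon> * \<bar>t\<bar>)"

text \<open>What the Sobolev space arguments use of a finite element function, described without reference to a mesh. The size
of the gradient enters only through the Lipschitz bound, and the exceptional set only as a null set.\<close>

definition regular_on_box :: "'a::euclidean_space \<Rightarrow> 'a \<Rightarrow> ('a \<Rightarrow> real) \<Rightarrow> bool" where
  "regular_on_box a b w \<longleftrightarrow> continuous_on UNIV w \<and> (\<forall>z. z \<notin> box a b \<longrightarrow> w z = 0) \<and>
     (\<exists>L. \<forall>e\<in>Basis. \<forall>z t. \<bar>w (z + t *\<^sub>R e) - w z\<bar> \<le> L * \<bar>t\<bar>) \<and>
     (AE z in lborel. \<forall>e\<in>Basis. \<exists>d. strict_partial e w z d)"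

definition partial :: "'a::euclidean_space \<Rightarrow> ('a \<Rightarrow> real) \<Rightarrow> 'a \<Rightarrow> real" where
  "partial e w z = lim (\<lambda>n. dquot e w n z)"

lemma strict_partial_dquot:
  assumes "strict_partial e w z d" shows "(\<lambda>n. dquot e w n z) \<longlonglongrightarrow> d"
proof (rule LIMSEQ_I)
  fix \<epsilon> :: real assume \<epsilon>: "0 < \<epsilon>"
  then obtain \<delta> where \<delta>: "\<delta> > 0" "\<And>y t. y \<in> ball z \<delta> \<Longrightarrow> \<bar>t\<bar> < \<delta> \<Longrightarrow> \<bar>w (y + t *\<^sub>R e) - w y - t * d\<bar> \<le> (\<epsilon> / 2) * \<bar>t\<bar>"
    using assms unfolding strict_partial_def by (metis half_gt_zero)
  obtain n0 where n0: "1 / real (Suc n0) < \<delta>" using nat_approx_posE[OF \<delta>(1)] by blast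
  have "norm (dquot e w n z - d) < \<epsilon>" if "n0 \<le> n" for n
  proof -
    define t where "t = 1 / real (Suc n)"
    have "t \<le> 1 / real (Suc n0)" unfolding t_def using that by (intro divide_left_mono) auto
    then have t: "0 < t" "t < \<delta>" "real (Suc n) * t = 1" using n0 by (auto simp: t_def)
    have "dquot e w n z - d = real (Suc n) * (w (z + t *\<^sub>R e) - w z) - (real (Suc n) * t) * d"
      using t(3) by (simp add: dquot_def t_def)
    also have "\<dots> = real (Suc n) * (w (z + t *\<^sub>R e) - w z - t * d)" by (simp only: right_diff_distrib mult.assoc)
    finally have "\<bar>dquot e w n z - d\<bar> = real (Suc n) * \<bar>w (z + t *\<^sub>R e) - w z - t * d\<bar>" by (simp add: abs_mult)
    also have "\<dots> \<le> real (Suc n) * (\<epsilon> / 2 * \<bar>t\<bar>)" using \<delta>(2)[of z t] \<delta>(1) t by (intro mult_left_mono) auto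
    also have "\<dots> = (real (Suc n) * t) * (\<epsilon> / 2)" using t by simp
    also have "\<dots> < \<epsilon>" unfolding t(3) using \<epsilon> by simp
    finally show ?thesis by simp
  qed
  then show "\<exists>n0. \<forall>n\<ge>n0. norm (dquot e w n z - d) < \<epsilon>" by blast
qed

lemma regular_on_box_partial:
  assumes "regular_on_box a b w"
  shows "AE z in lborel. \<forall>e\<in>Basis. strict_partial e w z (partial e w z)"
proof -
  have "AE z in lborel. \<forall>e\<in>Basis. \<exists>d. strict_partial e w z d" using assms by (simp add: regular_on_box_def)
  then show ?thesis
  proof eventually_elim
    case (elim z)
    then show ?case unfolding partial_def by (metis limI strict_partial_dquot)
  qed
qed

lemma box_norm_bound: "\<exists>r. \<forall>z\<in>box a (b::'a::euclidean_space). norm z \<le> r"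
  using bounded_box bounded_iff by blast

lemma regular_on_box_ae_partial:
  assumes w: "regular_on_box a b w" and e: "e \<in> Basis"
  shows "ae_partial e w (partial e w)"
  unfolding ae_partial_def
proof (intro conjI)
  show c: "continuous_on UNIV w" using w by (simp add: regular_on_box_def)
  show "\<exists>r. \<forall>z. w z \<noteq> 0 \<longrightarrow> norm z \<le> r" using w box_norm_bound[of a b] unfolding regular_on_box_def by metis
  show "\<exists>L. \<forall>z t. \<bar>w (z + t *\<^sub>R e) - w z\<bar> \<le> L * \<bar>t\<bar>" using w e unfolding regular_on_box_def by metis
  show "partial e w \<in> borel_measurable borel"
    unfolding partial_def using dquot_measurable[OF c] by (intro borel_measurable_lim_metric)
  show "AE z in lborel. (\<lambda>n. dquot e w n z) \<longlonglongrightarrow> partial e w z"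
    using regular_on_box_partial[OF w] by eventually_elim (use e strict_partial_dquot in blast)
qed

lemma set_integrable_powr_bounded:
  fixes f :: "'a::euclidean_space \<Rightarrow> real"
  assumes f: "f \<in> borel_measurable borel" "AE z in lborel. \<bar>f z\<bar> \<le> C" and p: "0 \<le> p"
  shows "set_integrable lborel (box a b) (\<lambda>z. \<bar>f z\<bar> powr p)"
proof -
  obtain r where r: "\<And>z. z \<in> box a b \<Longrightarrow> norm z \<le> r" using box_norm_bound[of a b] by blast
  have m: "(\<lambda>z. indicator (box a b) z *\<^sub>R \<bar>f z\<bar> powr p) \<in> borel_measurable borel" using f(1) by measurable
  show ?thesis unfolding set_integrable_def
  proof (rule integrable_bounded_support[OF m])
    show "AE z in lborel. \<bar>indicator (box a b) z *\<^sub>R \<bar>f z\<bar> powr p\<bar> \<le> \<bar>C\<bar> powr p"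
      using f(2) by eventually_elim (use p in \<open>auto simp: indicator_def intro!: powr_mono2\<close>)
    show "indicator (box a b) z *\<^sub>R \<bar>f z\<bar> powr p \<noteq> 0 \<Longrightarrow> norm z \<le> r" for z
      using r[of z] by (auto simp: indicator_def split: if_splits)
  qed
qed

lemma ae_partial_integrable_powr:
  assumes "ae_partial e w g" "0 \<le> p"
  shows "set_integrable lborel (box a b) (\<lambda>z. \<bar>g z\<bar> powr p)"
  using ae_partialE[OF assms(1)] set_integrable_powr_bounded[OF _ _ assms(2)] ae_partial_bound[OF assms(1)] by metis

lemma W1p_ae_partial:
  fixes w :: "'a::euclidean_space \<Rightarrow> real"
  assumes g: "\<And>e. e \<in> Basis \<Longrightarrow> ae_partial e w (g e)" and p: "0 \<le> p"
  shows "w \<in> W1p (box a b) p"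
proof -
  obtain e0 :: 'a where e0: "e0 \<in> Basis" using nonempty_Basis by blast
  obtain M where w: "continuous_on UNIV w" and M: "\<And>z. \<bar>w z\<bar> \<le> M" using ae_partialE[OF g[OF e0]] by metis
  have wm: "w \<in> borel_measurable borel" using w by (rule borel_measurable_continuous_onI)
  have m: "set_borel_measurable lborel (box a b) f" if "f \<in> borel_measurable borel" for f :: "'a \<Rightarrow> real"
    unfolding set_borel_measurable_def using that by measurable
  have "in_Lp (box a b) p w"
    unfolding in_Lp_def using m[OF wm] set_integrable_powr_bounded[OF wm _ p, of M] M by auto
  moreover have "has_weak_partial (box a b) e w (g e) \<and> in_Lp (box a b) p (g e)" if e: "e \<in> Basis" for e
    unfolding in_Lp_def
    using ae_partial_has_weak_partial[OF g[OF e] e open_box] ae_partial_integrable_powr[OF g[OF e] p] m g[OF e]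
    by (auto simp: ae_partial_def)
  ultimately show ?thesis unfolding W1p_def by blast
qed

lemma seminorm_eq:
  assumes "\<And>e. e \<in> Basis \<Longrightarrow> ae_partial e w (g e)"
  shows "W1p_seminorm (box a b) p w = (\<Sum>e\<in>Basis. LINT z:box a b|lborel. \<bar>g e z\<bar> powr p) powr (1 / p)"
  unfolding W1p_seminorm_def using integral_weak_partial[OF assms _ open_box] by simp

lemma norm_eq:
  assumes "\<And>e. e \<in> Basis \<Longrightarrow> ae_partial e w (g e)"
  shows "W1p_norm (box a b) p w = ((LINT z:box a b|lborel. \<bar>w z\<bar> powr p)
    + (\<Sum>e\<in>Basis. LINT z:box a b|lborel. \<bar>g e z\<bar> powr p)) powr (1 / p)"
  unfolding W1p_norm_def using integral_weak_partial[OF assms _ open_box] by simp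

lemma bounded_convergence_powr:
  fixes f :: "nat \<Rightarrow> 'a::euclidean_space \<Rightarrow> real"
  assumes f: "\<And>n. f n \<in> borel_measurable borel" "\<And>n. AE z in lborel. \<bar>f n z\<bar> \<le> C"
    and lim: "AE z in lborel. (\<lambda>n. f n z) \<longlonglongrightarrow> 0" and p: "0 < p"
  shows "(\<lambda>n. LINT z:box a b|lborel. \<bar>f n z\<bar> powr p) \<longlonglongrightarrow> 0"
proof -
  have "(\<lambda>n. LINT z|lborel. indicator (box a b) z *\<^sub>R \<bar>f n z\<bar> powr p) \<longlonglongrightarrow> (LINT z::'a|lborel. 0)"
  proof (rule integral_dominated_convergence)
    show "integrable lborel (\<lambda>z. indicator (box a b) z *\<^sub>R \<bar>\<bar>C\<bar>\<bar> powr p)"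
      using set_integrable_powr_bounded[of "\<lambda>_. \<bar>C\<bar>" "\<bar>C\<bar>" p a b] p by (simp add: set_integrable_def)
    show "(\<lambda>z. indicator (box a b) z *\<^sub>R \<bar>f n z\<bar> powr p) \<in> borel_measurable lborel" for n
      using f(1)[of n] by measurable
    show "AE z in lborel. (\<lambda>n. indicator (box a b) z *\<^sub>R \<bar>f n z\<bar> powr p) \<longlonglongrightarrow> 0"
      using lim
    proof eventually_elim
      case (elim z)
      then have "(\<lambda>n. \<bar>f n z\<bar>) \<longlonglongrightarrow> 0" by (rule tendsto_rabs_zero)
      then have "(\<lambda>n. \<bar>f n z\<bar> powr p) \<longlonglongrightarrow> 0"
        by (rule tendsto_zero_powrI[OF _ tendsto_const _ p]) simp
      from tendsto_scaleR[OF tendsto_const[of "indicator (box a b) z"] this] show ?case by simp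
    qed
    show "AE z in lborel. norm (indicator (box a b) z *\<^sub>R \<bar>f n z\<bar> powr p) \<le> indicator (box a b) z *\<^sub>R \<bar>\<bar>C\<bar>\<bar> powr p" for n
      using f(2)[of n] by eventually_elim (use p in \<open>auto simp: indicator_def intro!: powr_mono2\<close>)
  qed simp
  then show ?thesis by (simp add: set_lebesgue_integral_def)
qed

lemma derivative_close:
  fixes f :: "real \<Rightarrow> real"
  assumes f: "(f has_real_derivative D) (at 0)" and \<delta>: "0 < \<delta>"
    and near: "\<And>t. \<bar>t\<bar> < \<delta> \<Longrightarrow> \<bar>f t - f 0 - t * k\<bar> \<le> E * \<bar>t\<bar>"
  shows "\<bar>D - k\<bar> \<le> E"
proof -
  have lim: "((\<lambda>h. \<bar>(f h - f 0) / h - k\<bar>) \<longlongrightarrow> \<bar>D - k\<bar>) (at 0)"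
    using f by (intro tendsto_intros) (simp add: DERIV_def)
  have "\<forall>\<^sub>F h in at 0. \<bar>(f h - f 0) / h - k\<bar> \<le> E"
    unfolding eventually_at
  proof (intro exI[of _ \<delta>] conjI \<delta> ballI impI)
    fix h :: real assume h: "h \<noteq> 0 \<and> dist h 0 < \<delta>"
    have "\<bar>(f h - f 0) / h - k\<bar> = \<bar>f h - f 0 - h * k\<bar> / \<bar>h\<bar>"
      using h by (simp add: field_simps flip: abs_divide)
    also have "\<dots> \<le> E" using near[of h] h by (simp add: dist_real_def divide_le_eq)
    finally show "\<bar>(f h - f 0) / h - k\<bar> \<le> E" .
  qed
  with lim show ?thesis by (intro tendsto_upperbound) auto
qed

text \<open>Dilation factors tending to 1 give test functions that converge pointwise, with gradients that converge wherever
strict partial derivatives exist. All bounds are uniform, which is what dominated convergence in the Sobolev norm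
requires.\<close>

lemma regular_on_box_approximation:
  fixes a b :: "'a::euclidean_space"
  assumes ab: "\<And>i. i \<in> Basis \<Longrightarrow> a \<bullet> i < b \<bullet> i" and w: "regular_on_box a b w"
  obtains \<phi> :: "nat \<Rightarrow> 'a \<Rightarrow> real" and C :: real and \<phi>' :: "nat \<Rightarrow> 'a \<Rightarrow> 'a \<Rightarrow> real" where
    "\<And>n. \<phi> n \<in> test_functions (box a b)" "\<And>z. (\<lambda>n. \<phi> n z) \<longlonglongrightarrow> w z" "\<And>n z. \<bar>\<phi> n z - w z\<bar> \<le> C"
    "\<And>n e. e \<in> Basis \<Longrightarrow> ae_partial e (\<phi> n) (\<phi>' n e)"
    "\<And>n e. e \<in> Basis \<Longrightarrow> AE z in lborel. \<bar>\<phi>' n e z - partial e w z\<bar> \<le> C"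
    "\<And>e. e \<in> Basis \<Longrightarrow> AE z in lborel. (\<lambda>n. \<phi>' n e z) \<longlonglongrightarrow> partial e w z"
proof -
  \<comment> \<open>starting at 1/2, so that dividing by \<open>s n\<close> at most doubles the Lipschitz constant\<close>
  define s where "s n = 1 - 1 / real (n + 2)" for n
  have s: "0 < s n" "s n < 1" "1 / 2 \<le> s n" for n by (auto simp: s_def field_simps)
  have slim: "s \<longlonglongrightarrow> 1"
  proof -
    have "(\<lambda>n. 1 / real (n + 2)) \<longlonglongrightarrow> 0" using LIMSEQ_ignore_initial_segment[OF lim_1_over_n, of 2] by simp
    then have "s \<longlonglongrightarrow> 1 - 0" unfolding s_def by (intro tendsto_diff tendsto_const)
    then show ?thesis by simp
  qed
  define c where "c = (1 / 2) *\<^sub>R (a + b)"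
  define H where "H = (\<Sum>i\<in>Basis. ((1 / 2) *\<^sub>R (b - a)) \<bullet> i)"
  define r where "r n z = (1 - s n) * (H + norm (z - c)) / s n" for n z
  have rlim: "(\<lambda>n. r n z) \<longlonglongrightarrow> 0" for z
  proof -
    have "(\<lambda>n. r n z) \<longlonglongrightarrow> (1 - 1) * (H + norm (z - c)) / 1"
      unfolding r_def by (intro tendsto_intros slim) auto
    then show ?thesis by simp
  qed
  have cw: "continuous_on UNIV w" and w0: "\<And>z. z \<notin> box a b \<Longrightarrow> w z = 0" using w by (auto simp: regular_on_box_def)
  obtain L where L: "\<And>e z t. e \<in> Basis \<Longrightarrow> \<bar>w (z + t *\<^sub>R e) - w z\<bar> \<le> L * \<bar>t\<bar>"
    using w unfolding regular_on_box_def by blast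
  obtain e0 :: 'a where e0: "e0 \<in> Basis" using nonempty_Basis by blast
  have L0: "0 \<le> L" using L[OF e0, of 0 1] by simp
  obtain M where M: "0 \<le> M" "\<And>z. \<bar>w z\<bar> \<le> M" using ae_partialE[OF regular_on_box_ae_partial[OF w e0]] by metis
  have "\<exists>\<phi>. \<phi> \<in> test_functions (box a b) \<and>
    (\<forall>z d B. (\<forall>y. norm (y - z) \<le> r n z \<longrightarrow> \<bar>w y - d\<bar> \<le> B) \<longrightarrow> \<bar>\<phi> z - d\<bar> \<le> B) \<and>
    (\<forall>z e \<tau> d B. (\<forall>y. norm (y - z) \<le> r n z \<longrightarrow> \<bar>w (y + (\<tau> / s n) *\<^sub>R e) - w y - d\<bar> \<le> B)
       \<longrightarrow> \<bar>\<phi> (z + \<tau> *\<^sub>R e) - \<phi> z - d\<bar> \<le> B)" for n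
    by (rule mollified_dilation[OF ab cw w0 s(1)[of n] s(2)[of n], folded c_def H_def]) (auto simp: r_def)
  then obtain \<phi> where \<phi>: "\<And>n. \<phi> n \<in> test_functions (box a b)"
    and av: "\<And>n z d B. (\<And>y. norm (y - z) \<le> r n z \<Longrightarrow> \<bar>w y - d\<bar> \<le> B) \<Longrightarrow> \<bar>\<phi> n z - d\<bar> \<le> B"
    and avd: "\<And>n z e \<tau> d B. (\<And>y. norm (y - z) \<le> r n z \<Longrightarrow> \<bar>w (y + (\<tau> / s n) *\<^sub>R e) - w y - d\<bar> \<le> B)
       \<Longrightarrow> \<bar>\<phi> n (z + \<tau> *\<^sub>R e) - \<phi> n z - d\<bar> \<le> B"
    by metis
  define \<phi>' where "\<phi>' n e z = deriv (\<lambda>t. \<phi> n (z + t *\<^sub>R e)) 0" for n e z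
  have \<phi>': "ae_partial e (\<phi> n) (\<phi>' n e)" "((\<lambda>t. \<phi> n (z + t *\<^sub>R e)) has_real_derivative \<phi>' n e z) (at 0)"
    if e: "e \<in> Basis" for e n z
  proof -
    obtain f' where "\<And>z. ((\<lambda>t. \<phi> n (z + t *\<^sub>R e)) has_real_derivative f' z) (at 0)"
      "f' = (\<lambda>z. deriv (\<lambda>t. \<phi> n (z + t *\<^sub>R e)) 0)" "ae_partial e (\<phi> n) f'"
      using test_function_partial[OF \<phi>[of n] e] by metis
    moreover from this have "\<phi>' n e = f'" by (simp add: \<phi>'_def fun_eq_iff)
    ultimately show "ae_partial e (\<phi> n) (\<phi>' n e)" "((\<lambda>t. \<phi> n (z + t *\<^sub>R e)) has_real_derivative \<phi>' n e z) (at 0)"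
      by auto
  qed
  have lim0: "(\<lambda>n. \<phi> n z) \<longlonglongrightarrow> w z" for z
  proof (rule LIMSEQ_I)
    fix \<epsilon> :: real assume \<epsilon>: "0 < \<epsilon>"
    have "isCont w z" using cw by (simp add: continuous_on_eq_continuous_at)
    then obtain \<delta> where \<delta>: "\<delta> > 0" "\<And>y. dist y z < \<delta> \<Longrightarrow> dist (w y) (w z) < \<epsilon> / 2"
      using \<epsilon> unfolding continuous_at_eps_delta by (metis half_gt_zero)
    have "\<forall>\<^sub>F n in sequentially. r n z < \<delta>" using rlim[of z] \<delta>(1) by (rule order_tendstoD)
    then obtain n0 where n0: "\<And>n. n0 \<le> n \<Longrightarrow> r n z < \<delta>" by (auto simp: eventually_sequentially)
    have "norm (\<phi> n z - w z) < \<epsilon>" if "n0 \<le> n" for n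
    proof -
      have "\<bar>\<phi> n z - w z\<bar> \<le> \<epsilon> / 2"
      proof (rule av)
        fix y assume "norm (y - z) \<le> r n z"
        then have "dist y z < \<delta>" using n0[OF that] by (simp add: dist_norm)
        then show "\<bar>w y - w z\<bar> \<le> \<epsilon> / 2" using \<delta>(2)[of y] by (simp add: dist_real_def)
      qed
      then show ?thesis using \<epsilon> by simp
    qed
    then show "\<exists>n0. \<forall>n\<ge>n0. norm (\<phi> n z - w z) < \<epsilon>" by blast
  qed
  have lip: "\<bar>(\<phi> n (z + \<tau> *\<^sub>R e) - w (z + \<tau> *\<^sub>R e)) - (\<phi> n z - w z)\<bar> \<le> (3 * L) * \<bar>\<tau>\<bar>" if e: "e \<in> Basis" for n z \<tau> e
  proof -
    have "\<bar>\<phi> n (z + \<tau> *\<^sub>R e) - \<phi> n z - 0\<bar> \<le> L * \<bar>\<tau> / s n\<bar>" by (rule avd) (use L[OF e, of _ "\<tau> / s n"] in simp)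
    also have "\<dots> \<le> L * (2 * \<bar>\<tau>\<bar>)"
    proof (rule mult_left_mono[OF _ L0])
      have "\<bar>\<tau>\<bar> * 1 \<le> \<bar>\<tau>\<bar> * (2 * s n)" using s(3)[of n] by (intro mult_left_mono) auto
      then show "\<bar>\<tau> / s n\<bar> \<le> 2 * \<bar>\<tau>\<bar>" using s(1)[of n] by (simp add: abs_divide divide_le_eq algebra_simps)
    qed
    finally show ?thesis using L[OF e, of z \<tau>] by (simp add: abs_le_iff)
  qed
  have AEbound: "AE z in lborel. \<bar>\<phi>' n e z - partial e w z\<bar> \<le> 3 * L" if e: "e \<in> Basis" for n e
    by (rule ae_partial_bound[OF ae_partial_diff[OF \<phi>'(1)[OF e] regular_on_box_ae_partial[OF w e]] lip[OF e]])
  have lim1: "AE z in lborel. (\<lambda>n. \<phi>' n e z) \<longlonglongrightarrow> partial e w z" if e: "e \<in> Basis" for e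
    using regular_on_box_partial[OF w]
  proof eventually_elim
    case (elim z)
    define d where "d = partial e w z"
    have strict: "strict_partial e w z d" using elim e by (simp add: d_def)
    have "(\<lambda>n. s n * \<phi>' n e z - d) \<longlonglongrightarrow> 0"
    proof (rule LIMSEQ_I)
      fix \<epsilon> :: real assume \<epsilon>: "0 < \<epsilon>"
      then obtain \<delta> where \<delta>: "\<delta> > 0" "\<And>y t. y \<in> ball z \<delta> \<Longrightarrow> \<bar>t\<bar> < \<delta> \<Longrightarrow> \<bar>w (y + t *\<^sub>R e) - w y - t * d\<bar> \<le> (\<epsilon> / 2) * \<bar>t\<bar>"
        using strict unfolding strict_partial_def by (metis half_gt_zero)
      have "\<forall>\<^sub>F n in sequentially. r n z < \<delta>" using rlim[of z] \<delta>(1) by (rule order_tendstoD)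
      then obtain n0 where n0: "\<And>n. n0 \<le> n \<Longrightarrow> r n z < \<delta>" by (auto simp: eventually_sequentially)
      have "norm (s n * \<phi>' n e z - d - 0) < \<epsilon>" if n: "n0 \<le> n" for n
      proof -
        have sn: "0 < s n" by (rule s)
        have "\<bar>\<phi>' n e z - d / s n\<bar> \<le> (\<epsilon> / 2) / s n"
        proof (rule derivative_close[OF \<phi>'(2)[OF e, of n z], of "\<delta> * s n"])
          show "0 < \<delta> * s n" using \<delta>(1) sn by simp
          fix \<tau> :: real assume \<tau>: "\<bar>\<tau>\<bar> < \<delta> * s n"
          then have ts: "\<bar>\<tau> / s n\<bar> < \<delta>" using sn by (simp add: abs_divide divide_less_eq)
          have "\<bar>\<phi> n (z + \<tau> *\<^sub>R e) - \<phi> n z - (\<tau> / s n) * d\<bar> \<le> (\<epsilon> / 2) * \<bar>\<tau> / s n\<bar>"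
          proof (rule avd)
            fix y assume "norm (y - z) \<le> r n z"
            then have "y \<in> ball z \<delta>" using n0[OF n] by (simp add: dist_norm norm_minus_commute)
            then show "\<bar>w (y + (\<tau> / s n) *\<^sub>R e) - w y - (\<tau> / s n) * d\<bar> \<le> (\<epsilon> / 2) * \<bar>\<tau> / s n\<bar>"
              using \<delta>(2) ts by blast
          qed
          then show "\<bar>\<phi> n (z + \<tau> *\<^sub>R e) - \<phi> n (z + 0 *\<^sub>R e) - \<tau> * (d / s n)\<bar> \<le> (\<epsilon> / 2) / s n * \<bar>\<tau>\<bar>"
            using sn by (simp add: abs_divide)
        qed
        then have "s n * \<bar>\<phi>' n e z - d / s n\<bar> \<le> \<epsilon> / 2" using sn by (simp add: le_divide_eq mult.commute)
        also have "s n * \<bar>\<phi>' n e z - d / s n\<bar> = \<bar>s n * (\<phi>' n e z - d / s n)\<bar>" using sn by (simp add: abs_mult)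
        also have "s n * (\<phi>' n e z - d / s n) = s n * \<phi>' n e z - d" using sn by (simp add: right_diff_distrib)
        finally show ?thesis using \<epsilon> by simp
      qed
      then show "\<exists>n0. \<forall>n\<ge>n0. norm (s n * \<phi>' n e z - d - 0) < \<epsilon>" by blast
    qed
    then have "(\<lambda>n. (s n * \<phi>' n e z - d + d) / s n) \<longlonglongrightarrow> (0 + d) / 1"
      by (intro tendsto_intros slim) auto
    moreover have "(s n * \<phi>' n e z - d + d) / s n = \<phi>' n e z" for n using s(1)[of n] by simp
    ultimately show ?case by (simp add: d_def)
  qed
  have b0: "\<bar>\<phi> n z - w z\<bar> \<le> max (2 * M) (3 * L)" for n z
  proof -
    have "\<bar>\<phi> n z - 0\<bar> \<le> M" by (rule av) (use M in auto)
    then have "\<bar>\<phi> n z - w z\<bar> \<le> 2 * M" using M(2)[of z] by linarith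
    then show ?thesis by simp
  qed
  have b1: "AE z in lborel. \<bar>\<phi>' n e z - partial e w z\<bar> \<le> max (2 * M) (3 * L)" if "e \<in> Basis" for n e
    using AEbound[OF that, of n] by eventually_elim simp
  show thesis by (rule that[OF \<phi> lim0 b0 \<phi>'(1) b1 lim1])
qed

lemma regular_on_box_W1p0:
  fixes a b :: "'a::euclidean_space"
  assumes ab: "\<And>i. i \<in> Basis \<Longrightarrow> a \<bullet> i < b \<bullet> i" and w: "regular_on_box a b w" and p: "0 < p"
  shows "w \<in> W1p0 (box a b) p"
proof (rule regular_on_box_approximation[OF ab w])
  fix \<phi> :: "nat \<Rightarrow> 'a \<Rightarrow> real" and C :: real and \<phi>' :: "nat \<Rightarrow> 'a \<Rightarrow> 'a \<Rightarrow> real"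
  assume \<phi>: "\<And>n. \<phi> n \<in> test_functions (box a b)" and lim: "\<And>z. (\<lambda>n. \<phi> n z) \<longlonglongrightarrow> w z"
    and C: "\<And>n z. \<bar>\<phi> n z - w z\<bar> \<le> C"
    and \<phi>': "\<And>n e. e \<in> Basis \<Longrightarrow> ae_partial e (\<phi> n) (\<phi>' n e)"
    and C': "\<And>n e. e \<in> Basis \<Longrightarrow> AE z in lborel. \<bar>\<phi>' n e z - partial e w z\<bar> \<le> C"
    and lim': "\<And>e. e \<in> Basis \<Longrightarrow> AE z in lborel. (\<lambda>n. \<phi>' n e z) \<longlonglongrightarrow> partial e w z"
  have d: "ae_partial e (\<lambda>z. \<phi> n z - w z) (\<lambda>z. \<phi>' n e z - partial e w z)" if e: "e \<in> Basis" for n e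
    by (rule ae_partial_diff[OF \<phi>'[OF e] regular_on_box_ae_partial[OF w e]])
  obtain e0 :: 'a where e0: "e0 \<in> Basis" using nonempty_Basis by blast
  have "(\<lambda>n. (LINT z:box a b|lborel. \<bar>\<phi> n z - w z\<bar> powr p)) \<longlonglongrightarrow> 0"
  proof (rule bounded_convergence_powr[OF _ _ _ p])
    show "(\<lambda>z. \<phi> n z - w z) \<in> borel_measurable borel" for n
      using d[OF e0, of n] by (auto simp: ae_partial_def intro: borel_measurable_continuous_onI)
    show "AE z in lborel. \<bar>\<phi> n z - w z\<bar> \<le> C" for n using C by simp
    show "AE z in lborel. (\<lambda>n. \<phi> n z - w z) \<longlonglongrightarrow> 0" using lim by (simp add: LIM_zero)
  qed
  moreover have "(\<lambda>n. (LINT z:box a b|lborel. \<bar>\<phi>' n e z - partial e w z\<bar> powr p)) \<longlonglongrightarrow> 0" if e: "e \<in> Basis" for e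
  proof (rule bounded_convergence_powr[OF _ C'[OF e] _ p])
    show "(\<lambda>z. \<phi>' n e z - partial e w z) \<in> borel_measurable borel" for n
      using d[OF e, of n] by (auto simp: ae_partial_def)
    show "AE z in lborel. (\<lambda>n. \<phi>' n e z - partial e w z) \<longlonglongrightarrow> 0"
      using lim'[OF e] by eventually_elim (simp add: LIM_zero)
  qed
  ultimately have "(\<lambda>n. (LINT z:box a b|lborel. \<bar>\<phi> n z - w z\<bar> powr p)
      + (\<Sum>e\<in>Basis. LINT z:box a b|lborel. \<bar>\<phi>' n e z - partial e w z\<bar> powr p)) \<longlonglongrightarrow> 0 + (\<Sum>e\<in>(Basis::'a set). 0)"
    by (intro tendsto_add tendsto_sum)
  then have "(\<lambda>n. ((LINT z:box a b|lborel. \<bar>\<phi> n z - w z\<bar> powr p)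
      + (\<Sum>e\<in>Basis. LINT z:box a b|lborel. \<bar>\<phi>' n e z - partial e w z\<bar> powr p)) powr (1 / p)) \<longlonglongrightarrow> 0"
    using p by (intro tendsto_zero_powrI[OF _ tendsto_const])
      (auto simp: set_lebesgue_integral_def intro!: always_eventually add_nonneg_nonneg sum_nonneg Bochner_Integration.integral_nonneg)
  then have "(\<lambda>n. W1p_norm (box a b) p (\<lambda>z. \<phi> n z - w z)) \<longlonglongrightarrow> 0"
    using norm_eq[of "\<lambda>z. \<phi> n z - w z" "\<lambda>e z. \<phi>' n e z - partial e w z" a b p for n, OF d] by simp
  moreover have "w \<in> W1p (box a b) p"
    by (rule W1p_ae_partial[OF regular_on_box_ae_partial[OF w]]) (use p in simp_all)
  ultimately show ?thesis unfolding W1p0_def using \<phi> by blast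
qed

section \<open>The seminorm on regular functions\<close>

lemma convex_powr_nonneg:
  assumes "0 \<le> x" "0 \<le> y" "0 \<le> t" "t \<le> 1" "1 \<le> (p::real)"
  shows "(t * x + (1 - t) * y) powr p \<le> t * x powr p + (1 - t) * y powr p"
proof -
  have sub: "(s * z) powr p \<le> s * z powr p" if "0 \<le> s" "s \<le> 1" "0 \<le> z" for s z
  proof (cases "s = 0")
    case False
    then have "s powr p \<le> s powr 1" using that assms(5) by (intro powr_mono') auto
    then show ?thesis using that False by (simp add: powr_mult mult_right_mono)
  qed simp
  consider "x = 0" | "y = 0" | "0 < x" "0 < y" using assms by linarith
  then show ?thesis
  proof cases
    case 1
    then show ?thesis using sub[of "1 - t" y] assms by simp
  next
    case 2
    then show ?thesis using sub[of t x] assms by simp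
  next
    case 3
    have "(\<lambda>x. x powr p) ((1 - t) *\<^sub>R y + t *\<^sub>R x) \<le> (1 - t) * (\<lambda>x. x powr p) y + t * (\<lambda>x. x powr p) x"
      by (rule convex_onD[OF powr_convex[OF assms(5)]]) (use 3 assms in auto)
    then show ?thesis by (simp add: add.commute)
  qed
qed

lemma seminorm_nonneg: "0 \<le> W1p_seminorm \<Omega> p w"
  unfolding W1p_seminorm_def by simp

lemma partial_integral_nonneg:
  fixes g :: "'a::euclidean_space \<Rightarrow> real"
  shows "0 \<le> (LINT z:\<Omega>|lborel. \<bar>g z\<bar> powr p)"
  unfolding set_lebesgue_integral_def by (rule integral_nonneg_AE) simp

lemma seminorm_powr:
  assumes "\<And>e. e \<in> Basis \<Longrightarrow> ae_partial e w (g e)" "0 < p"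
  shows "(\<Sum>e\<in>Basis. LINT z:box a b|lborel. \<bar>g e z\<bar> powr p) = W1p_seminorm (box a b) p w powr p"
proof -
  have "W1p_seminorm (box a b) p w = (\<Sum>e\<in>Basis. LINT z:box a b|lborel. \<bar>g e z\<bar> powr p) powr (1 / p)"
    by (rule seminorm_eq) (rule assms(1))
  then show ?thesis using assms(2) by (simp add: powr_powr sum_nonneg partial_integral_nonneg)
qed

text \<open>The integral over the box controls the derivative inside only; outside the closed box the
function vanishes identically, and the boundary is a null set. So the derivative vanishes almost
everywhere on the whole space.\<close>

lemma regular_seminorm_definite:
  fixes a b :: "'a::euclidean_space"
  assumes w: "regular_on_box a b w" and p: "0 < p" and z: "W1p_seminorm (box a b) p w = 0"
  shows "w = (\<lambda>_. 0)"
proof -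
  obtain e :: 'a where e: "e \<in> Basis" using nonempty_Basis by blast
  let ?g = "partial e w"
  have ae: "ae_partial e w ?g" by (rule regular_on_box_ae_partial[OF w e])
  have "(\<Sum>e\<in>Basis. LINT z:box a b|lborel. \<bar>partial e w z\<bar> powr p) = 0"
    using seminorm_powr[OF regular_on_box_ae_partial[OF w] p, of a b] z p by simp
  then have "(LINT z:box a b|lborel. \<bar>?g z\<bar> powr p) = 0"
    using e by (subst (asm) sum_nonneg_eq_0_iff) (auto simp: partial_integral_nonneg)
  then have "AE z in lborel. indicator (box a b) z *\<^sub>R \<bar>?g z\<bar> powr p = 0"
    using ae_partial_integrable_powr[OF ae, of p a b] p
    by (subst (asm) set_lebesgue_integral_def, subst (asm) integral_nonneg_eq_0_iff_AE) (auto simp: set_integrable_def)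
  moreover have "AE z in lborel. (\<lambda>n. dquot e w n z) \<longlonglongrightarrow> ?g z" using ae by (simp add: ae_partial_def)
  moreover have "AE z in lborel. z \<in> cbox a b \<longrightarrow> z \<in> box a b" by (rule AE_boundary_cbox)
  ultimately have "AE z in lborel. ?g z = 0"
  proof eventually_elim
    case (elim z)
    show ?case
    proof (cases "z \<in> box a b")
      case True
      then show ?thesis using elim(1) by (simp add: powr_eq_0_iff)
    next
      case False
      \<comment> \<open>outside the closed box the difference quotients vanish eventually\<close>
      then have "z \<in> - cbox a b" using elim(3) by blast
      moreover have "open (- cbox a b)" by (intro open_Compl closed_cbox)
      ultimately have "\<forall>\<^sub>F n in sequentially. z + (1 / real (Suc n)) *\<^sub>R e \<in> - cbox a b"
      proof -
        assume zo: "z \<in> - cbox a b" "open (- cbox a b)"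
        have "(\<lambda>n. z + (1 / real (Suc n)) *\<^sub>R e) \<longlonglongrightarrow> z + 0 *\<^sub>R e"
          by (intro tendsto_intros LIMSEQ_Suc[OF lim_1_over_n])
        then show ?thesis using topological_tendstoD[OF _ zo(2)] zo(1) by fastforce
      qed
      then have "\<forall>\<^sub>F n in sequentially. dquot e w n z = 0"
      proof eventually_elim
        case (elim n)
        then show ?case using w False box_subset_cbox[of a b] by (auto simp: dquot_def regular_on_box_def)
      qed
      then have "(\<lambda>n. dquot e w n z) \<longlonglongrightarrow> 0" by (simp add: tendsto_eventually)
      then show ?thesis using elim(2) LIMSEQ_unique by blast
    qed
  qed
  then show ?thesis using ae_partial_0_imp_0[OF ae e] by blast
qed

text \<open>Minkowski's inequality, for the sum over all partial derivatives at once, from convexity of the power function at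
the weights \<open>A / (A + B)\<close> and \<open>B / (A + B)\<close>.\<close>

lemma regular_seminorm_triangle:
  assumes u: "regular_on_box a b u" and v: "regular_on_box a b v" and p: "1 \<le> p"
  shows "W1p_seminorm (box a b) p (\<lambda>z. u z + v z) \<le> W1p_seminorm (box a b) p u + W1p_seminorm (box a b) p v"
proof -
  define A where "A = W1p_seminorm (box a b) p u"
  define B where "B = W1p_seminorm (box a b) p v"
  have p0: "0 < p" using p by simp
  consider "A = 0" | "B = 0" | "0 < A" "0 < B" using seminorm_nonneg unfolding A_def B_def by (metis less_eq_real_def)
  then show ?thesis
  proof cases
    case 1
    then have "u = (\<lambda>_. 0)" using regular_seminorm_definite[OF u p0] by (simp add: A_def)
    then show ?thesis using 1 by (simp add: A_def)
  next
    case 2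
    then have "v = (\<lambda>_. 0)" using regular_seminorm_definite[OF v p0] by (simp add: B_def)
    then show ?thesis using 2 by (simp add: B_def)
  next
    case 3
    define t where "t = A / (A + B)"
    have t: "0 \<le> t" "t \<le> 1" "1 - t = B / (A + B)" using 3 by (auto simp: t_def field_simps)
    let ?u = "\<lambda>e. partial e u" and ?v = "\<lambda>e. partial e v"
    have au: "ae_partial e u (?u e)" and av: "ae_partial e v (?v e)" if "e \<in> Basis" for e
      using regular_on_box_ae_partial u v that by blast+
    have auv: "ae_partial e (\<lambda>z. u z + v z) (\<lambda>z. ?u e z + ?v e z)" if "e \<in> Basis" for e
      by (rule ae_partial_add[OF au av]) (use that in auto)
    have pw: "\<bar>x + y\<bar> powr p \<le> (A + B) powr p * (t * (\<bar>x\<bar> powr p / A powr p) + (1 - t) * (\<bar>y\<bar> powr p / B powr p))" for x y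
    proof -
      have "t * (\<bar>x\<bar> / A) + (1 - t) * (\<bar>y\<bar> / B) = (\<bar>x\<bar> + \<bar>y\<bar>) / (A + B)"
        unfolding t(3) using 3 by (simp add: t_def add_divide_distrib)
      then have "\<bar>x + y\<bar> \<le> (A + B) * (t * (\<bar>x\<bar> / A) + (1 - t) * (\<bar>y\<bar> / B))"
        using 3 abs_triangle_ineq[of x y] by simp
      then have "\<bar>x + y\<bar> powr p \<le> ((A + B) * (t * (\<bar>x\<bar> / A) + (1 - t) * (\<bar>y\<bar> / B))) powr p"
        using p by (intro powr_mono2) auto
      also have "\<dots> = (A + B) powr p * (t * (\<bar>x\<bar> / A) + (1 - t) * (\<bar>y\<bar> / B)) powr p"
        using 3 t by (intro powr_mult)
      also have "\<dots> \<le> (A + B) powr p * (t * (\<bar>x\<bar> / A) powr p + (1 - t) * (\<bar>y\<bar> / B) powr p)"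
        using 3 t p by (intro mult_left_mono convex_powr_nonneg) auto
      finally show ?thesis using 3 by (simp add: powr_divide)
    qed
    have iu: "set_integrable lborel (box a b) (\<lambda>z. \<bar>?u e z\<bar> powr p)"
      and iv: "set_integrable lborel (box a b) (\<lambda>z. \<bar>?v e z\<bar> powr p)"
      and iuv: "set_integrable lborel (box a b) (\<lambda>z. \<bar>?u e z + ?v e z\<bar> powr p)" if "e \<in> Basis" for e
      using ae_partial_integrable_powr[OF au[OF that]] ae_partial_integrable_powr[OF av[OF that]]
        ae_partial_integrable_powr[OF auv[OF that]] p by auto
    have each: "(LINT z:box a b|lborel. \<bar>?u e z + ?v e z\<bar> powr p)
        \<le> (A + B) powr p * (t / A powr p * (LINT z:box a b|lborel. \<bar>?u e z\<bar> powr p)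
          + (1 - t) / B powr p * (LINT z:box a b|lborel. \<bar>?v e z\<bar> powr p))" if e: "e \<in> Basis" for e
    proof -
      have int: "set_integrable lborel (box a b) (\<lambda>z. (A + B) powr p * (t / A powr p * \<bar>?u e z\<bar> powr p + (1 - t) / B powr p * \<bar>?v e z\<bar> powr p))"
        using iu[OF e] iv[OF e] by (intro set_integrable_mult_right set_integral_add(1))
      have "(LINT z:box a b|lborel. \<bar>?u e z + ?v e z\<bar> powr p) \<le>
        (LINT z:box a b|lborel. (A + B) powr p * (t / A powr p * \<bar>?u e z\<bar> powr p + (1 - t) / B powr p * \<bar>?v e z\<bar> powr p))"
        by (rule set_integral_mono[OF iuv[OF e] int]) (use pw in \<open>simp add: divide_simps\<close>)
      also have "\<dots> = (A + B) powr p * (t / A powr p * (LINT z:box a b|lborel. \<bar>?u e z\<bar> powr p)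
          + (1 - t) / B powr p * (LINT z:box a b|lborel. \<bar>?v e z\<bar> powr p))"
        using iu[OF e] iv[OF e] by (simp add: set_integral_add(2))
      finally show ?thesis .
    qed
    have "W1p_seminorm (box a b) p (\<lambda>z. u z + v z) powr p = (\<Sum>e\<in>Basis. LINT z:box a b|lborel. \<bar>?u e z + ?v e z\<bar> powr p)"
      by (rule seminorm_powr[OF auv p0, symmetric])
    also have "\<dots> \<le> (\<Sum>e\<in>Basis. (A + B) powr p * (t / A powr p * (LINT z:box a b|lborel. \<bar>?u e z\<bar> powr p)
          + (1 - t) / B powr p * (LINT z:box a b|lborel. \<bar>?v e z\<bar> powr p)))"
      by (intro sum_mono each)
    also have "\<dots> = (A + B) powr p * (t / A powr p * (\<Sum>e\<in>Basis. LINT z:box a b|lborel. \<bar>?u e z\<bar> powr p)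
          + (1 - t) / B powr p * (\<Sum>e\<in>Basis. LINT z:box a b|lborel. \<bar>?v e z\<bar> powr p))"
      by (simp add: sum_distrib_left sum.distrib distrib_left)
    also have "\<dots> = (A + B) powr p"
      using seminorm_powr[OF au p0, of a b] seminorm_powr[OF av p0, of a b] 3 by (simp add: A_def B_def)
    finally have "W1p_seminorm (box a b) p (\<lambda>z. u z + v z) powr p \<le> (A + B) powr p" .
    then show ?thesis
      using seminorm_nonneg[of "box a b" p] 3 p0 powr_less_mono2[of p "A + B"] unfolding A_def B_def
      by (smt (verit))
  qed
qed

lemma regular_seminorm_cmult:
  assumes u: "regular_on_box a b u" and p: "0 < p"
  shows "W1p_seminorm (box a b) p (\<lambda>z. k * u z) = \<bar>k\<bar> * W1p_seminorm (box a b) p u"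
proof -
  have g: "ae_partial e u (partial e u)" "ae_partial e (\<lambda>z. k * u z) (\<lambda>z. k * partial e u z)" if "e \<in> Basis" for e
    using regular_on_box_ae_partial[OF u that] ae_partial_cmult by blast+
  have "(\<Sum>e\<in>Basis. LINT z:box a b|lborel. \<bar>k * partial e u z\<bar> powr p)
      = \<bar>k\<bar> powr p * (\<Sum>e\<in>Basis. LINT z:box a b|lborel. \<bar>partial e u z\<bar> powr p)"
    by (simp add: abs_mult powr_mult sum_distrib_left)
  moreover have "W1p_seminorm (box a b) p (\<lambda>z. k * u z)
      = (\<Sum>e\<in>Basis. LINT z:box a b|lborel. \<bar>k * partial e u z\<bar> powr p) powr (1 / p)"
    by (rule seminorm_eq) (rule g(2))
  moreover have "W1p_seminorm (box a b) p u = (\<Sum>e\<in>Basis. LINT z:box a b|lborel. \<bar>partial e u z\<bar> powr p) powr (1 / p)"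
    by (rule seminorm_eq) (rule g(1))
  ultimately show ?thesis using p
    by (simp add: powr_mult powr_powr sum_nonneg partial_integral_nonneg)
qed

section \<open>Finite element functions\<close>

lemma Ck_inner: "Ck k (\<lambda>z::'a::euclidean_space. z \<bullet> i)"
proof (cases k)
  case 0
  then show ?thesis by (simp, intro continuous_intros)
next
  case (Suc n)
  have "((\<lambda>t. (z + t *\<^sub>R e) \<bullet> i) has_real_derivative e \<bullet> i) (at 0)" for z e :: 'a
    by (auto intro!: derivative_eq_intros simp: inner_add_left)
  then have "\<exists>f'. Ck n f' \<and> (\<forall>z. ((\<lambda>t. (z + t *\<^sub>R e) \<bullet> i) has_real_derivative f' z) (at 0))" for e :: 'a
    by (intro exI[of _ "\<lambda>z. e \<bullet> i"] conjI allI Ck_const)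
  then show ?thesis unfolding Suc Ck.simps by (intro conjI ballI) (auto intro!: continuous_intros)
qed

lemma Ck_power: "Ck k f \<Longrightarrow> Ck k (\<lambda>z. f z ^ n)"
  by (induction n) (auto intro: Ck_const Ck_mult)

lemma Ck_polynomial_2d:
  "Ck k (\<lambda>z::real \<times> real. \<Sum>a\<le>r. \<Sum>b\<le>s. c a b * fst z ^ a * snd z ^ b)"
proof -
  have "Ck k (\<lambda>z::real \<times> real. \<Sum>a\<le>r. \<Sum>b\<le>s. c a b * (z \<bullet> (1, 0)) ^ a * (z \<bullet> (0, 1)) ^ b)"
    by (intro Ck_sum Ck_mult Ck_power Ck_inner Ck_const) auto
  then show ?thesis by (simp add: inner_prod_def)
qed

lemma Ck_1_partial:
  assumes "Ck (Suc 0) f" "e \<in> Basis"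
  shows "\<exists>f'. continuous_on UNIV f' \<and>
    (\<forall>z t. ((\<lambda>t. f (z + t *\<^sub>R e)) has_real_derivative f' (z + t *\<^sub>R e)) (at t))"
proof -
  obtain f' where "Ck 0 f'" "\<And>z. ((\<lambda>t. f (z + t *\<^sub>R e)) has_real_derivative f' z) (at 0)" using assms by auto
  then show ?thesis using line_derivative[of f e f'] by auto
qed

text \<open>The mean value theorem bounds the deviation by the oscillation of the continuous derivative near \<open>z\<close>.\<close>

lemma strict_partial_Ck_1:
  assumes f: "Ck (Suc 0) f" and e: "e \<in> Basis"
  shows "\<exists>d. strict_partial e f z d"
proof -
  obtain f' where f': "continuous_on UNIV f'"
    "\<And>z t. ((\<lambda>t. f (z + t *\<^sub>R e)) has_real_derivative f' (z + t *\<^sub>R e)) (at t)"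
    using Ck_1_partial[OF f e] by blast
  have "strict_partial e f z (f' z)" unfolding strict_partial_def
  proof (intro allI impI)
    fix \<epsilon> :: real assume "0 < \<epsilon>"
    moreover have "isCont f' z" using f'(1) by (simp add: continuous_on_eq_continuous_at)
    ultimately obtain \<delta> where \<delta>: "\<delta> > 0" "\<And>y. dist y z < \<delta> \<Longrightarrow> dist (f' y) (f' z) < \<epsilon>"
      unfolding continuous_at_eps_delta by metis
    have "\<bar>f (y + t *\<^sub>R e) - f y - t * f' z\<bar> \<le> \<epsilon> * \<bar>t\<bar>"
      if y: "y \<in> ball z (\<delta> / 2)" and t: "\<bar>t\<bar> < \<delta> / 2" for y t
    proof -
      let ?g = "\<lambda>s. f (y + s *\<^sub>R e) - s * f' z"
      have "norm (?g t - ?g 0) \<le> \<epsilon> * norm (t - 0)"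
      proof (rule field_differentiable_bound[of "{-(\<delta> / 2)<..<\<delta> / 2}" ?g "\<lambda>s. f' (y + s *\<^sub>R e) - f' z"])
        show "(?g has_field_derivative f' (y + s *\<^sub>R e) - f' z) (at s within {-(\<delta> / 2)<..<\<delta> / 2})" for s
          by (rule has_field_derivative_at_within) (auto intro!: derivative_eq_intros f'(2))
        show "norm (f' (y + s *\<^sub>R e) - f' z) \<le> \<epsilon>" if s: "s \<in> {-(\<delta> / 2)<..<\<delta> / 2}" for s
        proof -
          have "dist (y + s *\<^sub>R e) z \<le> dist y z + \<bar>s\<bar>"
            using norm_triangle_ineq[of "y - z" "s *\<^sub>R e"] e by (simp add: dist_norm algebra_simps)
          then have "dist (y + s *\<^sub>R e) z < \<delta>" using y s by (auto simp: dist_commute abs_if split: if_splits)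
          then show ?thesis using \<delta>(2) by (force simp: dist_real_def)
        qed
      qed (use t \<delta> in auto)
      then show ?thesis by (simp add: algebra_simps)
    qed
    then show "\<exists>\<delta>>0. \<forall>y\<in>ball z \<delta>. \<forall>t. \<bar>t\<bar> < \<delta> \<longrightarrow> \<bar>f (y + t *\<^sub>R e) - f y - t * f' z\<bar> \<le> \<epsilon> * \<bar>t\<bar>"
      using \<delta>(1) by (intro exI[of _ "\<delta> / 2"]) auto
  qed
  then show ?thesis by blast
qed

lemma strict_partial_cong_open:
  assumes f: "strict_partial e f z d" and e: "e \<in> Basis" and U: "open U" "z \<in> U" "\<And>y. y \<in> U \<Longrightarrow> w y = f y"
  shows "strict_partial e w z d"
  unfolding strict_partial_def
proof (intro allI impI)
  fix \<epsilon> :: real assume "0 < \<epsilon>"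
  then obtain \<delta> where \<delta>: "\<delta> > 0" "\<And>y t. y \<in> ball z \<delta> \<Longrightarrow> \<bar>t\<bar> < \<delta> \<Longrightarrow> \<bar>f (y + t *\<^sub>R e) - f y - t * d\<bar> \<le> \<epsilon> * \<bar>t\<bar>"
    using f unfolding strict_partial_def by metis
  obtain \<gamma> where \<gamma>: "\<gamma> > 0" "ball z \<gamma> \<subseteq> U" using U(1,2) open_contains_ball by blast
  have "\<bar>w (y + t *\<^sub>R e) - w y - t * d\<bar> \<le> \<epsilon> * \<bar>t\<bar>"
    if y: "y \<in> ball z (min \<delta> (\<gamma> / 2))" and t: "\<bar>t\<bar> < min \<delta> (\<gamma> / 2)" for y t
  proof -
    have "dist z (y + t *\<^sub>R e) \<le> dist z y + \<bar>t\<bar>"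
      using norm_triangle_ineq4[of "z - y" "t *\<^sub>R e"] e by (simp add: dist_norm algebra_simps)
    then have "y \<in> U" "y + t *\<^sub>R e \<in> U" using y t \<gamma> by (auto intro!: subsetD[OF \<gamma>(2)])
    then show ?thesis using \<delta>(2)[of y t] y t U(3) by simp
  qed
  then show "\<exists>\<delta>>0. \<forall>y\<in>ball z \<delta>. \<forall>t. \<bar>t\<bar> < \<delta> \<longrightarrow> \<bar>w (y + t *\<^sub>R e) - w y - t * d\<bar> \<le> \<epsilon> * \<bar>t\<bar>"
    using \<delta>(1) \<gamma>(1) by (intro exI[of _ "min \<delta> (\<gamma> / 2)"]) auto
qed

lemma meshD:
  assumes "mesh a b ns"
  shows "hd ns = a" "last ns = b" "ns \<noteq> []" "ns ! 0 = a" "ns ! (length ns - 1) = b"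
    "\<And>i j. i < j \<Longrightarrow> j < length ns \<Longrightarrow> ns ! i < ns ! j" "2 \<le> length ns"
proof -
  have "ns \<noteq> []" using assms by (auto simp: mesh_def)
  then show "hd ns = a" "last ns = b" "ns \<noteq> []" "ns ! 0 = a" "ns ! (length ns - 1) = b"
    "\<And>i j. i < j \<Longrightarrow> j < length ns \<Longrightarrow> ns ! i < ns ! j" "2 \<le> length ns"
    using assms unfolding mesh_def by (auto simp: hd_conv_nth last_conv_nth sorted_wrt_iff_nth_less)
qed

lemma mesh_cell:
  assumes ns: "mesh a b ns" and x: "a \<le> x" "x \<le> b"
  obtains i where "Suc i < length ns" "x \<in> {ns ! i..ns ! Suc i}"
proof -
  \<comment> \<open>the cell sought is the last one whose left end point does not exceed \<open>x\<close>\<close>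
  define S where "S = {i. Suc i < length ns \<and> ns ! i \<le> x}"
  have "finite S" by (rule finite_subset[of _ "{..length ns}"]) (auto simp: S_def)
  moreover have "0 \<in> S" using meshD[OF ns] x by (auto simp: S_def)
  ultimately have i: "Max S \<in> S" "\<And>j. j \<in> S \<Longrightarrow> j \<le> Max S" by (auto intro: Max_in)
  have "x \<le> ns ! Suc (Max S)"
  proof (cases "Suc (Suc (Max S)) < length ns")
    case True
    then have "Suc (Max S) \<notin> S" using i(2)[of "Suc (Max S)"] by auto
    then show ?thesis using True by (simp add: S_def)
  next
    case False
    then have "Suc (Max S) = length ns - 1" using i(1) by (auto simp: S_def)
    then show ?thesis using meshD(5)[OF ns] x by simp
  qed
  then show thesis using i(1) that by (auto simp: S_def)
qed

lemma mesh_open_cell: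
  assumes ns: "mesh a b ns" and x: "a < x" "x < b" "x \<notin> set ns"
  obtains i where "Suc i < length ns" "x \<in> {ns ! i<..<ns ! Suc i}"
proof -
  obtain i where i: "Suc i < length ns" "x \<in> {ns ! i..ns ! Suc i}" using mesh_cell[OF ns, of x] x by auto
  then have "ns ! i \<in> set ns" "ns ! Suc i \<in> set ns" by auto
  then have "ns ! i \<noteq> x" "ns ! Suc i \<noteq> x" using x(3) by auto
  then show thesis using that[OF i(1)] i(2) by auto
qed

text \<open>The cells and the two outer rays form a finite closed cover of the line on which the same Lipschitz
constant holds.\<close>

lemma lipschitz_on_mesh:
  fixes f :: "real \<Rightarrow> real"
  assumes ns: "mesh a b ns" and K: "0 \<le> K"
    and cell: "\<And>i. Suc i < length ns \<Longrightarrow> K-lipschitz_on {ns ! i..ns ! Suc i} f"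
    and out: "\<And>x. x \<notin> {a<..<b} \<Longrightarrow> f x = 0"
  shows "\<bar>f (x + t) - f x\<bar> \<le> K * \<bar>t\<bar>"
proof -
  \<comment> \<open>the indices \<open>length ns - 1\<close> and \<open>length ns\<close> stand for the outer rays\<close>
  define U where "U i = (if Suc i < length ns then {ns ! i..ns ! Suc i} else if Suc i = length ns then {..a} else {b..})" for i
  have "K-lipschitz_on {u..v} f" for u v
  proof (rule lipschitz_on_closed_Union[of "{..length ns}" K U])
    fix i
    show "closed (U i)" by (auto simp: U_def)
    have z: "K-lipschitz_on S f" if "\<And>x. x \<in> S \<Longrightarrow> f x = 0" for S
      using that K by (auto simp: lipschitz_on_def)
    show "K-lipschitz_on (U i) f" unfolding U_def using cell out by (auto intro!: z)
  next
    show "{u..v} \<subseteq> (\<Union>i\<in>{..length ns}. U i)"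
    proof
      fix x
      consider "x \<le> a" | "b \<le> x" | "a \<le> x" "x \<le> b" by linarith
      then show "x \<in> (\<Union>i\<in>{..length ns}. U i)"
      proof cases
        case 1
        then show ?thesis using meshD(7)[OF ns] by (intro UN_I[of "length ns - 1"]) (auto simp: U_def)
      next
        case 2
        then show ?thesis by (intro UN_I[of "length ns"]) (auto simp: U_def)
      next
        case 3
        then obtain i where "Suc i < length ns" "x \<in> {ns ! i..ns ! Suc i}" using mesh_cell[OF ns] by metis
        then show ?thesis by (intro UN_I[of i]) (auto simp: U_def)
      qed
    qed
  qed (use K in auto)
  from lipschitz_onD[OF this, of "x + t" "min x (x + t)" "max x (x + t)" x]
  show ?thesis by (auto simp: dist_real_def)
qed

lemma fe_polynomial:
  assumes "w \<in> fe_space_2d xs ys r s" "Suc i < length xs" "Suc j < length ys"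
  shows "\<exists>c. \<forall>z\<in>{xs ! i..xs ! Suc i} \<times> {ys ! j..ys ! Suc j}.
    w z = (\<Sum>a\<le>r. \<Sum>b\<le>s. c a b * fst z ^ a * snd z ^ b)"
proof -
  obtain c where "\<forall>x\<in>{xs ! i..xs ! Suc i}. \<forall>y\<in>{ys ! j..ys ! Suc j}. w (x, y) = (\<Sum>a\<le>r. \<Sum>b\<le>s. c a b * x ^ a * y ^ b)"
    using assms unfolding fe_space_2d_def by blast
  then show ?thesis by (intro exI[of _ c]) auto
qed

lemma fe_zero_outside:
  assumes "mesh x0 x1 xs" "mesh y0 y1 ys" "w \<in> fe_space_2d xs ys r s" "z \<notin> {x0<..<x1} \<times> {y0<..<y1}"
  shows "w z = 0"
  using assms(3,4) meshD(1,2)[OF assms(1)] meshD(1,2)[OF assms(2)] unfolding fe_space_2d_def by blast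

text \<open>On each closed cell the function is a polynomial, whose derivative is bounded by compactness. The other direction
follows by exchanging the coordinates (\<open>fe_space_swap\<close>).\<close>

lemma fe_lipschitz_x:
  assumes xs: "mesh x0 x1 xs" and ys: "mesh y0 y1 ys" and w: "w \<in> fe_space_2d xs ys r s"
  obtains K where "\<And>x y t. \<bar>w (x + t, y) - w (x, y)\<bar> \<le> K * \<bar>t\<bar>"
proof -
  have "\<exists>K. \<forall>y\<in>{ys ! j..ys ! Suc j}. K-lipschitz_on {xs ! i..xs ! Suc i} (\<lambda>x. w (x, y))"
    if ij: "Suc i < length xs" "Suc j < length ys" for i j
  proof -
    obtain c where c: "\<And>z. z \<in> {xs ! i..xs ! Suc i} \<times> {ys ! j..ys ! Suc j} \<Longrightarrow>
      w z = (\<Sum>a\<le>r. \<Sum>b\<le>s. c a b * fst z ^ a * snd z ^ b)"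
      using fe_polynomial[OF w ij] by blast
    let ?P = "\<lambda>z::real \<times> real. \<Sum>a\<le>r. \<Sum>b\<le>s. c a b * fst z ^ a * snd z ^ b"
    have e: "(1, 0) \<in> (Basis :: (real \<times> real) set)" by (auto simp: Basis_prod_def)
    obtain P' where P': "continuous_on UNIV P'"
      "\<And>z t. ((\<lambda>t. ?P (z + t *\<^sub>R (1, 0))) has_real_derivative P' (z + t *\<^sub>R (1, 0))) (at t)"
      using Ck_1_partial[OF Ck_polynomial_2d e] by blast
    have "compact (P' ` ({xs ! i..xs ! Suc i} \<times> {ys ! j..ys ! Suc j}))"
      by (intro compact_continuous_image continuous_on_subset[OF P'(1)] compact_Times) auto
    then obtain K where K: "\<And>z. z \<in> {xs ! i..xs ! Suc i} \<times> {ys ! j..ys ! Suc j} \<Longrightarrow> \<bar>P' z\<bar> \<le> K"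
      by (metis bounded_iff compact_imp_bounded imageI real_norm_def)
    have "(max K 0)-lipschitz_on {xs ! i..xs ! Suc i} (\<lambda>x. w (x, y))" if y: "y \<in> {ys ! j..ys ! Suc j}" for y
    proof (rule lipschitz_onI)
      fix x x' assume x: "x \<in> {xs ! i..xs ! Suc i}" "x' \<in> {xs ! i..xs ! Suc i}"
      have D: "((\<lambda>t. ?P (t, y)) has_field_derivative P' (t, y)) (at t within {xs ! i..xs ! Suc i})" for t
        using has_field_derivative_at_within[OF P'(2)[of "(0, y)" t]] by simp
      have "norm (?P (x, y) - ?P (x', y)) \<le> max K 0 * norm (x - x')"
        by (rule field_differentiable_bound[OF _ D]) (use K x y in \<open>fastforce simp: max_def\<close>)+
      then show "dist (w (x, y)) (w (x', y)) \<le> max K 0 * dist x x'"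
        using c[of "(x, y)"] c[of "(x', y)"] x y by (simp add: dist_real_def)
    qed simp
    then show ?thesis by blast
  qed
  then obtain K :: "nat \<Rightarrow> nat \<Rightarrow> real" where K: "\<And>i j y. Suc i < length xs \<Longrightarrow> Suc j < length ys \<Longrightarrow> y \<in> {ys ! j..ys ! Suc j} \<Longrightarrow>
      (K i j)-lipschitz_on {xs ! i..xs ! Suc i} (\<lambda>x. w (x, y))" by metis
  define Q where "Q = (\<Sum>i<length xs. \<Sum>j<length ys. \<bar>K i j\<bar>)"
  have Q0: "0 \<le> Q" unfolding Q_def by (intro sum_nonneg) auto
  have KQ: "K i j \<le> Q" if "i < length xs" "j < length ys" for i j
  proof -
    have "K i j \<le> \<bar>K i j\<bar>" by simp
    also have "\<dots> \<le> (\<Sum>j<length ys. \<bar>K i j\<bar>)" using that by (intro member_le_sum) auto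
    also have "\<dots> \<le> Q" unfolding Q_def
      using that by (intro member_le_sum[of i _ "\<lambda>i. \<Sum>j<length ys. \<bar>K i j\<bar>"]) (auto intro: sum_nonneg)
    finally show ?thesis .
  qed
  have w0: "w z = 0" if "z \<notin> {x0<..<x1} \<times> {y0<..<y1}" for z
    by (rule fe_zero_outside[OF xs ys w that])
  have "\<bar>w (x + t, y) - w (x, y)\<bar> \<le> Q * \<bar>t\<bar>" for x y t
  proof (cases "y \<in> {y0<..<y1}")
    case True
    then obtain j where j: "Suc j < length ys" "y \<in> {ys ! j..ys ! Suc j}"
      using mesh_cell[OF ys, of y] by auto
    show ?thesis
    proof (rule lipschitz_on_mesh[OF xs Q0, of "\<lambda>x. w (x, y)"])
      show "Q-lipschitz_on {xs ! i..xs ! Suc i} (\<lambda>x. w (x, y))" if "Suc i < length xs" for i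
        using lipschitz_on_mono[OF K[OF that j] order_refl KQ] that j(1) by simp
    qed (use w0 in auto)
  next
    case False
    then show ?thesis using w0[of "(x + t, y)"] w0[of "(x, y)"] Q0 by simp
  qed
  then show thesis using that by blast
qed

lemma fe_space_swap:
  assumes "w \<in> fe_space_2d xs ys r s"
  shows "(\<lambda>z. w (prod.swap z)) \<in> fe_space_2d ys xs s r"
  unfolding fe_space_2d_def
proof (intro CollectI conjI allI impI)
  show "continuous_on UNIV (\<lambda>z. w (prod.swap z))"
    using assms unfolding fe_space_2d_def
    by (auto intro!: continuous_on_compose2[of UNIV w] continuous_on_swap)
  show "w (prod.swap z) = 0" if "z \<notin> {hd ys<..<last ys} \<times> {hd xs<..<last xs}" for z
    using assms that unfolding fe_space_2d_def by (cases z) auto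
  fix j i assume ij: "Suc j < length ys \<and> Suc i < length xs"
  then obtain c where c: "\<And>x y. x\<in>{xs ! i..xs ! Suc i} \<Longrightarrow> y\<in>{ys ! j..ys ! Suc j} \<Longrightarrow>
      w (x, y) = (\<Sum>a\<le>r. \<Sum>b\<le>s. c a b * x ^ a * y ^ b)"
    using assms unfolding fe_space_2d_def by blast
  have "w (prod.swap (y, x)) = (\<Sum>b\<le>s. \<Sum>a\<le>r. c a b * y ^ b * x ^ a)"
    if "y\<in>{ys ! j..ys ! Suc j}" "x\<in>{xs ! i..xs ! Suc i}" for x y
    unfolding prod.swap_def fst_conv snd_conv c[OF that(2,1)] by (subst sum.swap) (simp add: mult.assoc mult.commute[of "y ^ _"])
  then show "\<exists>c. \<forall>y\<in>{ys ! j..ys ! Suc j}. \<forall>x\<in>{xs ! i..xs ! Suc i}.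
      w (prod.swap (y, x)) = (\<Sum>b\<le>s. \<Sum>a\<le>r. c b a * y ^ b * x ^ a)"
    by (intro exI[of _ "\<lambda>b a. c a b"]) auto
qed

lemma AE_off_mesh_lines:
  fixes A B :: "real set"
  assumes "finite A" "finite B"
  shows "AE z in lborel. fst z \<notin> A \<and> snd z \<notin> B"
proof -
  have line: "AE z in lborel. z \<bullet> i \<noteq> c" if "i \<in> Basis" for i :: "real \<times> real" and c
  proof -
    have "negligible {z. i \<bullet> z = c}" using that by (intro negligible_hyperplane) auto
    moreover have "closed {z. i \<bullet> z = c}" by (rule closed_hyperplane)
    ultimately have "{z. i \<bullet> z = c} \<in> null_sets lborel"
      using null_sets_completion_iff[of "{z. i \<bullet> z = c}" lborel] by (simp add: negligible_iff_null_sets)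
    then show ?thesis by (rule AE_I') (auto simp: inner_commute)
  qed
  have "AE z in lborel. \<forall>c\<in>A. z \<bullet> (1 :: real, 0 :: real) \<noteq> c"
    by (intro AE_finite_allI assms(1) line) (simp add: Basis_prod_def)
  moreover have "AE z in lborel. \<forall>c\<in>B. z \<bullet> (0 :: real, 1 :: real) \<noteq> c"
    by (intro AE_finite_allI assms(2) line) (simp add: Basis_prod_def)
  ultimately show ?thesis by eventually_elim (auto simp: inner_prod_def)
qed

text \<open>Off the mesh lines, a null set, the function agrees near each point with a polynomial or with zero.\<close>

lemma fe_regular:
  assumes xs: "mesh x0 x1 xs" and ys: "mesh y0 y1 ys" and w: "w \<in> fe_space_2d xs ys r s"
  shows "regular_on_box (x0, y0) (x1, y1) w"
proof -
  have box: "box (x0, y0) (x1, y1) = {x0<..<x1} \<times> {y0<..<y1}" by (auto simp: mem_box Basis_prod_def)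
  have w0: "w z = 0" if "z \<notin> {x0<..<x1} \<times> {y0<..<y1}" for z
    by (rule fe_zero_outside[OF xs ys w that])
  have B: "e = (1, 0) \<or> e = (0, 1)" if "e \<in> Basis" for e :: "real \<times> real" using that by (auto simp: Basis_prod_def)
  obtain K1 where K1: "\<And>x y t. \<bar>w (x + t, y) - w (x, y)\<bar> \<le> K1 * \<bar>t\<bar>" using fe_lipschitz_x[OF xs ys w] by blast
  obtain K2 where K2: "\<And>x y t. \<bar>w (prod.swap (x + t, y)) - w (prod.swap (x, y))\<bar> \<le> K2 * \<bar>t\<bar>"
    using fe_lipschitz_x[OF ys xs fe_space_swap[OF w]] by blast
  have lip: "\<bar>w (z + t *\<^sub>R e) - w z\<bar> \<le> max K1 K2 * \<bar>t\<bar>" if "e \<in> Basis" for e z t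
  proof -
    have m: "K1 * \<bar>t\<bar> \<le> max K1 K2 * \<bar>t\<bar>" "K2 * \<bar>t\<bar> \<le> max K1 K2 * \<bar>t\<bar>" by (auto intro: mult_right_mono)
    obtain x y where z: "z = (x, y)" by (cases z)
    show ?thesis using B[OF that] K1[of x t y] K2[of y t x] m unfolding z by auto
  qed
  have "AE z in lborel. \<forall>e\<in>Basis. \<exists>d. strict_partial e w z d"
    using AE_off_mesh_lines[OF finite_set[of xs] finite_set[of ys]]
  proof eventually_elim
    case (elim z)
    obtain x y where z: "z = (x, y)" by (cases z)
    have n: "x \<notin> set xs" "y \<notin> set ys" using elim z by auto
    show ?case
    proof (cases "z \<in> {x0<..<x1} \<times> {y0<..<y1}")
      case True
      obtain i where i: "Suc i < length xs" "x \<in> {xs ! i<..<xs ! Suc i}"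
        using mesh_open_cell[OF xs, of x] n True z by auto
      obtain j where j: "Suc j < length ys" "y \<in> {ys ! j<..<ys ! Suc j}"
        using mesh_open_cell[OF ys, of y] n True z by auto
      obtain c where c: "\<And>z. z \<in> {xs ! i..xs ! Suc i} \<times> {ys ! j..ys ! Suc j} \<Longrightarrow>
          w z = (\<Sum>a\<le>r. \<Sum>b\<le>s. c a b * fst z ^ a * snd z ^ b)"
        using fe_polynomial[OF w i(1) j(1)] by blast
      let ?U = "{xs ! i<..<xs ! Suc i} \<times> {ys ! j<..<ys ! Suc j}"
      have U: "open ?U" "z \<in> ?U" using i j z by (auto intro: open_Times)
      show ?thesis
      proof
        fix e :: "real \<times> real" assume e: "e \<in> Basis"
        obtain d where "strict_partial e (\<lambda>z. \<Sum>a\<le>r. \<Sum>b\<le>s. c a b * fst z ^ a * snd z ^ b) z d"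
          using strict_partial_Ck_1[OF Ck_polynomial_2d e] by blast
        then have "strict_partial e w z d" by (rule strict_partial_cong_open[OF _ e U]) (use c in auto)
        then show "\<exists>d. strict_partial e w z d" by blast
      qed
    next
      case False
      have ends: "x0 \<in> set xs" "x1 \<in> set xs" "y0 \<in> set ys" "y1 \<in> set ys"
        using meshD[OF xs] meshD[OF ys] by auto
      then have "z \<notin> {x0..x1} \<times> {y0..y1}" using False n z by (auto simp: less_le)
      then have U: "open (- ({x0..x1} \<times> {y0..y1}))" "z \<in> - ({x0..x1} \<times> {y0..y1})"
        by (auto intro!: open_Compl closed_Times)
      show ?thesis
      proof
        fix e :: "real \<times> real" assume e: "e \<in> Basis"
        have "strict_partial e (\<lambda>z. 0) z 0" by (auto simp: strict_partial_def intro!: exI[of _ 1])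
        then have "strict_partial e w z 0" by (rule strict_partial_cong_open[OF _ e U]) (rule w0, auto)
        then show "\<exists>d. strict_partial e w z d" by blast
      qed
    qed
  qed
  moreover have "continuous_on UNIV w" using w by (simp add: fe_space_2d_def)
  ultimately show ?thesis
    unfolding regular_on_box_def box using w0 lip by blast
qed

lemma fe_space_add:
  assumes u: "u \<in> fe_space_2d xs ys r s" and v: "v \<in> fe_space_2d xs ys r s"
  shows "(\<lambda>z. u z + v z) \<in> fe_space_2d xs ys r s"
  unfolding fe_space_2d_def
proof (intro CollectI conjI allI impI)
  show "continuous_on UNIV (\<lambda>z. u z + v z)" using u v by (auto simp: fe_space_2d_def intro: continuous_on_add)
  show "u z + v z = 0" if "z \<notin> {hd xs<..<last xs} \<times> {hd ys<..<last ys}" for z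
  proof -
    have "u z = 0" "v z = 0" using u v that unfolding fe_space_2d_def by blast+
    then show ?thesis by simp
  qed
  fix i j assume ij: "Suc i < length xs \<and> Suc j < length ys"
  obtain c where c: "\<And>x y. x\<in>{xs ! i..xs ! Suc i} \<Longrightarrow> y\<in>{ys ! j..ys ! Suc j} \<Longrightarrow>
      u (x, y) = (\<Sum>a\<le>r. \<Sum>b\<le>s. c a b * x ^ a * y ^ b)" using u ij unfolding fe_space_2d_def by blast
  obtain d where d: "\<And>x y. x\<in>{xs ! i..xs ! Suc i} \<Longrightarrow> y\<in>{ys ! j..ys ! Suc j} \<Longrightarrow>
      v (x, y) = (\<Sum>a\<le>r. \<Sum>b\<le>s. d a b * x ^ a * y ^ b)" using v ij unfolding fe_space_2d_def by blast
  show "\<exists>c. \<forall>x\<in>{xs ! i..xs ! Suc i}. \<forall>y\<in>{ys ! j..ys ! Suc j}.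
      u (x, y) + v (x, y) = (\<Sum>a\<le>r. \<Sum>b\<le>s. c a b * x ^ a * y ^ b)"
    using c d by (intro exI[of _ "\<lambda>a b. c a b + d a b"]) (simp add: distrib_right sum.distrib)
qed

lemma fe_space_cmult:
  assumes u: "u \<in> fe_space_2d xs ys r s"
  shows "(\<lambda>z. k * u z) \<in> fe_space_2d xs ys r s"
  unfolding fe_space_2d_def
proof (intro CollectI conjI allI impI)
  show "continuous_on UNIV (\<lambda>z. k * u z)" using u by (auto simp: fe_space_2d_def intro: continuous_on_mult_left)
  show "k * u z = 0" if "z \<notin> {hd xs<..<last xs} \<times> {hd ys<..<last ys}" for z
  proof -
    have "u z = 0" using u that unfolding fe_space_2d_def by blast
    then show ?thesis by simp
  qed
  fix i j assume ij: "Suc i < length xs \<and> Suc j < length ys"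
  obtain c where c: "\<And>x y. x\<in>{xs ! i..xs ! Suc i} \<Longrightarrow> y\<in>{ys ! j..ys ! Suc j} \<Longrightarrow>
      u (x, y) = (\<Sum>a\<le>r. \<Sum>b\<le>s. c a b * x ^ a * y ^ b)" using u ij unfolding fe_space_2d_def by blast
  show "\<exists>c. \<forall>x\<in>{xs ! i..xs ! Suc i}. \<forall>y\<in>{ys ! j..ys ! Suc j}.
      k * u (x, y) = (\<Sum>a\<le>r. \<Sum>b\<le>s. c a b * x ^ a * y ^ b)"
    using c by (intro exI[of _ "\<lambda>a b. k * c a b"]) (simp add: sum_distrib_left mult.assoc)
qed

lemma fe_space_0: "(\<lambda>z. 0) \<in> fe_space_2d xs ys r s"
  unfolding fe_space_2d_def by (auto intro!: exI[of _ "\<lambda>a b. 0"])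

lemma reduced_space_subset:
  assumes X: "X = fe_space_1d xs r" and \<phi>: "\<forall>j\<in>{1..m}. \<phi> j \<in> fe_space_1d ys s"
  shows "reduced_space X m \<phi> \<subseteq> fe_space_2d xs ys r s"
proof
  fix w assume "w \<in> reduced_space X m \<phi>"
  then obtain v where v: "\<forall>j\<in>{1..m}. v j \<in> X" and w: "w = (\<lambda>(x, y). \<Sum>j=1..m. v j x * \<phi> j y)"
    unfolding reduced_space_def by blast
  have tensor: "(\<lambda>(x, y). g x * h y) \<in> fe_space_2d xs ys r s"
    if g: "g \<in> fe_space_1d xs r" and h: "h \<in> fe_space_1d ys s" for g h
    unfolding fe_space_2d_def
  proof (intro CollectI conjI allI impI)
    show "continuous_on UNIV (\<lambda>(x, y). g x * h y)"
      using g h unfolding fe_space_1d_def split_def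
      by (auto intro!: continuous_on_mult continuous_on_compose2[of UNIV g] continuous_on_compose2[of UNIV h]
          continuous_on_fst continuous_on_snd continuous_on_id)
    show "(case z of (x, y) \<Rightarrow> g x * h y) = 0" if "z \<notin> {hd xs<..<last xs} \<times> {hd ys<..<last ys}" for z
      using g h that unfolding fe_space_1d_def by (cases z) auto
    fix i j assume ij: "Suc i < length xs \<and> Suc j < length ys"
    obtain c where c: "\<And>x. x\<in>{xs ! i..xs ! Suc i} \<Longrightarrow> g x = (\<Sum>a\<le>r. c a * x ^ a)"
      using g ij unfolding fe_space_1d_def by blast
    obtain d where d: "\<And>y. y\<in>{ys ! j..ys ! Suc j} \<Longrightarrow> h y = (\<Sum>b\<le>s. d b * y ^ b)"
      using h ij unfolding fe_space_1d_def by blast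
    show "\<exists>c. \<forall>x\<in>{xs ! i..xs ! Suc i}. \<forall>y\<in>{ys ! j..ys ! Suc j}.
      (case (x, y) of (x, y) \<Rightarrow> g x * h y) = (\<Sum>a\<le>r. \<Sum>b\<le>s. c a b * x ^ a * y ^ b)"
      using c d by (intro exI[of _ "\<lambda>a b. c a * d b"]) (simp add: sum_product mult_ac)
  qed
  have "(\<lambda>z. \<Sum>j\<in>A. (\<lambda>(x, y). v j x * \<phi> j y) z) \<in> fe_space_2d xs ys r s" if "finite A" "A \<subseteq> {1..m}" for A
    using that
  proof (induction A rule: finite_induct)
    case empty
    then show ?case using fe_space_0 by simp
  next
    case (insert j A)
    then show ?case using fe_space_add[OF tensor[of "v j" "\<phi> j"]] v \<phi> X by simp
  qed
  from this[of "{1..m}"] show "w \<in> fe_space_2d xs ys r s" by (simp add: w split_def)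
qed

definition nodes :: "nat \<Rightarrow> real \<Rightarrow> real \<Rightarrow> real set" where
  "nodes n u v = (\<lambda>k. u + (v - u) * (real k / real (Suc n))) ` {..n}"

lemma nodes_properties:
  assumes "u < v" shows "finite (nodes n u v)" "card (nodes n u v) = Suc n" "nodes n u v \<subseteq> {u..v}"
proof -
  have "inj_on (\<lambda>k. u + (v - u) * (real k / real (Suc n))) {..n}"
    using assms by (auto simp: inj_on_def)
  then show "card (nodes n u v) = Suc n" by (simp add: nodes_def card_image)
  show "finite (nodes n u v)" by (simp add: nodes_def)
  show "nodes n u v \<subseteq> {u..v}"
  proof
    fix x assume "x \<in> nodes n u v"
    then obtain k where k: "k \<le> n" "x = u + (v - u) * (real k / real (Suc n))" by (auto simp: nodes_def)
    have "real k / real (Suc n) \<le> 1" "0 \<le> real k / real (Suc n)" using k by auto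
    then have "(v - u) * (real k / real (Suc n)) \<le> (v - u) * 1" "0 \<le> (v - u) * (real k / real (Suc n))"
      using assms by (auto intro: mult_left_mono simp del: times_divide_eq_right)
    then show "x \<in> {u..v}" using k by simp
  qed
qed

lemma polynomial_zero_on_nodes:
  fixes c :: "nat \<Rightarrow> real"
  assumes "u < v" and z: "\<And>x. x \<in> nodes n u v \<Longrightarrow> (\<Sum>a\<le>n. c a * x ^ a) = 0"
  shows "(\<Sum>a\<le>n. c a * x ^ a) = 0"
proof -
  have "c k = 0" if "k \<le> n" for k
  proof (rule ccontr)
    assume "c k \<noteq> 0"
    then have ex: "\<exists>k\<le>n. c k \<noteq> 0" using that by blast
    have "finite {z. (\<Sum>i\<le>n. c i * z ^ i) = 0}" "card {z. (\<Sum>i\<le>n. c i * z ^ i) = 0} \<le> n"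
      using polyfun_rootbound[OF ex] by auto
    moreover have "nodes n u v \<subseteq> {z. (\<Sum>i\<le>n. c i * z ^ i) = 0}" using z by auto
    ultimately have "card (nodes n u v) \<le> n" by (meson card_mono le_trans)
    then show False using nodes_properties(2)[OF assms(1), of n] by simp
  qed
  then show ?thesis by simp
qed

text \<open>On each cell, a polynomial of bidegree \<open>(r, s)\<close> that vanishes on a tensor grid of \<open>r + 1\<close> times \<open>s + 1\<close> points is zero, as one
sees by applying the one-dimensional fact in each variable. This is what makes the space finite-dimensional.\<close>

lemma fe_space_determined_by_nodes:
  assumes xs: "mesh x0 x1 xs" and ys: "mesh y0 y1 ys"
  obtains Z where "finite Z" "\<And>w. w \<in> fe_space_2d xs ys r s \<Longrightarrow> (\<And>z. z \<in> Z \<Longrightarrow> w z = 0) \<Longrightarrow> w = (\<lambda>z. 0)"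
proof -
  define Nx where "Nx i = nodes r (xs ! i) (xs ! Suc i)" for i
  define Ny where "Ny j = nodes s (ys ! j) (ys ! Suc j)" for j
  define Z where "Z = (\<Union>i\<in>{i. Suc i < length xs}. \<Union>j\<in>{j. Suc j < length ys}. Nx i \<times> Ny j)"
  have lx: "xs ! i < xs ! Suc i" if "Suc i < length xs" for i using meshD(6)[OF xs] that by auto
  have ly: "ys ! j < ys ! Suc j" if "Suc j < length ys" for j using meshD(6)[OF ys] that by auto
  have fin: "finite {i. Suc i < length ns}" for ns :: "real list"
    by (rule finite_subset[of _ "{..length ns}"]) auto
  have "finite Z" unfolding Z_def Nx_def Ny_def
    by (intro finite_UN_I fin finite_cartesian_product nodes_properties(1)) (auto intro: lx ly)
  moreover have "w z = 0" if w: "w \<in> fe_space_2d xs ys r s" and Z: "\<And>z. z \<in> Z \<Longrightarrow> w z = 0" for w z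
  proof (cases "z \<in> {x0<..<x1} \<times> {y0<..<y1}")
    case False
    then show ?thesis by (rule fe_zero_outside[OF xs ys w])
  next
    case True
    obtain x y where z: "z = (x, y)" by (cases z)
    obtain i where i: "Suc i < length xs" "x \<in> {xs ! i..xs ! Suc i}" using mesh_cell[OF xs, of x] True z by auto
    obtain j where j: "Suc j < length ys" "y \<in> {ys ! j..ys ! Suc j}" using mesh_cell[OF ys, of y] True z by auto
    obtain c where c: "\<And>x y. x\<in>{xs ! i..xs ! Suc i} \<Longrightarrow> y\<in>{ys ! j..ys ! Suc j} \<Longrightarrow>
      w (x, y) = (\<Sum>a\<le>r. \<Sum>b\<le>s. c a b * x ^ a * y ^ b)" using w i j unfolding fe_space_2d_def by blast
    have cx: "w (x, y) = (\<Sum>a\<le>r. (\<Sum>b\<le>s. c a b * y ^ b) * x ^ a)"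
      if "x\<in>{xs ! i..xs ! Suc i}" "y\<in>{ys ! j..ys ! Suc j}" for x y
      unfolding c[OF that] by (simp add: sum_distrib_left mult_ac)
    have cy: "w (x, y) = (\<Sum>b\<le>s. (\<Sum>a\<le>r. c a b * x ^ a) * y ^ b)"
      if "x\<in>{xs ! i..xs ! Suc i}" "y\<in>{ys ! j..ys ! Suc j}" for x y
      unfolding c[OF that] by (subst sum.swap) (simp add: sum_distrib_right)
    have Nx: "Nx i \<subseteq> {xs ! i..xs ! Suc i}" and Ny: "Ny j \<subseteq> {ys ! j..ys ! Suc j}"
      using nodes_properties(3) lx ly i j by (auto simp: Nx_def Ny_def)
    have "w (x, y') = 0" if y': "y' \<in> Ny j" for y'
    proof -
      have "(\<Sum>a\<le>r. (\<Sum>b\<le>s. c a b * y' ^ b) * x ^ a) = 0"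
      proof (rule polynomial_zero_on_nodes[OF lx[OF i(1)]])
        fix x' assume "x' \<in> nodes r (xs ! i) (xs ! Suc i)"
        then have x': "x' \<in> Nx i" by (simp add: Nx_def)
        then have "(x', y') \<in> Z" using y' i j by (auto simp: Z_def)
        then show "(\<Sum>a\<le>r. (\<Sum>b\<le>s. c a b * y' ^ b) * x' ^ a) = 0"
          using Z cx[OF subsetD[OF Nx x'] subsetD[OF Ny y']] by simp
      qed
      then show ?thesis using cx[of x y'] i y' Ny by auto
    qed
    then have z0: "(\<Sum>b\<le>s. (\<Sum>a\<le>r. c a b * x ^ a) * y' ^ b) = 0" if "y' \<in> nodes s (ys ! j) (ys ! Suc j)" for y'
      using cy[OF i(2), of y'] Ny that unfolding Ny_def by auto
    have "(\<Sum>b\<le>s. (\<Sum>a\<le>r. c a b * x ^ a) * y ^ b) = 0"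
      by (rule polynomial_zero_on_nodes[OF ly[OF j(1)] z0])
    then show ?thesis using cy[OF i(2) j(2)] z by simp
  qed
  ultimately show thesis using that[of Z] by blast
qed

section \<open>Bounds from dual norms, operator norms and the inf-sup constant\<close>

text \<open>Finite element functions are compared as functions on the whole plane; the pointwise vector space structure lets
the abstract results apply to them literally.\<close>

instantiation "fun" :: (type, real_vector) real_vector
begin

definition scaleR_fun_def: "c *\<^sub>R f = (\<lambda>x. c *\<^sub>R f x)"

instance
  by standard (simp_all add: scaleR_fun_def fun_eq_iff scaleR_add_right scaleR_add_left)

end

lemma fun_vector_eqs:
  fixes u v :: "'a \<Rightarrow> real"
  shows "u + v = (\<lambda>z. u z + v z)" "u - v = (\<lambda>z. u z - v z)" "c *\<^sub>R u = (\<lambda>z. c * u z)" "0 = (\<lambda>z. 0::real)"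
  by (simp_all add: fun_eq_iff scaleR_fun_def)

text \<open>For test functions of seminorm zero, which the supremum leaves out, the boundedness of the functional itself is
used.\<close>

lemma abs_le_dual_norm:
  assumes \<Phi>: "\<Phi> \<in> W_dual \<Omega> q" and v: "v \<in> W1p0 \<Omega> q"
  shows "\<bar>\<Phi> v\<bar> \<le> dual_norm \<Omega> q \<Phi> * W1p_seminorm \<Omega> q v"
proof -
  obtain C where C: "\<And>v. v \<in> W1p0 \<Omega> q \<Longrightarrow> \<bar>\<Phi> v\<bar> \<le> C * W1p_seminorm \<Omega> q v" using \<Phi> unfolding W_dual_def by blast
  show ?thesis
  proof (cases "W1p_seminorm \<Omega> q v = 0")
    case True
    then show ?thesis using C[OF v] by simp
  next
    case False
    then have pos: "0 < W1p_seminorm \<Omega> q v" using seminorm_nonneg[of \<Omega> q v] by simp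
    have bdd: "bdd_above ((\<lambda>v. \<bar>\<Phi> v\<bar> / W1p_seminorm \<Omega> q v) ` {v \<in> W1p0 \<Omega> q. W1p_seminorm \<Omega> q v \<noteq> 0})"
    proof (rule bdd_aboveI2)
      fix v assume "v \<in> {v \<in> W1p0 \<Omega> q. W1p_seminorm \<Omega> q v \<noteq> 0}"
      then have "v \<in> W1p0 \<Omega> q" "0 < W1p_seminorm \<Omega> q v" using seminorm_nonneg[of \<Omega> q v] by auto
      then show "\<bar>\<Phi> v\<bar> / W1p_seminorm \<Omega> q v \<le> C" using C by (simp add: divide_le_eq)
    qed
    have "\<bar>\<Phi> v\<bar> / W1p_seminorm \<Omega> q v \<le> dual_norm \<Omega> q \<Phi>"
      unfolding dual_norm_def by (rule cSUP_upper[OF _ bdd]) (use v False in simp)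
    then show ?thesis using pos by (simp add: divide_le_eq)
  qed
qed

text \<open>A test function of nonzero seminorm has to exist, because the supremum over the empty set of reals has no useful value.\<close>

lemma dual_norm_least:
  assumes ne: "\<exists>v\<in>W1p0 \<Omega> q. W1p_seminorm \<Omega> q v \<noteq> 0"
    and C: "\<And>v. v \<in> W1p0 \<Omega> q \<Longrightarrow> \<bar>\<Phi> v\<bar> \<le> C * W1p_seminorm \<Omega> q v"
  shows "dual_norm \<Omega> q \<Phi> \<le> C"
  unfolding dual_norm_def
proof (rule cSUP_least)
  show "{v \<in> W1p0 \<Omega> q. W1p_seminorm \<Omega> q v \<noteq> 0} \<noteq> {}" using ne by auto
  fix v assume "v \<in> {v \<in> W1p0 \<Omega> q. W1p_seminorm \<Omega> q v \<noteq> 0}"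
  then have "v \<in> W1p0 \<Omega> q" "0 < W1p_seminorm \<Omega> q v" using seminorm_nonneg[of \<Omega> q v] by auto
  then show "\<bar>\<Phi> v\<bar> / W1p_seminorm \<Omega> q v \<le> C" using C by (simp add: divide_le_eq)
qed

lemma dual_norm_nonneg:
  assumes ne: "\<exists>v\<in>W1p0 \<Omega> q. W1p_seminorm \<Omega> q v \<noteq> 0" and \<Phi>: "\<Phi> \<in> W_dual \<Omega> q"
  shows "0 \<le> dual_norm \<Omega> q \<Phi>"
proof -
  obtain v where v: "v \<in> W1p0 \<Omega> q" "0 < W1p_seminorm \<Omega> q v" using ne seminorm_nonneg by (metis less_eq_real_def)
  have "0 \<le> dual_norm \<Omega> q \<Phi> * W1p_seminorm \<Omega> q v"
    using abs_le_dual_norm[OF \<Phi> v(1)] by (smt (verit) abs_ge_zero)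
  then show ?thesis using v(2) by (simp add: zero_le_mult_iff)
qed

lemma W_dual_diff:
  assumes "\<Phi> \<in> W_dual \<Omega> q" "\<Psi> \<in> W_dual \<Omega> q"
  shows "(\<lambda>v. \<Phi> v - \<Psi> v) \<in> W_dual \<Omega> q"
proof -
  obtain C where C: "\<And>v. v \<in> W1p0 \<Omega> q \<Longrightarrow> \<bar>\<Phi> v\<bar> \<le> C * W1p_seminorm \<Omega> q v" using assms unfolding W_dual_def by blast
  obtain D where D: "\<And>v. v \<in> W1p0 \<Omega> q \<Longrightarrow> \<bar>\<Psi> v\<bar> \<le> D * W1p_seminorm \<Omega> q v" using assms unfolding W_dual_def by blast
  have "\<bar>\<Phi> v - \<Psi> v\<bar> \<le> (C + D) * W1p_seminorm \<Omega> q v" if "v \<in> W1p0 \<Omega> q" for v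
    using C[OF that] D[OF that] unfolding distrib_right by linarith
  then show ?thesis using assms unfolding W_dual_def by (auto simp: right_diff_distrib)
qed

text \<open>The operator norm dominates only because the difference of two bounded operators is bounded, so that both
suprema are taken over bounded sets.\<close>

lemma bounded_operator_diff_bound:
  assumes ne: "\<exists>v\<in>W1p0 \<Omega> q. W1p_seminorm \<Omega> q v \<noteq> 0"
    and S: "bounded_operator \<Omega> p q S" and T: "bounded_operator \<Omega> p q T"
    and h: "h \<in> W1p0 \<Omega> p" and v: "v \<in> W1p0 \<Omega> q"
  shows "\<bar>S h v - T h v\<bar> \<le> operator_norm \<Omega> p q (\<lambda>h v. S h v - T h v) * W1p_seminorm \<Omega> p h * W1p_seminorm \<Omega> q v"
proof -
  let ?D = "\<lambda>h v. S h v - T h v"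
  obtain C where C: "\<And>h. h \<in> W1p0 \<Omega> p \<Longrightarrow> dual_norm \<Omega> q (S h) \<le> C * W1p_seminorm \<Omega> p h"
    using S unfolding bounded_operator_def by blast
  obtain K where K: "\<And>h. h \<in> W1p0 \<Omega> p \<Longrightarrow> dual_norm \<Omega> q (T h) \<le> K * W1p_seminorm \<Omega> p h"
    using T unfolding bounded_operator_def by blast
  have ST: "S h \<in> W_dual \<Omega> q" "T h \<in> W_dual \<Omega> q" if "h \<in> W1p0 \<Omega> p" for h
    using S T that by (auto simp: bounded_operator_def)
  have D: "dual_norm \<Omega> q (?D h) \<le> (C + K) * W1p_seminorm \<Omega> p h" if h: "h \<in> W1p0 \<Omega> p" for h
  proof (rule dual_norm_least[OF ne])
    fix v assume v: "v \<in> W1p0 \<Omega> q"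
    have "\<bar>?D h v\<bar> \<le> \<bar>S h v\<bar> + \<bar>T h v\<bar>" by simp
    also have "\<dots> \<le> dual_norm \<Omega> q (S h) * W1p_seminorm \<Omega> q v + dual_norm \<Omega> q (T h) * W1p_seminorm \<Omega> q v"
      by (intro add_mono abs_le_dual_norm ST h v)
    also have "\<dots> \<le> (C * W1p_seminorm \<Omega> p h) * W1p_seminorm \<Omega> q v + (K * W1p_seminorm \<Omega> p h) * W1p_seminorm \<Omega> q v"
      by (intro add_mono mult_right_mono C K h seminorm_nonneg)
    finally show "\<bar>?D h v\<bar> \<le> (C + K) * W1p_seminorm \<Omega> p h * W1p_seminorm \<Omega> q v" by (simp add: distrib_right)
  qed
  have v': "\<bar>?D h v\<bar> \<le> dual_norm \<Omega> q (?D h) * W1p_seminorm \<Omega> q v"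
    by (rule abs_le_dual_norm[OF W_dual_diff[OF ST[OF h]] v])
  also have "\<dots> \<le> (operator_norm \<Omega> p q ?D * W1p_seminorm \<Omega> p h) * W1p_seminorm \<Omega> q v"
  proof (rule mult_right_mono[OF _ seminorm_nonneg])
    show "dual_norm \<Omega> q (?D h) \<le> operator_norm \<Omega> p q ?D * W1p_seminorm \<Omega> p h"
    proof (cases "W1p_seminorm \<Omega> p h = 0")
      case True
      then show ?thesis using D[OF h] by simp
    next
      case False
      then have pos: "0 < W1p_seminorm \<Omega> p h" using seminorm_nonneg[of \<Omega> p h] by simp
      have bdd: "bdd_above ((\<lambda>h. dual_norm \<Omega> q (?D h) / W1p_seminorm \<Omega> p h) ` {h \<in> W1p0 \<Omega> p. W1p_seminorm \<Omega> p h \<noteq> 0})"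
      proof (rule bdd_aboveI2)
        fix h assume "h \<in> {h \<in> W1p0 \<Omega> p. W1p_seminorm \<Omega> p h \<noteq> 0}"
        then have "h \<in> W1p0 \<Omega> p" "0 < W1p_seminorm \<Omega> p h" using seminorm_nonneg[of \<Omega> p h] by auto
        then show "dual_norm \<Omega> q (?D h) / W1p_seminorm \<Omega> p h \<le> C + K" using D by (simp add: divide_le_eq)
      qed
      have "dual_norm \<Omega> q (?D h) / W1p_seminorm \<Omega> p h \<le> operator_norm \<Omega> p q ?D"
        unfolding operator_norm_def by (rule cSUP_upper[OF _ bdd]) (use h False in simp)
      then show ?thesis using pos by (simp add: divide_le_eq)
    qed
  qed
  finally show ?thesis .
qed

text \<open>The remainder along \<open>t h\<close> is bounded by an arbitrarily small multiple of \<open>\<bar>t\<bar>\<close> in the dual norm; testing against the fixed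
\<open>v\<close> gives the derivative of a real function. Membership of the values in the dual space is needed to turn
the dual norm of the remainder into a bound.\<close>

lemma frechet_directional_derivative:
  assumes F': "has_frechet_derivative_at \<Omega> p q F T w"
    and dual: "\<And>t. F (\<lambda>z. w z + t * h z) \<in> W_dual \<Omega> q"
    and h: "h \<in> W1p0 \<Omega> p" "\<And>t. (\<lambda>z. t * h z) \<in> W1p0 \<Omega> p"
    and scale: "\<And>t. W1p_seminorm \<Omega> p (\<lambda>z. t * h z) = \<bar>t\<bar> * W1p_seminorm \<Omega> p h"
    and v: "v \<in> W1p0 \<Omega> q"
  shows "((\<lambda>t. F (\<lambda>z. w z + t * h z) v) has_real_derivative T h v) (at 0)"
  unfolding DERIV_def LIM_eq
proof (intro allI impI)
  fix \<epsilon> :: real assume \<epsilon>: "0 < \<epsilon>"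
  define a where "a = W1p_seminorm \<Omega> p h"
  define m where "m = W1p_seminorm \<Omega> q v"
  have am: "0 \<le> a" "0 \<le> m" using seminorm_nonneg by (auto simp: a_def m_def)
  \<comment> \<open>the summand 1 keeps the denominator positive when \<open>h\<close> or \<open>v\<close> has seminorm zero\<close>
  define \<eta> where "\<eta> = \<epsilon> / (2 * (a * m + 1))"
  have \<eta>: "0 < \<eta>" "\<eta> * (a * m) < \<epsilon>"
  proof -
    have pos: "0 < a * m + 1" using am by (simp add: add_nonneg_pos)
    then show "0 < \<eta>" using \<epsilon> by (simp add: \<eta>_def)
    have "\<eta> * (a * m) \<le> \<eta> * (a * m + 1)" using \<open>0 < \<eta>\<close> by simp
    also have "\<dots> = \<epsilon> / 2"
    proof -
      have "\<epsilon> / (2 * K) * K = \<epsilon> / 2" if "0 < K" for K using that by simp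
      from this[OF pos] show ?thesis by (simp only: \<eta>_def)
    qed
    finally show "\<eta> * (a * m) < \<epsilon>" using \<epsilon> by simp
  qed
  have bT: "bounded_operator \<Omega> p q T" using F' by (simp add: has_frechet_derivative_at_def)
  obtain \<delta> where \<delta>: "0 < \<delta>" "\<And>h. h \<in> W1p0 \<Omega> p \<Longrightarrow> W1p_seminorm \<Omega> p h < \<delta> \<Longrightarrow>
      dual_norm \<Omega> q (\<lambda>v. F (\<lambda>z. w z + h z) v - F w v - T h v) \<le> \<eta> * W1p_seminorm \<Omega> p h"
    using F' \<eta>(1) unfolding has_frechet_derivative_at_def by blast
  have "norm ((F (\<lambda>z. w z + (0 + t) * h z) v - F (\<lambda>z. w z + 0 * h z) v) / t - T h v) < \<epsilon>"
    if t: "t \<noteq> 0" "norm (t - 0) < \<delta> / (a + 1)" for t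
  proof -
    have "\<bar>t\<bar> * a \<le> \<bar>t\<bar> * (a + 1)" by (intro mult_left_mono) auto
    also have "\<dots> < \<delta>" using t am by (simp add: less_divide_eq)
    finally have small: "W1p_seminorm \<Omega> p (\<lambda>z. t * h z) < \<delta>" by (simp add: scale a_def)
    let ?R = "\<lambda>v. F (\<lambda>z. w z + t * h z) v - F w v - T (\<lambda>z. t * h z) v"
    have "T (\<lambda>z. t * h z) \<in> W_dual \<Omega> q" using bT h(2) by (simp add: bounded_operator_def)
    moreover have "F w \<in> W_dual \<Omega> q" using dual[of 0] by simp
    ultimately have "?R \<in> W_dual \<Omega> q" using dual[of t] by (intro W_dual_diff)
    then have "\<bar>?R v\<bar> \<le> dual_norm \<Omega> q ?R * m" unfolding m_def by (rule abs_le_dual_norm[OF _ v])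
    also have "\<dots> \<le> (\<eta> * (\<bar>t\<bar> * a)) * m"
      using \<delta>(2)[OF h(2) small] am by (intro mult_right_mono) (simp_all add: scale a_def)
    also have "\<dots> = \<bar>t\<bar> * (\<eta> * (a * m))" by simp
    also have "\<dots> < \<bar>t\<bar> * \<epsilon>" using t \<eta>(2) by (intro mult_strict_left_mono) auto
    finally have R: "\<bar>?R v\<bar> < \<bar>t\<bar> * \<epsilon>" .
    have Tt: "T (\<lambda>z. t * h z) v = t * T h v" using bT h v by (simp add: bounded_operator_def)
    have "(F (\<lambda>z. w z + (0 + t) * h z) v - F (\<lambda>z. w z + 0 * h z) v) / t - T h v = ?R v / t"
      unfolding Tt using t by (simp add: diff_divide_distrib)
    then show ?thesis using R t by (simp add: divide_less_eq mult.commute)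
  qed
  then show "\<exists>s>0. \<forall>t. t \<noteq> 0 \<and> norm (t - 0) < s \<longrightarrow>
      norm ((F (\<lambda>z. w z + (0 + t) * h z) v - F (\<lambda>z. w z + 0 * h z) v) / t - T h v) < \<epsilon>"
    using \<delta>(1) am by (intro exI[of _ "\<delta> / (a + 1)"]) auto
qed

lemma inf_sup_bound:
  assumes \<beta>: "ereal \<beta> = inf_sup_constant \<Omega> p q V T"
    and h: "h \<in> V" "W1p_seminorm \<Omega> p h \<noteq> 0" 
    and K: "\<And>v. v \<in> V \<Longrightarrow> \<bar>T h v\<bar> \<le> K * W1p_seminorm \<Omega> q v"
  shows "\<beta> * W1p_seminorm \<Omega> p h \<le> K"
proof -
  have pos: "0 < W1p_seminorm \<Omega> p h" using h(2) seminorm_nonneg[of \<Omega> p h] by simp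
  have "ereal \<beta> \<le> (SUP v\<in>{v \<in> V. W1p_seminorm \<Omega> q v \<noteq> 0}. ereal (T h v / (W1p_seminorm \<Omega> p h * W1p_seminorm \<Omega> q v)))"
    unfolding \<beta> inf_sup_constant_def by (rule INF_lower) (use h in simp)
  also have "\<dots> \<le> ereal (K / W1p_seminorm \<Omega> p h)"
  proof (rule SUP_least)
    fix v assume "v \<in> {v \<in> V. W1p_seminorm \<Omega> q v \<noteq> 0}"
    then have v: "v \<in> V" "0 < W1p_seminorm \<Omega> q v" using seminorm_nonneg[of \<Omega> q v] by auto
    have "T h v \<le> K * W1p_seminorm \<Omega> q v" using K[OF v(1)] by simp
    then show "ereal (T h v / (W1p_seminorm \<Omega> p h * W1p_seminorm \<Omega> q v)) \<le> ereal (K / W1p_seminorm \<Omega> p h)"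
      using pos v(2) by (simp add: field_simps)
  qed
  finally show ?thesis using pos by (simp add: le_divide_eq)
qed

text \<open>The inf-sup constant would be infinite if there were no trial functions, and minus infinity if there were no
test functions.\<close>

lemma inf_sup_nontrivial:
  assumes \<beta>: "ereal \<beta> = inf_sup_constant \<Omega> p q V T" "0 < \<beta>"
  shows "\<exists>v\<in>V. W1p_seminorm \<Omega> q v \<noteq> 0"
proof (rule ccontr)
  assume "\<not> (\<exists>v\<in>V. W1p_seminorm \<Omega> q v \<noteq> 0)"
  then have e: "{v \<in> V. W1p_seminorm \<Omega> q v \<noteq> 0} = {}" by auto
  have "{w \<in> V. W1p_seminorm \<Omega> p w \<noteq> 0} \<noteq> {}"
  proof
    assume "{w \<in> V. W1p_seminorm \<Omega> p w \<noteq> 0} = {}"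
    then have "inf_sup_constant \<Omega> p q V T = \<infinity>"
      unfolding inf_sup_constant_def by (simp only: image_empty Inf_empty top_ereal_def)
    then show False using \<beta>(1)[symmetric] by simp
  qed
  then have "inf_sup_constant \<Omega> p q V T = - \<infinity>" unfolding inf_sup_constant_def e by (simp add: bot_ereal_def)
  then show False using \<beta>(1)[symmetric] by simp
qed

section \<open>Existence, uniqueness and the a posteriori error estimate\<close>

theorem proposition3p1:
  fixes x0 x1 y0 y1 :: real
    and \<omega> :: "real set"
    and \<Omega> :: "(real \<times> real) set"
    and p q R \<beta> Lip \<tau> \<Delta> :: real
    and xs ys :: "real list"
    and r s m k :: nat
    and X Y :: "(real \<Rightarrow> real) set"
    and V Vm :: "(real \<times> real \<Rightarrow> real) set"
    and \<phi> \<kappa> :: "nat \<Rightarrow> real \<Rightarrow> real"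
    and \<II> :: "real set set"
    and kI :: "real set \<Rightarrow> nat"
    and \<sigma> :: "real set \<Rightarrow> nat \<Rightarrow> (real \<Rightarrow> real) \<Rightarrow> real"
    and \<theta> :: "real set \<Rightarrow> nat \<Rightarrow> real \<Rightarrow> real"
    and u0 u1 u2 :: "(real \<times> real \<Rightarrow> real) \<Rightarrow> real \<times> real \<Rightarrow> real"
    and P :: "(real \<times> real \<Rightarrow> real) \<Rightarrow> real \<times> real \<Rightarrow> real"
    and f :: "(real \<times> real \<Rightarrow> real) \<Rightarrow> real"
    and A PA F PF :: "(real \<times> real \<Rightarrow> real) \<Rightarrow> (real \<times> real \<Rightarrow> real) \<Rightarrow> real"
    and dF :: "(real \<times> real \<Rightarrow> real) \<Rightarrow> (real \<times> real \<Rightarrow> real) \<Rightarrow> (real \<times> real \<Rightarrow> real) \<Rightarrow> real"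
    and pmk :: "real \<times> real \<Rightarrow> real"
  assumes domain: "x0 < x1" "y0 < y1" "\<omega> = {y0<..<y1}" "\<Omega> = {x0<..<x1} \<times> \<omega>"
    and exponents: "2 \<le> p" "1 / p + 1 / q = 1"
    \<comment> \<open>discrete spaces\<close>
    and meshes: "mesh x0 x1 xs" "mesh y0 y1 ys"
    and spaces: "V = fe_space_2d xs ys r s" "X = fe_space_1d xs r" "Y = fe_space_1d ys s"
    and reduction: "\<forall>j\<in>{1..m}. \<phi> j \<in> Y" "L2_orthonormal \<omega> m \<phi>" "Vm = reduced_space X m \<phi>"
    \<comment> \<open>operator, right-hand side and derivative\<close>
    and A: "\<forall>w. A w = component_functional \<Omega> (u0 w) (u1 w) (u2 w)"
    and A_dual: "\<forall>w\<in>W1p0 \<Omega> p. admissible_components \<Omega> q (u0 w) (u1 w) (u2 w)"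
    and f: "f \<in> W_dual \<Omega> q"
    and F: "\<forall>w v. F w v = A w v - f v"
    and dF: "\<forall>w\<in>W1p0 \<Omega> p. has_frechet_derivative_at \<Omega> p q F (dF w) w"
    \<comment> \<open>empirical projection\<close>
    and collateral: "L2_orthonormal \<omega> k \<kappa>"
    and intervals: "finite \<II>" "partition_on \<omega> \<II>" "\<forall>I\<in>\<II>. is_interval I"
    and functionals: "\<forall>I\<in>\<II>. \<forall>j\<in>{1..kI I}. linear_functional_on I (\<sigma> I j)"
    and interpolation_span: "\<forall>I\<in>\<II>. \<forall>j\<in>{1..kI I}. \<exists>c :: nat \<Rightarrow> real.
           \<theta> I j = (\<lambda>y. if y \<in> I then \<Sum>n=1..k. c n * \<kappa> n y else 0)"
    and interpolation: "\<forall>I\<in>\<II>. \<forall>i\<in>{1..kI I}. \<forall>j\<in>{1..kI I}. \<sigma> I i (\<theta> I j) = of_bool (i = j)"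
    and P: "P = empirical_projection \<omega> k \<kappa> \<II> kI \<sigma> \<theta>"
    and PA: "\<forall>w. PA w = component_functional \<Omega> (P (u0 w)) (P (u1 w)) (P (u2 w))"
    and PF: "\<forall>w v. PF w v = PA w v - f v"
    \<comment> \<open>reduced solution\<close>
    and pmk: "pmk \<in> Vm" "\<forall>v\<in>Vm. PF pmk v = 0"
    and PA_dual: "admissible_components \<Omega> q (P (u0 pmk)) (P (u1 pmk)) (P (u2 pmk))"
    \<comment> \<open>constants\<close>
    and beta: "ereal \<beta> = inf_sup_constant \<Omega> p q V (dF pmk)" "0 < \<beta>"
    and Lip: "ereal Lip = lipschitz_constant_at \<Omega> p q V dF pmk R" "0 < Lip"
    and R: "0 < R" "\<beta> / Lip \<le> R"
    and tau: "\<tau> = 2 * Lip / \<beta>\<^sup>2 *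
           (dual_norm \<Omega> q (\<lambda>v. F pmk v - PF pmk v) + dual_norm \<Omega> q (PF pmk))"
    and Delta: "\<Delta> = \<beta> / Lip * (1 - sqrt (1 - \<tau>))"
    and tau_less: "\<tau> < 1"
  shows "(\<exists>!u. u \<in> fe_ball \<Omega> p V pmk (\<beta> / Lip) \<and> (\<forall>v\<in>V. F u v = 0)) \<and>
         (\<forall>u. u \<in> fe_ball \<Omega> p V pmk (\<beta> / Lip) \<and> (\<forall>v\<in>V. F u v = 0) \<longrightarrow>
              W1p_seminorm \<Omega> p (\<lambda>z. u z - pmk z) \<le> \<Delta>)"
proof -
  define a where "a = (x0, y0)"
  define b where "b = (x1, y1)"
  have \<Omega>: "\<Omega> = box a b" using domain by (auto simp: a_def b_def mem_box Basis_prod_def)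
  have ab: "a \<bullet> i < b \<bullet> i" if "i \<in> Basis" for i using that domain by (auto simp: a_def b_def Basis_prod_def)
  have p0: "0 < p" "1 \<le> p" using exponents by auto
  have q0: "0 < q"
  proof -
    have "1 / p \<le> 1 / 2" using exponents(1) by (intro divide_left_mono) auto
    then have "0 < 1 / q" using exponents(2) by linarith
    then show ?thesis by simp
  qed
  have reg: "regular_on_box a b w" if "w \<in> V" for w
    using fe_regular[OF meshes] that spaces(1) by (simp add: a_def b_def)
  have Vp: "w \<in> W1p0 \<Omega> p" and Vq: "w \<in> W1p0 \<Omega> q" if "w \<in> V" for w
    unfolding \<Omega> using regular_on_box_W1p0[OF ab reg[OF that]] p0 q0 by auto
  have sub: "subspace V"
    unfolding subspace_def spaces(1) fun_vector_eqs using fe_space_0 fe_space_add fe_space_cmult by blast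
  have Vadd: "(\<lambda>z. u z + t * h z) \<in> V" if "u \<in> V" "h \<in> V" for u h t
    using fe_space_add fe_space_cmult that unfolding spaces(1) by blast
  obtain Z where Z: "finite Z" "\<And>w. w \<in> V \<Longrightarrow> (\<And>z. z \<in> Z \<Longrightarrow> w z = 0) \<Longrightarrow> w = (\<lambda>z. 0)"
    using fe_space_determined_by_nodes[OF meshes] unfolding spaces(1) by metis
  obtain D bb where basis: "dual_basis V D (\<lambda>z w. w z) bb"
    by (rule dual_basis_of_determining_functionals[OF sub Z(1), of "\<lambda>z w. w z"])
      (use Z(2) in \<open>auto simp: linear_functional_def fun_vector_eqs\<close>)
  have pV: "pmk \<in> V"
    using reduced_space_subset[OF spaces(2), of m \<phi> ys s] reduction(1,3) pmk(1) spaces by auto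
  have ne: "\<exists>v\<in>W1p0 \<Omega> q. W1p_seminorm \<Omega> q v \<noteq> 0"
    using inf_sup_nontrivial[OF beta] Vq by blast
  have FW: "F w \<in> W_dual \<Omega> q" if "w \<in> V" for w
  proof -
    have "A w \<in> W_dual \<Omega> q" using A_dual Vp[OF that] A by (simp add: admissible_components_def)
    then have "(\<lambda>v. A w v - f v) \<in> W_dual \<Omega> q" using f by (rule W_dual_diff)
    then show ?thesis using F by (simp add: fun_eq_iff[symmetric] ext[of "F w" "\<lambda>v. A w v - f v"])
  qed
  have PFW: "PF pmk \<in> W_dual \<Omega> q"
  proof -
    have "PA pmk \<in> W_dual \<Omega> q" using PA_dual PA by (simp add: admissible_components_def)
    then have "(\<lambda>v. PA pmk v - f v) \<in> W_dual \<Omega> q" using f by (rule W_dual_diff)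
    moreover have "PF pmk = (\<lambda>v. PA pmk v - f v)" using PF by (intro ext) simp
    ultimately show ?thesis by simp
  qed
  have dFb: "bounded_operator \<Omega> p q (dF w)" if "w \<in> V" for w
    using dF Vp[OF that] by (simp add: has_frechet_derivative_at_def)
  define \<rho> where "\<rho> = dual_norm \<Omega> q (\<lambda>v. F pmk v - PF pmk v) + dual_norm \<Omega> q (PF pmk)"
  have FPF: "(\<lambda>v. F pmk v - PF pmk v) \<in> W_dual \<Omega> q" by (rule W_dual_diff[OF FW[OF pV] PFW])
  have Nadd: "W1p_seminorm \<Omega> p (u + v) \<le> W1p_seminorm \<Omega> p u + W1p_seminorm \<Omega> p v" if "u \<in> V" "v \<in> V" for u v
    unfolding fun_vector_eqs \<Omega> by (rule regular_seminorm_triangle[OF reg[OF that(1)] reg[OF that(2)] p0(2)])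
  have Nscale: "W1p_seminorm \<Omega> p (c *\<^sub>R u) = \<bar>c\<bar> * W1p_seminorm \<Omega> p u" if "u \<in> V" for u c
    unfolding fun_vector_eqs \<Omega> by (rule regular_seminorm_cmult[OF reg[OF that] p0(1)])
  have Ndef: "u = 0" if "u \<in> V" "W1p_seminorm \<Omega> p u = 0" for u
    using regular_seminorm_definite[OF reg[OF that(1)] p0(1)] that(2) unfolding fun_vector_eqs \<Omega> by blast
  have dFlin: "linear_functional V (dF w h)" "linear_functional V (\<lambda>h. dF w h v)"
    if "w \<in> V" "h \<in> V" "v \<in> V" for w h v
  proof -
    have "dF w h \<in> W_dual \<Omega> q" using dFb[OF that(1)] Vp[OF that(2)] by (simp add: bounded_operator_def)
    then show "linear_functional V (dF w h)"
      using Vq unfolding linear_functional_def fun_vector_eqs W_dual_def by blast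
    show "linear_functional V (\<lambda>h. dF w h v)"
      using dFb[OF that(1)] Vp Vq[OF that(3)] unfolding linear_functional_def fun_vector_eqs bounded_operator_def by blast
  qed
  interpret N: discrete_newton V "W1p_seminorm \<Omega> p" "W1p_seminorm \<Omega> q" F dF pmk \<beta> Lip \<rho> D "\<lambda>z w. w z" bb
  proof
    show "subspace V" by (rule sub)
    show "dual_basis V D (\<lambda>z w. w z) bb" by (rule basis)
    show "pmk \<in> V" by (rule pV)
    show "0 \<le> W1p_seminorm \<Omega> q v" for v by (rule seminorm_nonneg)
    show "linear_functional V (F w)" if "w \<in> V" for w
      using FW[OF that] Vq unfolding linear_functional_def fun_vector_eqs W_dual_def by blast
    show "linear_functional V (dF w h)" if "w \<in> V" "h \<in> V" for w h
      using dFlin[OF that that(1)] by blast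
    show "linear_functional V (\<lambda>h. dF w h v)" if "w \<in> V" "v \<in> V" for w v
      using dFlin(2)[OF that(1) that(1) that(2)] .
    show "((\<lambda>t. F (w + t *\<^sub>R h) v) has_real_derivative dF w h v) (at 0)" if "w \<in> V" "h \<in> V" "v \<in> V" for w h v
      unfolding fun_vector_eqs
    proof (rule frechet_directional_derivative[where F = F and T = "dF w" and w = w and h = h and v = v])
      show "has_frechet_derivative_at \<Omega> p q F (dF w) w" using dF Vp[OF that(1)] by blast
      show "F (\<lambda>z. w z + t * h z) \<in> W_dual \<Omega> q" for t by (rule FW[OF Vadd[OF that(1,2)]])
      show "(\<lambda>z. t * h z) \<in> W1p0 \<Omega> p" for t
        using Vp[OF subspace_scale[OF sub that(2), of t]] unfolding fun_vector_eqs .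
      show "W1p_seminorm \<Omega> p (\<lambda>z. t * h z) = \<bar>t\<bar> * W1p_seminorm \<Omega> p h" for t
        using Nscale[OF that(2), of t] unfolding fun_vector_eqs .
    qed (use Vp Vq that in auto)
    obtain C where C: "\<And>h. h \<in> W1p0 \<Omega> p \<Longrightarrow> dual_norm \<Omega> q (dF pmk h) \<le> C * W1p_seminorm \<Omega> p h"
      using dFb[OF pV] unfolding bounded_operator_def by blast
    have "\<bar>dF pmk h v\<bar> \<le> C * W1p_seminorm \<Omega> p h * W1p_seminorm \<Omega> q v" if "h \<in> V" "v \<in> V" for h v
    proof -
      have "dF pmk h \<in> W_dual \<Omega> q" using dFb[OF pV] Vp[OF that(1)] by (simp add: bounded_operator_def)
      then have "\<bar>dF pmk h v\<bar> \<le> dual_norm \<Omega> q (dF pmk h) * W1p_seminorm \<Omega> q v"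
        using Vq[OF that(2)] by (rule abs_le_dual_norm)
      also have "\<dots> \<le> C * W1p_seminorm \<Omega> p h * W1p_seminorm \<Omega> q v"
        by (intro mult_right_mono C Vp that seminorm_nonneg)
      finally show ?thesis .
    qed
    then show "\<exists>C. \<forall>h\<in>V. \<forall>v\<in>V. \<bar>dF pmk h v\<bar> \<le> C * W1p_seminorm \<Omega> p h * W1p_seminorm \<Omega> q v" by blast
    show "\<beta> * W1p_seminorm \<Omega> p h \<le> K" if h: "h \<in> V" and K: "\<And>v. v \<in> V \<Longrightarrow> \<bar>dF pmk h v\<bar> \<le> K * W1p_seminorm \<Omega> q v" for h K
    proof (cases "W1p_seminorm \<Omega> p h = 0")
      case True
      obtain v where v: "v \<in> V" "W1p_seminorm \<Omega> q v \<noteq> 0" using inf_sup_nontrivial[OF beta] by blast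
      have "0 \<le> K * W1p_seminorm \<Omega> q v" using K[OF v(1)] by (smt (verit) abs_ge_zero)
      then have "0 \<le> K" using v(2) seminorm_nonneg[of \<Omega> q v] by (simp add: zero_le_mult_iff)
      then show ?thesis using True by simp
    next
      case False
      show ?thesis by (rule inf_sup_bound[OF beta(1) h False K])
    qed
    show "\<bar>dF w h v - dF pmk h v\<bar> \<le> Lip * W1p_seminorm \<Omega> p (w - pmk) * W1p_seminorm \<Omega> p h * W1p_seminorm \<Omega> q v"
      if "w \<in> V" "h \<in> V" "v \<in> V" and near: "W1p_seminorm \<Omega> p (w - pmk) \<le> \<beta> / Lip" for w h v
    proof (cases "W1p_seminorm \<Omega> p (w - pmk) = 0")
      case True
      then have "w - pmk = 0" using Ndef subspace_diff[OF sub that(1) pV] by blast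
      then have "w = pmk" by simp
      then show ?thesis using True by simp
    next
      case False
      then have pos: "0 < W1p_seminorm \<Omega> p (w - pmk)" using seminorm_nonneg[of \<Omega> p "w - pmk"] by simp
      let ?op = "operator_norm \<Omega> p q (\<lambda>h v. dF w h v - dF pmk h v)"
      have "ereal (?op / W1p_seminorm \<Omega> p (\<lambda>z. w z - pmk z)) \<le> ereal Lip"
        unfolding Lip(1) lipschitz_constant_at_def
        by (rule SUP_upper) (use that(1) near False R(2) in \<open>auto simp: fe_ball_def fun_vector_eqs\<close>)
      then have op: "?op \<le> Lip * W1p_seminorm \<Omega> p (w - pmk)"
        using pos by (simp add: divide_le_eq fun_vector_eqs)
      have "\<bar>dF w h v - dF pmk h v\<bar> \<le> ?op * W1p_seminorm \<Omega> p h * W1p_seminorm \<Omega> q v"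
        by (rule bounded_operator_diff_bound[OF ne dFb[OF that(1)] dFb[OF pV] Vp[OF that(2)] Vq[OF that(3)]])
      also have "\<dots> \<le> Lip * W1p_seminorm \<Omega> p (w - pmk) * W1p_seminorm \<Omega> p h * W1p_seminorm \<Omega> q v"
        by (intro mult_right_mono op seminorm_nonneg)
      finally show ?thesis .
    qed
    show "\<bar>F pmk v\<bar> \<le> \<rho> * W1p_seminorm \<Omega> q v" if "v \<in> V" for v
      using abs_le_dual_norm[OF FPF Vq[OF that]] abs_le_dual_norm[OF PFW Vq[OF that]]
      unfolding \<rho>_def distrib_right by linarith
    show "0 < \<beta>" "0 < Lip" by (rule beta(2), rule Lip(2))
    show "0 \<le> \<rho>" unfolding \<rho>_def using dual_norm_nonneg[OF ne] FPF PFW by (simp add: add_nonneg_nonneg)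
    show "2 * Lip / \<beta>\<^sup>2 * \<rho> < 1" using tau tau_less by (simp add: \<rho>_def)
  qed (use Nadd Nscale Ndef in auto)
  have "N.\<tau> = 2 * Lip / \<beta>\<^sup>2 * \<rho>" by (rule N.\<tau>_def)
  also have "\<dots> = \<tau>" by (simp add: tau \<rho>_def)
  finally have "N.\<tau> = \<tau>" .
  then have \<Delta>: "N.\<Delta> = \<Delta>" unfolding N.\<Delta>_def Delta by simp
  have ball: "u \<in> fe_ball \<Omega> p V pmk (\<beta> / Lip) \<longleftrightarrow> u \<in> V \<and> W1p_seminorm \<Omega> p (u - pmk) \<le> \<beta> / Lip" for u
    by (simp add: fe_ball_def fun_vector_eqs)
  obtain u where u: "u \<in> V" "W1p_seminorm \<Omega> p (u - pmk) \<le> N.\<Delta>" "\<forall>v\<in>V. F u v = 0"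
    by (rule N.solution_exists)
  have "\<exists>!u. u \<in> fe_ball \<Omega> p V pmk (\<beta> / Lip) \<and> (\<forall>v\<in>V. F u v = 0)"
    unfolding ball
  proof (rule ex1I[of _ u])
    show "(u \<in> V \<and> W1p_seminorm \<Omega> p (u - pmk) \<le> \<beta> / Lip) \<and> (\<forall>v\<in>V. F u v = 0)"
      using u N.\<Delta>_properties(2) by simp
    fix w assume "(w \<in> V \<and> W1p_seminorm \<Omega> p (w - pmk) \<le> \<beta> / Lip) \<and> (\<forall>v\<in>V. F w v = 0)"
    then show "w = u" using N.solution_unique[of w u] u N.\<Delta>_properties(2) by simp
  qed
  moreover have "W1p_seminorm \<Omega> p (\<lambda>z. u z - pmk z) \<le> \<Delta>"
    if "u \<in> fe_ball \<Omega> p V pmk (\<beta> / Lip)" "\<forall>v\<in>V. F u v = 0" for u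
    using N.solution_bound[of u] that unfolding ball \<Delta> fun_vector_eqs by simp
  ultimately show ?thesis by blast
qed

end
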